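(* Let $A_{\mathrm{can}}\in\mathbb C^{n\times n}$ be a canonical matrix for *congruence, i.e. a matrix of the form $$A_{\mathrm{can}}=\bigoplus_i H_{2p_i}(\lambda_i)\ \oplus\ \bigoplus_j\mu_j\Delta_{q_j}\ \oplus\ \bigoplus_l J_{r_l}(0),\qquad r_1\ge r_2\ge\cdots,$$ with all $|\lambda_i|>1$ and all $|\mu_j|=1$, and let $\mathcal D=\mathcal D\langle A_{\mathrm{can}}\rangle$ be the $(0,*,\circ,\bullet)$ matrix associated with it in the context. Then the simplest $\mathbb R$-deformation $A_{\mathrm{can}}+\mathcal D(x\cup y)$ of $A_{\mathrm{can}}$ is miniversal.
   Context: **$\mathbb R$-deformations.** An $\mathbb R$-deformation of $A\in\mathbb C^{n\times n}$ with parameter space $\mathbb R^r$ is a (real-)analytic map $\mathcal A$ from a neighborhood of $\underline 0$ in $\mathbb R^r$ to $\mathbb C^{n\times n}$ with $\mathcal A(\underline 0)=A$. Two $\mathbb R$-deformations with the same parameter space are considered equal if they coincide on some neighborhood of $\underline 0$. $\mathbb R$-deformations $\mathcal A,\mathcal B$ of $A$ with the same parameter space $\mathbb R^r$ are *congruent if there is an $\mathbb R$-deformation $\mathcal S$ of $I_n$ with parameter space $\mathbb R^r$ such that $\mathcal S(\underline x)^*\mathcal A(\underline x)\mathcal S(\underline x)=\mathcal B(\underline x)$ for all $\underline x$ in a neighborhood of $\underline 0$ ($S^*$ is the conjugate transpose). If $\mathcal A$ and $\mathcal B$ are $\mathbb R$-deformations of $A$ with parameter spaces $\mathbb R^r$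 and $\mathbb R^s$, then $\mathcal B$ is embedded into $\mathcal A$ if there is an analytic map $\varphi:(\mathbb R^s,\underline 0)\to(\mathbb R^r,\underline 0)$ (defined near $\underline 0$, $\varphi(\underline 0)=\underline 0$) with $\mathcal B(\underline y)=\mathcal A(\varphi(\underline y))$ for all $\underline y$ in a neighborhood of $\underline 0\in\mathbb R^s$. An $\mathbb R$-deformation $\mathcal A$ of $A$ with parameter space $\mathbb R^r$ is versal if every $\mathbb R$-deformation of $A$ is *congruent to an $\mathbb R$-deformation of $A$ that is embedded into $\mathcal A$; it is miniversal if it is versal and there is no versal $\mathbb R$-deformation of $A$ whose parameter space has dimension less than $r$. **Canonical blocks.** $J_n(\lambda)$ is the $n\times n$ upper triangular Jordan block with eigenvalue $\lambda$ (ones on the superdiagonal). $\Delta_n$ is the $n\times n$ matrix with $(j,n+1-j)$ entry $1$ for $j=1,\dots,n$, $(j,n+2-j)$ entry $i=\sqrt{-1}$ for $j=2,\dots,n$, and all other entries $0$. $H_{2m}(\lambda):=\begin{bmatrix} 0 & I_m \\ J_m(\lambda) & 0 \end{bmatrix}$. **$(0,*,\circ,\bullet)$ matrices and simplest deformations.** A $(0,*,\circ,\bullet)$ matrix is a matrix each of whose entries is one of the symbols $0,*,\circ,\bullet$. For an $n\times n$ such matrix $\mathcal D$, $\mathcal D(x\cup y)$ is the parameter matrix obtained from $\mathcal D$ by replacing each $(k,l)$ entry $*$ by $x_{kl}+iy_{kl}$, each $(k,l)$ entry $\circ$ by $x_{kl}$, and each $(k,l)$ entry $\bullet$ by $iy_{kl}$,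 where all $x_{kl},y_{kl}$ are independent real parameters. For an $n\times n$ matrix $A$, the $\mathbb R$-deformation $A+\mathcal D(x\cup y)$ (whose parameter space is $\mathbb R^d$ with $d$ = number of circles and bullets plus twice the number of stars in $\mathcal D$) is called simplest. The following $(0,*,\circ,\bullet)$ matrices are used (entries not mentioned are $0$): - $0^{\swarrow}$ of size $m\times n$: all entries of the first column are $*$ if $m\le n$; all entries of the last row are $*$ if $m\ge n$ (either form may be taken if $m=n$). - $0^{\nearrow}$ of size $m\times n$: all entries of the last column are $*$ if $m\le n$; all entries of the first row are $*$ if $m\ge n$ (either if $m=n$). - $0^{\nwarrow}$ of size $m\times n$: all entries of the first column are $*$ if $m\le n$; all entries of the first row are $*$ if $m\ge n$ (either if $m=n$). - $0^{\mathrm{alt}}$ of size $m\times n$: if $m\le n$, the entries $(m,1),(m-2,1),(m-4,1),\dots$ of the first column are $*$; if $m\ge n$, the entries $(m,1),(m,3),(m,5),\dots$ of the last row are $*$ (either if $m=n$). - $0^{\circ}$ of size $n\times n$: $\operatorname{diag}( *,\dots,*,0,\dots,0)$ with $k$ stars if $n=2k$; $\operatorname{diag}( *,\dots,*,\circ,0,\dots,0)$ with $k$ stars followed by one $\circ$ and $k$ zeros if $n=2k+1$. - $0^{\bullet}$ of size $n\times n$: the same as $0^\circ$ with $\circ$ replaced by $\bullet$. - $0^{\updownarrow}$ of size $m\times n$: either the matrix whose first row consists of stars, or the matrix whose last row consists of stars (either form may be taken). - $\mathcal P_{mn}$ of size $m\times n$, $m\le n$: the entries $(m,m+2),(m,m+3),\dots,(m,n)$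 are $*$ (so there are $n-m-1$ stars if $m<n$, none if $m=n$). **The matrix $\mathcal D\langle A_{\mathrm{can}}\rangle$.** Write $A_{\mathrm{can}}=A_1\oplus\dots\oplus A_t$ with the summands in the order displayed in the claim (first the $H$'s, then the $\mu\Delta$'s, then the $J(0)$'s with nonincreasing sizes). $\mathcal D\langle A_{\mathrm{can}}\rangle=[\mathcal D_{ij}]_{i,j=1}^t$ is partitioned conformally with $A_{\mathrm{can}}$. Write $\mathcal D\langle A_i\rangle:=\mathcal D_{ii}$ and $\mathcal D\langle A_i,A_j\rangle:=(\mathcal D_{ji},\mathcal D_{ij})$ for $i<j$. With $|\lambda|,|\lambda'|>1$ and $|\mu|=|\mu'|=1$ the blocks are: (i) Diagonal blocks: $\mathcal D\langle H_{2m}(\lambda)\rangle=\begin{bmatrix} 0 & 0 \\ 0^{\swarrow} & 0 \end{bmatrix}$ (with $m\times m$ blocks); $\mathcal D\langle\mu\Delta_n\rangle=0^{\circ}$ if $\mu\notin\mathbb R$, and $=0^{\bullet}$ if $\mu\in\mathbb R$ ($0^{\bullet}$ can be used instead of $0^{\circ}$ if $\mu\notin\mathbb R\cup i\mathbb R$); $\mathcal D\langle J_n(0)\rangle=0^{\mathrm{alt}}$. (ii) Off-diagonal blocks for summands of the same type: $\mathcal D\langle H_{2m}(\lambda),H_{2n}(\lambda')\rangle=(0,0)$ if $\lambda\ne\lambda'$, and $=\left(\begin{bmatrix} 0 & 0^{\nearrow} \\ 0^{\swarrow} & 0 \end{bmatrix},0\right)$ (with $n\times m$ blocks) if $\lambda=\lambda'$;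 $\mathcal D\langle\mu\Delta_m,\mu'\Delta_n\rangle=(0,0)$ if $\mu\ne\pm\mu'$, and $=(0^{\nwarrow},0)$ if $\mu=\pm\mu'$; for $m\ge n$: $\mathcal D\langle J_m(0),J_n(0)\rangle=(0^{\mathrm{alt}},0^{\mathrm{alt}})$ if $n$ is even, and $=(0^{\mathrm{alt}}+\mathcal P_{nm},\,0^{\mathrm{alt}})$ if $n$ is odd (the sum means that stars are placed at all positions having a star in $0^{\mathrm{alt}}$ or in $\mathcal P_{nm}$). (iii) Off-diagonal blocks for summands of distinct types: $\mathcal D\langle H_{2m}(\lambda),\mu\Delta_n\rangle=(0,0)$; $\mathcal D\langle H_{2m}(\lambda),J_n(0)\rangle$ and $\mathcal D\langle\mu\Delta_m,J_n(0)\rangle$ are equal to $(0,0)$ if $n$ is even and to $(0^{\updownarrow},0)$ if $n$ is odd. Sizes of all blocks are determined by the conformal partition. *)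

theory Defs
  imports
    "HOL-Analysis.Analysis"
    "Jordan_Normal_Form.Jordan_Normal_Form"
    "Jordan_Normal_Form.Schur_Decomposition"
begin

section \<open>Real-analytic germs on \<open>\<real>\<^sup>r\<close>\<close>

text \<open>
  The dimension of a parameter space is bound by quantifiers inside the notions of versality and
  miniversality, so \<open>\<real>\<^sup>r\<close> is the topological space \<^const>\<open>Euclidean_space\<close> \<open>r\<close>, whose points are the
  functions \<open>x :: nat \<Rightarrow> real\<close> with \<open>x i = 0\<close> for \<open>i \<ge> r\<close>. Values of maps at other functions are
  irrelevant.
\<close>

abbreviation origin :: "nat \<Rightarrow> real" where
  "origin \<equiv> (\<lambda>_. 0)"

abbreviation near :: "nat \<Rightarrow> (nat \<Rightarrow> real) \<Rightarrow> (nat \<Rightarrow> real) filter" where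
  "near r p \<equiv> nhdsin (Euclidean_space r) p"

definition multi_indices :: "nat \<Rightarrow> (nat \<Rightarrow> nat) set" where
  "multi_indices r = {\<alpha>. \<forall>i\<ge>r. \<alpha> i = 0}"

definition real_analytic_at ::
    "nat \<Rightarrow> ((nat \<Rightarrow> real) \<Rightarrow> 'a::real_normed_vector) \<Rightarrow> (nat \<Rightarrow> real) \<Rightarrow> bool" where
  "real_analytic_at r f p \<longleftrightarrow>
     (\<exists>c. \<forall>\<^sub>F x in near r p.
        ((\<lambda>\<alpha>. (\<Prod>i<r. (x i - p i) ^ \<alpha> i) *\<^sub>R c \<alpha>) has_sum f x) (multi_indices r))"

section \<open>\<open>\<real>\<close>-deformations\<close>

text \<open>
  A deformation is represented by a total function of which only the germ at the origin matters:
  every notion below is invariant under changes away from a neighbourhood of the origin.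
\<close>

definition R_deformation ::
    "nat \<Rightarrow> nat \<Rightarrow> complex mat \<Rightarrow> ((nat \<Rightarrow> real) \<Rightarrow> complex mat) \<Rightarrow> bool" where
  "R_deformation n r A \<A> \<longleftrightarrow>
     (\<forall>\<^sub>F x in near r origin.
        \<A> x \<in> carrier_mat n n \<and>
        (\<forall>i<n. \<forall>j<n. real_analytic_at r (\<lambda>y. \<A> y $$ (i, j)) x)) \<and>
     \<A> origin = A"

definition star_congruent ::
    "nat \<Rightarrow> nat \<Rightarrow> ((nat \<Rightarrow> real) \<Rightarrow> complex mat) \<Rightarrow> ((nat \<Rightarrow> real) \<Rightarrow> complex mat) \<Rightarrow> bool" where
  "star_congruent n r \<A> \<B> \<longleftrightarrow>
     (\<exists>\<S>. R_deformation n r (1\<^sub>m n) \<S> \<and>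
        (\<forall>\<^sub>F x in near r origin. mat_adjoint (\<S> x) * \<A> x * \<S> x = \<B> x))"

text \<open>\<open>embedded s \<B> r \<A>\<close>: the deformation \<open>\<B>\<close> with parameter space \<open>\<real>\<^sup>s\<close> is embedded into the
  deformation \<open>\<A>\<close> with parameter space \<open>\<real>\<^sup>r\<close>.\<close>

definition embedded ::
    "nat \<Rightarrow> ((nat \<Rightarrow> real) \<Rightarrow> complex mat) \<Rightarrow> nat \<Rightarrow> ((nat \<Rightarrow> real) \<Rightarrow> complex mat) \<Rightarrow> bool" where
  "embedded s \<B> r \<A> \<longleftrightarrow>
     (\<exists>\<phi> :: (nat \<Rightarrow> real) \<Rightarrow> (nat \<Rightarrow> real).
        (\<forall>\<^sub>F y in near s origin.
           \<phi> y \<in> topspace (Euclidean_space r) \<and>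
           (\<forall>i<r. real_analytic_at s (\<lambda>z. \<phi> z i) y)) \<and>
        \<phi> origin = origin \<and>
        (\<forall>\<^sub>F y in near s origin. \<B> y = \<A> (\<phi> y)))"

definition versal ::
    "nat \<Rightarrow> nat \<Rightarrow> complex mat \<Rightarrow> ((nat \<Rightarrow> real) \<Rightarrow> complex mat) \<Rightarrow> bool" where
  "versal n r A \<A> \<longleftrightarrow>
     R_deformation n r A \<A> \<and>
     (\<forall>s \<B>. R_deformation n s A \<B> \<longrightarrow>
        (\<exists>\<C>. R_deformation n s A \<C> \<and> star_congruent n s \<B> \<C> \<and> embedded s \<C> r \<A>))"

definition miniversal ::
    "nat \<Rightarrow> nat \<Rightarrow> complex mat \<Rightarrow> ((nat \<Rightarrow> real) \<Rightarrow> complex mat) \<Rightarrow> bool" where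
  "miniversal n r A \<A> \<longleftrightarrow>
     versal n r A \<A> \<and> \<not> (\<exists>r' \<A>'. r' < r \<and> versal n r' A \<A>')"

section \<open>Canonical matrices for *congruence\<close>

text \<open>\<open>HBlock m \<lambda>\<close> stands for \<open>H\<^bsub>2m\<^esub>(\<lambda>)\<close> (of size \<open>2m\<close>), \<open>DeltaBlock n \<mu>\<close> for \<open>\<mu>\<Delta>\<^sub>n\<close>, and
  \<open>JBlock n\<close> for \<open>J\<^sub>n(0)\<close>.\<close>

datatype summand = HBlock nat complex | DeltaBlock nat complex | JBlock nat

text \<open>Matrices are indexed from 0, so the antidiagonal is \<open>k + l + 1 = n\<close>.\<close>

definition Delta_mat :: "nat \<Rightarrow> complex mat" where
  "Delta_mat n = mat n n (\<lambda>(k, l). if k + l + 1 = n then 1 else if k + l = n then \<i> else 0)"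

definition H_mat :: "nat \<Rightarrow> complex \<Rightarrow> complex mat" where
  "H_mat m \<nu> = four_block_mat (0\<^sub>m m m) (1\<^sub>m m) (jordan_block m \<nu>) (0\<^sub>m m m)"

fun summand_mat :: "summand \<Rightarrow> complex mat" where
  "summand_mat (HBlock m \<nu>) = H_mat m \<nu>"
| "summand_mat (DeltaBlock n \<mu>) = \<mu> \<cdot>\<^sub>m Delta_mat n"
| "summand_mat (JBlock n) = jordan_block n 0"

fun summand_size :: "summand \<Rightarrow> nat" where
  "summand_size (HBlock m \<nu>) = 2 * m"
| "summand_size (DeltaBlock n \<mu>) = n"
| "summand_size (JBlock n) = n"

definition canonical_mat :: "summand list \<Rightarrow> complex mat" where
  "canonical_mat As = diag_block_mat (map summand_mat As)"

section \<open>\<open>(0,*,\<circ>,\<bullet>)\<close> matrices\<close>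

datatype symb = Zero | Star | Circ | Bullet

text \<open>The predicate \<open>P\<close> refers to 1-based row and column numbers.\<close>

definition stars :: "nat \<Rightarrow> nat \<Rightarrow> (nat \<Rightarrow> nat \<Rightarrow> bool) \<Rightarrow> symb mat" where
  "stars m n P = mat m n (\<lambda>(k, l). if P (k + 1) (l + 1) then Star else Zero)"

definition zeros :: "nat \<Rightarrow> nat \<Rightarrow> symb mat" where
  "zeros m n = stars m n (\<lambda>k l. False)"

text \<open>Where the construction leaves a choice between two forms, the following are the sets of all
  admissible forms. Different occurrences may be chosen independently.\<close>

definition z_sw :: "nat \<Rightarrow> nat \<Rightarrow> symb mat set" where
  "z_sw m n = {Z. (m \<le> n \<and> Z = stars m n (\<lambda>k l. l = 1)) \<or>
                  (m \<ge> n \<and> Z = stars m n (\<lambda>k l. k = m))}"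

definition z_ne :: "nat \<Rightarrow> nat \<Rightarrow> symb mat set" where
  "z_ne m n = {Z. (m \<le> n \<and> Z = stars m n (\<lambda>k l. l = n)) \<or>
                  (m \<ge> n \<and> Z = stars m n (\<lambda>k l. k = 1))}"

definition z_nw :: "nat \<Rightarrow> nat \<Rightarrow> symb mat set" where
  "z_nw m n = {Z. (m \<le> n \<and> Z = stars m n (\<lambda>k l. l = 1)) \<or>
                  (m \<ge> n \<and> Z = stars m n (\<lambda>k l. k = 1))}"

definition z_alt :: "nat \<Rightarrow> nat \<Rightarrow> symb mat set" where
  "z_alt m n = {Z. (m \<le> n \<and> Z = stars m n (\<lambda>k l. l = 1 \<and> even (m - k))) \<or>
                   (m \<ge> n \<and> Z = stars m n (\<lambda>k l. k = m \<and> odd l))}"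

definition z_updown :: "nat \<Rightarrow> nat \<Rightarrow> symb mat set" where
  "z_updown m n = {stars m n (\<lambda>k l. k = 1), stars m n (\<lambda>k l. k = m)}"

definition P_stars :: "nat \<Rightarrow> nat \<Rightarrow> symb mat" where
  "P_stars m n = stars m n (\<lambda>k l. k = m \<and> m + 2 \<le> l)"

text \<open>\<open>z_diag Circ n\<close> is \<open>0\<^sup>\<circ>\<close> and \<open>z_diag Bullet n\<close> is \<open>0\<^sup>\<bullet>\<close>.\<close>

definition z_diag :: "symb \<Rightarrow> nat \<Rightarrow> symb mat" where
  "z_diag s n = mat n n (\<lambda>(k, l).
     if k \<noteq> l then Zero
     else if k < n div 2 then Star
     else if k = n div 2 \<and> odd n then s
     else Zero)"

definition join_stars :: "symb mat \<Rightarrow> symb mat \<Rightarrow> symb mat" where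
  "join_stars Z Z' = mat (dim_row Z) (dim_col Z)
     (\<lambda>ij. if Z $$ ij = Star \<or> Z' $$ ij = Star then Star else Zero)"

section \<open>The matrix \<open>\<D>\<langle>A\<^sub>c\<^sub>a\<^sub>n\<rangle>\<close>\<close>

fun D_diag :: "summand \<Rightarrow> symb mat set" where
  "D_diag (HBlock m \<nu>) =
     {four_block_mat (zeros m m) (zeros m m) Z (zeros m m) |Z. Z \<in> z_sw m m}"
| "D_diag (DeltaBlock n \<mu>) =
     (if \<mu> \<in> \<real> then {z_diag Bullet n}
      else if Re \<mu> = 0 then {z_diag Circ n}
      else {z_diag Circ n, z_diag Bullet n})"
| "D_diag (JBlock n) = z_alt n n"

text \<open>For \<open>i < j\<close>, the set of admissible pairs \<open>(\<D>\<^bsub>ji\<^esub>, \<D>\<^bsub>ij\<^esub>)\<close>. Pairs of types that do not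
  occur in this order get the empty set.\<close>

fun D_off :: "summand \<Rightarrow> summand \<Rightarrow> (symb mat \<times> symb mat) set" where
  "D_off (HBlock m \<nu>) (HBlock n \<nu>') =
     (if \<nu> = \<nu>'
      then {(four_block_mat (zeros n m) Z Z' (zeros n m), zeros (2 * m) (2 * n)) |Z Z'.
              Z \<in> z_ne n m \<and> Z' \<in> z_sw n m}
      else {(zeros (2 * n) (2 * m), zeros (2 * m) (2 * n))})"
| "D_off (DeltaBlock m \<mu>) (DeltaBlock n \<mu>') =
     (if \<mu> = \<mu>' \<or> \<mu> = - \<mu>' then z_nw n m \<times> {zeros m n}
      else {(zeros n m, zeros m n)})"
| "D_off (JBlock m) (JBlock n) =
     (if n > m then {}
      else if even n then z_alt n m \<times> z_alt m n
      else {join_stars Z (P_stars n m) |Z. Z \<in> z_alt n m} \<times> z_alt m n)"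
| "D_off (HBlock m \<nu>) (DeltaBlock n \<mu>) = {(zeros n (2 * m), zeros (2 * m) n)}"
| "D_off (HBlock m \<nu>) (JBlock n) =
     (if even n then {(zeros n (2 * m), zeros (2 * m) n)}
      else z_updown n (2 * m) \<times> {zeros (2 * m) n})"
| "D_off (DeltaBlock m \<mu>) (JBlock n) =
     (if even n then {(zeros n m, zeros m n)}
      else z_updown n m \<times> {zeros m n})"
| "D_off _ _ = {}"

definition block_offset :: "summand list \<Rightarrow> nat \<Rightarrow> nat" where
  "block_offset As i = sum_list (map summand_size (take i As))"

definition subblock :: "summand list \<Rightarrow> 'a mat \<Rightarrow> nat \<Rightarrow> nat \<Rightarrow> 'a mat" where
  "subblock As D i j = mat (summand_size (As ! i)) (summand_size (As ! j))
     (\<lambda>(k, l). D $$ (block_offset As i + k, block_offset As j + l))"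

text \<open>The set of all matrices \<open>\<D>\<langle>A\<^sub>1 \<oplus> \<dots> \<oplus> A\<^sub>t\<rangle>\<close>, one for each way of making the choices.\<close>

definition D_matrices :: "summand list \<Rightarrow> symb mat set" where
  "D_matrices As =
     {D \<in> carrier_mat (block_offset As (length As)) (block_offset As (length As)).
        (\<forall>i<length As. subblock As D i i \<in> D_diag (As ! i)) \<and>
        (\<forall>j<length As. \<forall>i<j. (subblock As D j i, subblock As D i j) \<in> D_off (As ! i) (As ! j))}"

section \<open>Simplest deformations\<close>

text \<open>\<open>X k l\<close> and \<open>Y k l\<close> are the names of the parameters \<open>x\<^bsub>kl\<^esub>\<close> and \<open>y\<^bsub>kl\<^esub>\<close>.\<close>

datatype param = X nat nat | Y nat nat

definition params :: "symb mat \<Rightarrow> param set" where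
  "params D =
     {X k l |k l. k < dim_row D \<and> l < dim_col D \<and> D $$ (k, l) \<in> {Star, Circ}} \<union>
     {Y k l |k l. k < dim_row D \<and> l < dim_col D \<and> D $$ (k, l) \<in> {Star, Bullet}}"

definition param_mat :: "symb mat \<Rightarrow> (param \<Rightarrow> real) \<Rightarrow> complex mat" where
  "param_mat D v = mat (dim_row D) (dim_col D) (\<lambda>(k, l).
     case D $$ (k, l) of
       Zero \<Rightarrow> 0
     | Star \<Rightarrow> complex_of_real (v (X k l)) + \<i> * complex_of_real (v (Y k l))
     | Circ \<Rightarrow> complex_of_real (v (X k l))
     | Bullet \<Rightarrow> \<i> * complex_of_real (v (Y k l)))"

text \<open>The numbering \<open>e\<close> identifies the parameters with the coordinates of the parameter space.\<close>

definition simplest_deformation ::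
    "complex mat \<Rightarrow> symb mat \<Rightarrow> (param \<Rightarrow> nat) \<Rightarrow> (nat \<Rightarrow> real) \<Rightarrow> complex mat" where
  "simplest_deformation A D e x = A + param_mat D (\<lambda>p. x (e p))"

definition symb_count :: "symb \<Rightarrow> symb mat \<Rightarrow> nat" where
  "symb_count s D = card {(k, l). k < dim_row D \<and> l < dim_col D \<and> D $$ (k, l) = s}"

definition num_params :: "symb mat \<Rightarrow> nat" where
  "num_params D = symb_count Circ D + symb_count Bullet D + 2 * symb_count Star D"

lemma finite_symb_positions:
  "finite {(k, l). k < dim_row D \<and> l < dim_col D \<and> D $$ (k, l) = s}"
  by (rule finite_subset[of _ "{..<dim_row D} \<times> {..<dim_col D}"]) auto

lemma card_params: "card (params D) = num_params D"
proof -
  define S where "S s = {(k, l). k < dim_row D \<and> l < dim_col D \<and> D $$ (k, l) = s}" for s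
  have fin: "finite (S s)" for s
    unfolding S_def by (rule finite_symb_positions)
  have eq: "params D = case_prod X ` (S Star \<union> S Circ) \<union> case_prod Y ` (S Star \<union> S Bullet)"
    unfolding params_def S_def by (auto simp: image_iff)
  have "card (params D) =
      card (case_prod X ` (S Star \<union> S Circ)) + card (case_prod Y ` (S Star \<union> S Bullet))"
    unfolding eq by (rule card_Un_disjoint) (auto simp: fin)
  also have "card (case_prod X ` (S Star \<union> S Circ)) = card (S Star \<union> S Circ)"
    by (rule card_image) (auto simp: inj_on_def)
  also have "card (case_prod Y ` (S Star \<union> S Bullet)) = card (S Star \<union> S Bullet)"
    by (rule card_image) (auto simp: inj_on_def)
  also have "card (S Star \<union> S Circ) = card (S Star) + card (S Circ)"
    by (rule card_Un_disjoint) (auto simp: fin, auto simp: S_def)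
  also have "card (S Star \<union> S Bullet) = card (S Star) + card (S Bullet)"
    by (rule card_Un_disjoint) (auto simp: fin, auto simp: S_def)
  finally show ?thesis
    unfolding num_params_def symb_count_def S_def by simp
qed

end

theory Submission
  imports Defs
begin

text \<open>Let \<open>T = {C\<^sup>* A + A C}\<close> be the tangent space at \<open>A\<close> of its congruence class. The matrices of the pattern form
  a real complement of \<open>T\<close>. The annihilator of \<open>T\<close> for the inner product \<open>Re (tr (X\<^sup>* Y))\<close> is given by
  \<open>X\<^sup>* A + X A\<^sup>* = 0\<close>, so that spanning, like independence, is the uniqueness of the solution of a
  linear system. Both systems decouple over the blocks of \<open>A\<close>, where the equations propagate along the shifts.

  Given the complement, with a real linear section \<open>L\<close> of \<open>C \<mapsto> C\<^sup>* A + A C\<close> modulo the pattern, a deformation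
  \<open>A + E\<close> is reduced by \<open>I + C\<close> where \<open>C = - L (E + C\<^sup>* E + E C + C\<^sup>* (A + E) C)\<close>. Picard iteration in the Banach
  algebra of absolutely convergent power series solves this equation; its constants are uniform in the base
  point, so that the solution is analytic at every nearby point. If a deformation with fewer parameters were
  versal, the linear part of the map \<open>\<phi>\<close> embedding the simplest deformation would have a kernel; along a line in
  it the parameters move only to second order, so the direction of that line in the pattern would lie in \<open>T\<close>.\<close>

section \<open>Multiplication by the canonical blocks\<close>

text \<open>Spanning yields versality and independence yields minimality, so every pair of blocks is
  examined twice. The map \<open>C \<mapsto> C\<^sup>* A + A C\<close> is only real linear. For
  distinct i and j, however, the blocks \<open>C\<^sub>i\<^sub>j\<close> and
  \<open>C\<^sub>j\<^sub>i\<close> are independent, and conjugating one of them restores complex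
  linearity; a genuinely real problem survives only on the diagonal, which is where circles and
  bullets occur. The eigenvalues enter through 2 by 2 determinants. With \<open>|\<nu>| > 1\<close>
  and \<open>|\<mu>| = 1\<close> these can vanish only between equal \<open>\<nu>\<close> or between
  \<open>\<mu>\<close> and \<open>\<mu>' = \<mu>\<close> or \<open>\<mu>' = - \<mu>\<close>. In the
  exceptional cases an unknown commutes with a nilpotent shift, hence is constant along diagonals,
  and the stars occupy an edge met by every diagonal that the border does not already force to zero.
  Between nilpotent blocks there is no determinant at all: their equations move in steps of two, and
  the ends of the resulting paths account for the parities in the alternating pattern.\<close>

definition row_mult :: "summand \<Rightarrow> (nat \<Rightarrow> complex) \<Rightarrow> nat \<Rightarrow> complex" where
  "row_mult s f l = (\<Sum>j<summand_size s. f j * summand_mat s $$ (j, l))"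

definition row_mult_adj :: "summand \<Rightarrow> (nat \<Rightarrow> complex) \<Rightarrow> nat \<Rightarrow> complex" where
  "row_mult_adj s f l = (\<Sum>j<summand_size s. f j * cnj (summand_mat s $$ (l, j)))"

definition mult_col :: "summand \<Rightarrow> (nat \<Rightarrow> complex) \<Rightarrow> nat \<Rightarrow> complex" where
  "mult_col s g k = (\<Sum>j<summand_size s. summand_mat s $$ (k, j) * g j)"

definition adj_mult_col :: "summand \<Rightarrow> (nat \<Rightarrow> complex) \<Rightarrow> nat \<Rightarrow> complex" where
  "adj_mult_col s g k = (\<Sum>j<summand_size s. cnj (summand_mat s $$ (j, k)) * g j)"

text \<open>Conjugation exchanges products with rows and products with columns. The entry formulas
  below are therefore computed for rows only and transferred to columns.\<close>

lemma cnj_mult_col: "cnj (mult_col s g k) = row_mult_adj s (\<lambda>j. cnj (g j)) k"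
  unfolding mult_col_def row_mult_adj_def by (simp add: mult.commute)

lemma cnj_row_mult: "cnj (row_mult s f l) = adj_mult_col s (\<lambda>j. cnj (f j)) l"
  unfolding row_mult_def adj_mult_col_def by (simp add: mult.commute)

lemma cnj_row_mult_adj: "cnj (row_mult_adj s f l) = mult_col s (\<lambda>j. cnj (f j)) l"
  unfolding row_mult_adj_def mult_col_def by (simp add: mult.commute)

lemma cnj_adj_mult_col: "cnj (adj_mult_col s g k) = row_mult s (\<lambda>j. cnj (g j)) k"
  unfolding row_mult_def adj_mult_col_def by (simp add: mult.commute)

subsection \<open>Entries of the canonical blocks\<close>

lemma sum_delta2:
  fixes h :: "nat \<Rightarrow> 'a :: comm_monoid_add"
  assumes "a \<noteq> b"
  shows "(\<Sum>j<n. if j = a then g j else if j = b then h j else 0) =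
    (if a < n then g a else 0) + (if b < n then h b else 0)"
proof -
  have "(\<Sum>j<n. if j = a then g j else if j = b then h j else 0) =
     (\<Sum>j<n. (if j = a then g j else 0) + (if j = b then h j else 0))"
    using assms by (intro sum.cong) auto
  also have "\<dots> = (if a < n then g a else 0) + (if b < n then h b else 0)"
    by (simp add: sum.distrib)
  finally show ?thesis .
qed

lemma row_mult_J:
  assumes "l < n"
  shows "row_mult (JBlock n) f l = (if l = 0 then 0 else f (l - 1))"
proof -
  \<comment> \<open>For \<open>l = 0\<close> truncated subtraction makes \<open>l - 1\<close> equal
    to 0, so the missing term has to be set to zero inside the selected value.\<close>
  have "row_mult (JBlock n) f l = (\<Sum>j<n. if j = l - 1 then (if l = 0 then 0 else f (l - 1)) else 0)"
    unfolding row_mult_def using assms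
    by (intro sum.cong) (auto simp: jordan_block_def)
  then show ?thesis using assms by simp
qed

lemma row_mult_adj_J:
  assumes "l < n"
  shows "row_mult_adj (JBlock n) f l = (if Suc l < n then f (Suc l) else 0)"
proof -
  have "row_mult_adj (JBlock n) f l = (\<Sum>j<n. if j = Suc l then f (Suc l) else 0)"
    unfolding row_mult_adj_def using assms
    by (intro sum.cong) (auto simp: jordan_block_def)
  then show ?thesis by simp
qed

text \<open>At \<open>l = 0\<close> the second condition reads \<open>j = n\<close> and never holds;
  this is the origin of the case \<open>l = 0\<close> in the product formulas.\<close>

lemma Delta_entry:
  assumes "j < n" "l < n"
  shows "(\<mu> \<cdot>\<^sub>m Delta_mat n) $$ (j, l) =
    (if j = n - 1 - l then \<mu> else if j = n - l then \<mu> * \<i> else 0)"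
  using assms by (auto simp: Delta_mat_def)

lemma Delta_entry':
  assumes "j < n" "l < n"
  shows "(\<mu> \<cdot>\<^sub>m Delta_mat n) $$ (l, j) =
    (if j = n - 1 - l then \<mu> else if j = n - l then \<mu> * \<i> else 0)"
  using assms by (auto simp: Delta_mat_def)

lemma row_mult_Delta:
  assumes "l < n"
  shows "row_mult (DeltaBlock n \<mu>) f l = \<mu> * (f (n - 1 - l) + (if l = 0 then 0 else \<i> * f (n - l)))"
proof -
  have "row_mult (DeltaBlock n \<mu>) f l =
     (\<Sum>j<n. if j = n - 1 - l then \<mu> * f j else if j = n - l then \<mu> * \<i> * f j else 0)"
    unfolding row_mult_def using assms
    by (intro sum.cong) (auto simp: Delta_entry)
  also have "\<dots> = \<mu> * (f (n - 1 - l) + (if l = 0 then 0 else \<i> * f (n - l)))"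
    using assms by (subst sum_delta2) (auto simp: algebra_simps)
  finally show ?thesis .
qed

lemma row_mult_adj_Delta:
  assumes "l < n"
  shows "row_mult_adj (DeltaBlock n \<mu>) f l = cnj \<mu> * (f (n - 1 - l) - (if l = 0 then 0 else \<i> * f (n - l)))"
proof -
  have "row_mult_adj (DeltaBlock n \<mu>) f l =
     (\<Sum>j<n. if j = n - 1 - l then cnj \<mu> * f j else if j = n - l then - cnj \<mu> * \<i> * f j else 0)"
    unfolding row_mult_adj_def using assms
    by (intro sum.cong) (auto simp: Delta_entry')
  also have "\<dots> = cnj \<mu> * (f (n - 1 - l) - (if l = 0 then 0 else \<i> * f (n - l)))"
    using assms by (subst sum_delta2) (auto simp: algebra_simps)
  finally show ?thesis .
qed

lemma H_entries:
  assumes "k < m" "l < m"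
  shows "H_mat m \<nu> $$ (k, l) = 0" "H_mat m \<nu> $$ (k, m + l) = (if k = l then 1 else 0)"
    "H_mat m \<nu> $$ (m + k, l) = (if k = l then \<nu> else if Suc k = l then 1 else 0)"
    "H_mat m \<nu> $$ (m + k, m + l) = 0"
  using assms by (auto simp: H_mat_def jordan_block_def)

lemma sum_double:
  fixes f :: "nat \<Rightarrow> 'a :: comm_monoid_add"
  shows "(\<Sum>j<2 * m. f j) = (\<Sum>j<m. f j) + (\<Sum>j<m. f (m + j))"
  using sum.atLeastLessThan_concat[of 0 m "2 * m" f] sum.shift_bounds_nat_ivl[of f 0 m m]
  by (simp add: lessThan_atLeast0 add.commute mult_2)

lemma row_mult_H:
  assumes "l < m"
  shows "row_mult (HBlock m \<nu>) f l = \<nu> * f (m + l) + (if l = 0 then 0 else f (m + l - 1))"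
    "row_mult (HBlock m \<nu>) f (m + l) = f l"
proof -
  have "row_mult (HBlock m \<nu>) f l =
     (\<Sum>j<m. 0) + (\<Sum>j<m. (if j = l then \<nu> * f (m + l) else 0) +
       (if j = l - 1 then if l = 0 then 0 else f (m + l - 1) else 0))"
    unfolding row_mult_def summand_size.simps summand_mat.simps sum_double using assms
    by (intro arg_cong2[of _ _ _ _ "(+)"] sum.cong) (auto simp: H_entries)
  then show "row_mult (HBlock m \<nu>) f l = \<nu> * f (m + l) + (if l = 0 then 0 else f (m + l - 1))"
    using assms by (simp add: sum.distrib)
  have "row_mult (HBlock m \<nu>) f (m + l) = (\<Sum>j<m. if j = l then f l else 0) + (\<Sum>j<m. 0)"
    unfolding row_mult_def summand_size.simps summand_mat.simps sum_double using assms
    by (intro arg_cong2[of _ _ _ _ "(+)"] sum.cong) (auto simp: H_entries)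
  then show "row_mult (HBlock m \<nu>) f (m + l) = f l"
    using assms by simp
qed

lemma row_mult_adj_H:
  assumes "l < m"
  shows "row_mult_adj (HBlock m \<nu>) f l = f (m + l)"
    "row_mult_adj (HBlock m \<nu>) f (m + l) = cnj \<nu> * f l + (if Suc l < m then f (Suc l) else 0)"
proof -
  have "row_mult_adj (HBlock m \<nu>) f l = (\<Sum>j<m. 0) + (\<Sum>j<m. if j = l then f (m + l) else 0)"
    unfolding row_mult_adj_def summand_size.simps summand_mat.simps sum_double using assms
    by (intro arg_cong2[of _ _ _ _ "(+)"] sum.cong) (auto simp: H_entries)
  then show "row_mult_adj (HBlock m \<nu>) f l = f (m + l)"
    using assms by simp
  have "row_mult_adj (HBlock m \<nu>) f (m + l) =
     (\<Sum>j<m. (if j = l then cnj \<nu> * f l else 0) + (if j = Suc l then f (Suc l) else 0)) + (\<Sum>j<m. 0)"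
    unfolding row_mult_adj_def summand_size.simps summand_mat.simps sum_double using assms
    by (intro arg_cong2[of _ _ _ _ "(+)"] sum.cong) (auto simp: H_entries)
  then show "row_mult_adj (HBlock m \<nu>) f (m + l) = cnj \<nu> * f l + (if Suc l < m then f (Suc l) else 0)"
    using assms by (simp add: sum.distrib)
qed

lemma mult_col_eq: "mult_col s g k = cnj (row_mult_adj s (\<lambda>j. cnj (g j)) k)"
  by (simp flip: cnj_mult_col)

lemma adj_mult_col_eq: "adj_mult_col s g k = cnj (row_mult s (\<lambda>j. cnj (g j)) k)"
  by (simp flip: cnj_adj_mult_col)

lemma mult_col_J: "k < n \<Longrightarrow> mult_col (JBlock n) g k = (if Suc k < n then g (Suc k) else 0)"
  by (simp add: mult_col_eq row_mult_adj_J)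

lemma adj_mult_col_J: "k < n \<Longrightarrow> adj_mult_col (JBlock n) g k = (if k = 0 then 0 else g (k - 1))"
  by (simp add: adj_mult_col_eq row_mult_J)

lemma mult_col_Delta:
  "k < n \<Longrightarrow> mult_col (DeltaBlock n \<mu>) g k = \<mu> * (g (n - 1 - k) + (if k = 0 then 0 else \<i> * g (n - k)))"
  by (simp add: mult_col_eq row_mult_adj_Delta)

lemma adj_mult_col_Delta:
  "k < n \<Longrightarrow> adj_mult_col (DeltaBlock n \<mu>) g k = cnj \<mu> * (g (n - 1 - k) - (if k = 0 then 0 else \<i> * g (n - k)))"
  by (simp add: adj_mult_col_eq row_mult_Delta)

lemma mult_col_H:
  assumes "k < m"
  shows "mult_col (HBlock m \<nu>) g k = g (m + k)"
    "mult_col (HBlock m \<nu>) g (m + k) = \<nu> * g k + (if Suc k < m then g (Suc k) else 0)"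
  using assms by (simp_all add: mult_col_eq row_mult_adj_H)

lemma adj_mult_col_H:
  assumes "k < m"
  shows "adj_mult_col (HBlock m \<nu>) g k = cnj \<nu> * g (m + k) + (if k = 0 then 0 else g (m + k - 1))"
    "adj_mult_col (HBlock m \<nu>) g (m + k) = g k"
  using assms by (simp_all add: adj_mult_col_eq row_mult_H)

lemmas block_mult = row_mult_J row_mult_adj_J mult_col_J adj_mult_col_J
  row_mult_Delta row_mult_adj_Delta mult_col_Delta adj_mult_col_Delta
  row_mult_H row_mult_adj_H mult_col_H adj_mult_col_H
subsection \<open>Admissible entries and the two injectivity properties\<close>

fun sym_ok :: "symb \<Rightarrow> complex \<Rightarrow> bool" where
  "sym_ok Zero z \<longleftrightarrow> z = 0"
| "sym_ok Star z \<longleftrightarrow> True"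
| "sym_ok Circ z \<longleftrightarrow> Im z = 0"
| "sym_ok Bullet z \<longleftrightarrow> Re z = 0"

text \<open>The polar condition with respect to the real inner product \<open>Re (cnj w * z)\<close>.\<close>

fun dual_ok :: "symb \<Rightarrow> complex \<Rightarrow> bool" where
  "dual_ok Zero z \<longleftrightarrow> True"
| "dual_ok Star z \<longleftrightarrow> z = 0"
| "dual_ok Circ z \<longleftrightarrow> Re z = 0"
| "dual_ok Bullet z \<longleftrightarrow> Im z = 0"

lemma sym_ok_cnj [simp]: "sym_ok s (cnj z) = sym_ok s z"
  by (cases s) auto

lemma dual_ok_cnj [simp]: "dual_ok s (cnj z) = dual_ok s z"
  by (cases s) auto

lemma stars_index [simp]:
  "k < m \<Longrightarrow> l < n \<Longrightarrow> stars m n P $$ (k, l) = (if P (k + 1) (l + 1) then Star else Zero)"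
  by (simp add: stars_def)

lemma zeros_index [simp]: "k < m \<Longrightarrow> l < n \<Longrightarrow> zeros m n $$ (k, l) = Zero"
  by (simp add: zeros_def)

lemma stars_dim [simp]: "dim_row (stars m n P) = m" "dim_col (stars m n P) = n"
  by (simp_all add: stars_def)

lemma zeros_dim [simp]: "dim_row (zeros m n) = m" "dim_col (zeros m n) = n"
  by (simp_all add: zeros_def)

definition congr1 :: "summand \<Rightarrow> summand \<Rightarrow> (nat \<Rightarrow> nat \<Rightarrow> complex) \<Rightarrow> (nat \<Rightarrow> nat \<Rightarrow> complex) \<Rightarrow> nat \<Rightarrow> nat \<Rightarrow> complex" where
  "congr1 s s' P R k l = row_mult s (P k) l + mult_col s' (\<lambda>j. R j l) k"

definition congr2 :: "summand \<Rightarrow> summand \<Rightarrow> (nat \<Rightarrow> nat \<Rightarrow> complex) \<Rightarrow> (nat \<Rightarrow> nat \<Rightarrow> complex) \<Rightarrow> nat \<Rightarrow> nat \<Rightarrow> complex" where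
  "congr2 s s' P R k l = row_mult_adj s (P k) l + adj_mult_col s' (\<lambda>j. R j l) k"

text \<open>With \<open>A\<close> and \<open>B\<close> the matrices of \<open>s\<close> and \<open>s'\<close>, the blocks \<open>(j, i)\<close> and \<open>(i, j)\<close> of
  \<open>C\<^sup>* A + A C\<close> are \<open>P A + B R\<close> and the adjoint of \<open>P A\<^sup>* + B\<^sup>* R\<close>, where \<open>P = C\<^sub>i\<^sub>j\<^sup>*\<close> and \<open>R = C\<^sub>j\<^sub>i\<close>.
  This makes the off-diagonal problem complex linear in \<open>(P, R)\<close>.\<close>

definition pair_transversal :: "summand \<Rightarrow> summand \<Rightarrow> symb mat \<times> symb mat \<Rightarrow> bool" where
  "pair_transversal s s' D \<longleftrightarrow> (\<forall>P R.
     (\<forall>k<summand_size s'. \<forall>l<summand_size s.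
        sym_ok (fst D $$ (k, l)) (congr1 s s' P R k l) \<and> sym_ok (snd D $$ (l, k)) (congr2 s s' P R k l)) \<longrightarrow>
     (\<forall>k<summand_size s'. \<forall>l<summand_size s. congr1 s s' P R k l = 0 \<and> congr2 s s' P R k l = 0))"

text \<open>Here \<open>y\<close> is the block \<open>(j, i)\<close> of a matrix in the annihilator
  and \<open>z\<close> is the adjoint of its block \<open>(i, j)\<close>. The equations
  \<open>z A + y A\<^sup>* = 0\<close> and \<open>B z + B\<^sup>* y = 0\<close> are complex linear
  in \<open>(y, z)\<close>.\<close>

definition dual_eqs :: "summand \<Rightarrow> summand \<Rightarrow> (nat \<Rightarrow> nat \<Rightarrow> complex) \<Rightarrow> (nat \<Rightarrow> nat \<Rightarrow> complex) \<Rightarrow> bool" where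
  "dual_eqs s s' y z \<longleftrightarrow> (\<forall>k<summand_size s'. \<forall>l<summand_size s.
     row_mult s (z k) l + row_mult_adj s (y k) l = 0 \<and>
     mult_col s' (\<lambda>j. z j l) k + adj_mult_col s' (\<lambda>j. y j l) k = 0)"

definition pair_spanning :: "summand \<Rightarrow> summand \<Rightarrow> symb mat \<times> symb mat \<Rightarrow> bool" where
  "pair_spanning s s' D \<longleftrightarrow> (\<forall>y z. dual_eqs s s' y z \<longrightarrow>
     (\<forall>k<summand_size s'. \<forall>l<summand_size s. dual_ok (fst D $$ (k, l)) (y k l) \<and> dual_ok (snd D $$ (l, k)) (z k l)) \<longrightarrow>
     (\<forall>k<summand_size s'. \<forall>l<summand_size s. y k l = 0 \<and> z k l = 0))"

text \<open>On the diagonal \<open>P\<close> is bound to be the adjoint of \<open>R = C\<close>, so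
  this condition is real linear but not complex linear.\<close>

definition diag_transversal :: "summand \<Rightarrow> symb mat \<Rightarrow> bool" where
  "diag_transversal s D \<longleftrightarrow> (\<forall>C.
     (\<forall>k<summand_size s. \<forall>l<summand_size s. sym_ok (D $$ (k, l)) (congr1 s s (\<lambda>k j. cnj (C j k)) C k l)) \<longrightarrow>
     (\<forall>k<summand_size s. \<forall>l<summand_size s. congr1 s s (\<lambda>k j. cnj (C j k)) C k l = 0))"

definition diag_spanning :: "summand \<Rightarrow> symb mat \<Rightarrow> bool" where
  "diag_spanning s D \<longleftrightarrow> (\<forall>x. dual_eqs s s x (\<lambda>k l. cnj (x l k)) \<longrightarrow>
     (\<forall>k<summand_size s. \<forall>l<summand_size s. dual_ok (D $$ (k, l)) (x k l)) \<longrightarrow>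
     (\<forall>k<summand_size s. \<forall>l<summand_size s. x k l = 0))"

text \<open>With \<open>P = C\<^sup>*\<close> the second residual is the adjoint of the first. In
  this way statements about pairs specialize to a diagonal block.\<close>

lemma congr2_self: "congr2 s s (\<lambda>k j. cnj (C j k)) C k l = cnj (congr1 s s (\<lambda>k j. cnj (C j k)) C l k)"
  by (simp add: congr1_def congr2_def cnj_row_mult cnj_mult_col)

lemma pair_transversal_zeros:
  assumes "\<And>k l. k < summand_size s' \<Longrightarrow> l < summand_size s \<Longrightarrow> fst D $$ (k, l) = Zero \<and> snd D $$ (l, k) = Zero"
  shows "pair_transversal s s' D"
  using assms unfolding pair_transversal_def by simp

subsection \<open>Elimination along a rank function\<close>

text \<open>A single induction for all recursions on a grid; the rank selects the corner from which
  the elimination starts.\<close>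

lemma rank_induct2:
  fixes \<rho> :: "nat \<Rightarrow> nat \<Rightarrow> nat"
  assumes step: "\<And>k l. k < n \<Longrightarrow> l < m \<Longrightarrow>
      (\<And>k' l'. k' < n \<Longrightarrow> l' < m \<Longrightarrow> \<rho> k' l' < \<rho> k l \<Longrightarrow> P k' l') \<Longrightarrow> P k l"
    and "k < n" "l < m"
  shows "P k l"
  using assms(2,3)
proof (induction "\<rho> k l" arbitrary: k l rule: less_induct)
  case less
  show ?case by (rule step[OF less.prems]) (rule less.hyps)
qed

lemma two_by_two_zero:
  fixes a b c d y z :: complex
  assumes "a * z + b * y = 0" "c * z + d * y = 0" "a * d \<noteq> b * c"
  shows "y = 0 \<and> z = 0"
proof -
  have "(a * d - b * c) * y = a * (c * z + d * y) - c * (a * z + b * y)"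
    "(a * d - b * c) * z = d * (a * z + b * y) - b * (c * z + d * y)"
    by (simp_all add: algebra_simps)
  then have "(a * d - b * c) * y = 0" "(a * d - b * c) * z = 0"
    unfolding assms(1,2) by simp_all
  then show ?thesis using assms(3) by simp
qed

text \<open>The shifts point to larger indices, so an elimination from the lower right corner leaves
  at each position a system with determinant \<open>1 - a * b\<close>. This lemma and the next three
  are named after the block of an \<open>H\<close>-\<open>H\<close> pair that they serve.\<close>

lemma zero_of_upper_left:
  fixes Y Z :: "nat \<Rightarrow> nat \<Rightarrow> complex"
  assumes "\<And>k l. k < n \<Longrightarrow> l < m \<Longrightarrow> Z k l + (a * Y k l + (if Suc l < m then Y k (Suc l) else 0)) = 0"
    and "\<And>k l. k < n \<Longrightarrow> l < m \<Longrightarrow> (b * Z k l + (if Suc k < n then Z (Suc k) l else 0)) + Y k l = 0"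
    and "a * b \<noteq> 1" "k < n" "l < m"
  shows "Y k l = 0 \<and> Z k l = 0"
proof (rule rank_induct2[where n = n and m = m and \<rho> = "\<lambda>k l. (n - k) + (m - l)"])
  fix k l assume kl: "k < n" "l < m"
    and IH: "\<And>k' l'. k' < n \<Longrightarrow> l' < m \<Longrightarrow> n - k' + (m - l') < n - k + (m - l) \<Longrightarrow> Y k' l' = 0 \<and> Z k' l' = 0"
  have "Suc l < m \<Longrightarrow> Y k (Suc l) = 0" "Suc k < n \<Longrightarrow> Z (Suc k) l = 0"
    using IH[of k "Suc l"] IH[of "Suc k" l] kl by auto
  with assms(1,2)[OF kl] have "1 * Z k l + a * Y k l = 0" "b * Z k l + 1 * Y k l = 0"
    by (auto split: if_splits)
  then show "Y k l = 0 \<and> Z k l = 0"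
    by (rule two_by_two_zero) (use assms(3) in simp)
qed fact+

lemma zero_of_lower_right:
  fixes Y Z :: "nat \<Rightarrow> nat \<Rightarrow> complex"
  assumes "\<And>k l. k < n \<Longrightarrow> l < m \<Longrightarrow> (a * Z k l + (if l = 0 then 0 else Z k (l - 1))) + Y k l = 0"
    and "\<And>k l. k < n \<Longrightarrow> l < m \<Longrightarrow> Z k l + (b * Y k l + (if k = 0 then 0 else Y (k - 1) l)) = 0"
    and "a * b \<noteq> 1" "k < n" "l < m"
  shows "Y k l = 0 \<and> Z k l = 0"
proof (rule rank_induct2[where n = n and m = m and \<rho> = "\<lambda>k l. k + l"])
  fix k l assume kl: "k < n" "l < m"
    and IH: "\<And>k' l'. k' < n \<Longrightarrow> l' < m \<Longrightarrow> k' + l' < k + l \<Longrightarrow> Y k' l' = 0 \<and> Z k' l' = 0"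
  have "l \<noteq> 0 \<Longrightarrow> Z k (l - 1) = 0" "k \<noteq> 0 \<Longrightarrow> Y (k - 1) l = 0"
    using IH[of k "l - 1"] IH[of "k - 1" l] kl by auto
  with assms(1,2)[OF kl] have "a * Z k l + 1 * Y k l = 0" "1 * Z k l + b * Y k l = 0"
    by (auto split: if_splits)
  then show "Y k l = 0 \<and> Z k l = 0"
    by (rule two_by_two_zero) (use assms(3) in simp)
qed fact+

text \<open>For \<open>a \<noteq> b\<close> the determinant is \<open>a - b\<close>. For
  \<open>a = b\<close> subtracting the equations shows that \<open>Z\<close> commutes with the
  shift, hence is constant along diagonals. The stars make \<open>Y\<close> vanish on a whole edge,
  while the unknown with constant diagonals is \<open>Z\<close>; the condition
  \<open>a \<noteq> 0\<close> carries the zeros from \<open>Y\<close> over to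
  \<open>Z\<close>.\<close>

lemma zero_of_upper_right:
  fixes Y Z :: "nat \<Rightarrow> nat \<Rightarrow> complex"
  assumes 1: "\<And>k l. k < n \<Longrightarrow> l < m \<Longrightarrow> (a * Z k l + (if l = 0 then 0 else Z k (l - 1))) + Y k l = 0"
    and 2: "\<And>k l. k < n \<Longrightarrow> l < m \<Longrightarrow> (b * Z k l + (if Suc k < n then Z (Suc k) l else 0)) + Y k l = 0"
    and disj: "a \<noteq> b \<or> a \<noteq> 0 \<and> (\<exists>S\<in>z_ne n m. \<forall>k<n. \<forall>l<m. dual_ok (S $$ (k, l)) (Y k l))"
    and kl: "k < n" "l < m"
  shows "Y k l = 0 \<and> Z k l = 0"
proof (cases "a = b")
  case False
  show ?thesis
  proof (rule rank_induct2[where n = n and m = m and \<rho> = "\<lambda>k l. (n - k) + l"])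
    fix k l assume kl: "k < n" "l < m"
      and IH: "\<And>k' l'. k' < n \<Longrightarrow> l' < m \<Longrightarrow> n - k' + l' < n - k + l \<Longrightarrow> Y k' l' = 0 \<and> Z k' l' = 0"
    have "l \<noteq> 0 \<Longrightarrow> Z k (l - 1) = 0" "Suc k < n \<Longrightarrow> Z (Suc k) l = 0"
      using IH[of k "l - 1"] IH[of "Suc k" l] kl by auto
    with 1[OF kl] 2[OF kl] have "a * Z k l + 1 * Y k l = 0" "b * Z k l + 1 * Y k l = 0"
      by (auto split: if_splits)
    then show "Y k l = 0 \<and> Z k l = 0"
      by (rule two_by_two_zero) (use False in simp)
  qed fact+
next
  case True
  with disj obtain S where a: "a \<noteq> 0" and S: "S \<in> z_ne n m" "\<And>k l. k < n \<Longrightarrow> l < m \<Longrightarrow> dual_ok (S $$ (k, l)) (Y k l)"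
    by auto
  have comm: "(if l = 0 then 0 else Z k (l - 1)) = (if Suc k < n then Z (Suc k) l else 0)" if "k < n" "l < m" for k l
  proof -
    have "(a * Z k l + (if l = 0 then 0 else Z k (l - 1))) + Y k l = (a * Z k l + (if Suc k < n then Z (Suc k) l else 0)) + Y k l"
      using 1[OF that] 2[OF that] True by (simp only:)
    then show ?thesis by (simp only: add_left_cancel add_right_cancel)
  qed
  have Y: "Y k l = - (a * Z k l + (if l = 0 then 0 else Z k (l - 1)))" if "k < n" "l < m" for k l
    using 1[OF that] by (subst eq_neg_iff_add_eq_0) (subst add.commute)
  from S(1) consider "S = stars n m (\<lambda>k l. l = m)" | "S = stars n m (\<lambda>k l. k = 1)"
    by (auto simp: z_ne_def)
  then have Z: "Z k l = 0" if "k < n" "l < m" for k l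
  proof cases
    case c: 1
    have Y0: "Y k (m - 1) = 0" if "k < n" for k
      using S(2)[OF that, of "m - 1"] kl(2) that c by simp
    show ?thesis
    proof (rule rank_induct2[where n = n and m = m and \<rho> = "\<lambda>k l. (n - k) + (m - l)"])
      fix k l assume kl: "k < n" "l < m"
        and IH: "\<And>k' l'. k' < n \<Longrightarrow> l' < m \<Longrightarrow> n - k' + (m - l') < n - k + (m - l) \<Longrightarrow> Z k' l' = 0"
      \<comment> \<open>In the last column \<open>Y = 0\<close> turns the second equation into a
        recursion from the bottom; the other columns follow along the diagonals.\<close>
      show "Z k l = 0"
      proof (cases "l = m - 1")
        case True
        then have "a * Z k l + (if Suc k < n then Z (Suc k) l else 0) = 0"
          using 2[OF kl] Y0[OF kl(1)] \<open>a = b\<close> by simp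
        moreover have "Suc k < n \<Longrightarrow> Z (Suc k) l = 0" using IH[of "Suc k" l] kl by simp
        ultimately show ?thesis using a by (auto split: if_splits)
      next
        case False
        then show ?thesis using comm[of k "Suc l"] kl IH[of "Suc k" "Suc l"] by (auto split: if_splits)
      qed
    qed fact+
  next
    case c: 2
    have Y0: "Y 0 l = 0" if "l < m" for l
      using S(2)[OF _ that, of 0] that kl c by simp
    show ?thesis
    proof (rule rank_induct2[where n = n and m = m and \<rho> = "\<lambda>k l. k + l"])
      fix k l assume kl: "k < n" "l < m"
        and IH: "\<And>k' l'. k' < n \<Longrightarrow> l' < m \<Longrightarrow> k' + l' < k + l \<Longrightarrow> Z k' l' = 0"
      show "Z k l = 0"
      proof (cases "k = 0")
        case True
        then show ?thesis using Y[OF kl] Y0[OF kl(2)] IH[of k "l - 1"] kl a by (auto split: if_splits)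
      next
        case False
        then obtain k' where "k = Suc k'" by (cases k) auto
        then show ?thesis using comm[of k' l] kl IH[of k' "l - 1"] by (cases l) auto
      qed
    qed fact+
  qed
  show ?thesis using Y[OF kl] Z[OF kl] Z[OF kl(1), of "l - 1"] kl by simp
qed

text \<open>The roles of the unknowns are exchanged: for \<open>a = b\<close> it is now
  \<open>Y\<close> that commutes with the shift, so the stars act directly on the unknown with
  constant diagonals.\<close>

lemma zero_of_lower_left:
  fixes Y Z :: "nat \<Rightarrow> nat \<Rightarrow> complex"
  assumes 1: "\<And>k l. k < n \<Longrightarrow> l < m \<Longrightarrow> Z k l + (a * Y k l + (if Suc l < m then Y k (Suc l) else 0)) = 0"
    and 2: "\<And>k l. k < n \<Longrightarrow> l < m \<Longrightarrow> Z k l + (b * Y k l + (if k = 0 then 0 else Y (k - 1) l)) = 0"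
    and disj: "a \<noteq> b \<or> (\<exists>S\<in>z_sw n m. \<forall>k<n. \<forall>l<m. dual_ok (S $$ (k, l)) (Y k l))"
    and kl: "k < n" "l < m"
  shows "Y k l = 0 \<and> Z k l = 0"
proof (cases "a = b")
  case False
  show ?thesis
  proof (rule rank_induct2[where n = n and m = m and \<rho> = "\<lambda>k l. k + (m - l)"])
    fix k l assume kl: "k < n" "l < m"
      and IH: "\<And>k' l'. k' < n \<Longrightarrow> l' < m \<Longrightarrow> k' + (m - l') < k + (m - l) \<Longrightarrow> Y k' l' = 0 \<and> Z k' l' = 0"
    have "k \<noteq> 0 \<Longrightarrow> Y (k - 1) l = 0" "Suc l < m \<Longrightarrow> Y k (Suc l) = 0"
      using IH[of k "Suc l"] IH[of "k - 1" l] kl by auto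
    with 1[OF kl] 2[OF kl] have "1 * Z k l + a * Y k l = 0" "1 * Z k l + b * Y k l = 0"
      by (auto split: if_splits)
    then show "Y k l = 0 \<and> Z k l = 0"
      by (rule two_by_two_zero) (use False in simp)
  qed fact+
next
  case True
  with disj obtain S where S: "S \<in> z_sw n m" "\<And>k l. k < n \<Longrightarrow> l < m \<Longrightarrow> dual_ok (S $$ (k, l)) (Y k l)"
    by auto
  have comm: "(if Suc l < m then Y k (Suc l) else 0) = (if k = 0 then 0 else Y (k - 1) l)" if "k < n" "l < m" for k l
  proof -
    have "Z k l + (a * Y k l + (if Suc l < m then Y k (Suc l) else 0)) = Z k l + (a * Y k l + (if k = 0 then 0 else Y (k - 1) l))"
      using 1[OF that] 2[OF that] True by (simp only:)
    then show ?thesis by (simp only: add_left_cancel)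
  qed
  from S(1) consider "S = stars n m (\<lambda>k l. l = 1)" | "S = stars n m (\<lambda>k l. k = n)"
    by (auto simp: z_sw_def)
  then have Y: "Y k l = 0" if "k < n" "l < m" for k l
  proof cases
    case c: 1
    show ?thesis
    proof (rule rank_induct2[where n = n and m = m and \<rho> = "\<lambda>k l. k + l"])
      fix k l assume kl: "k < n" "l < m"
        and IH: "\<And>k' l'. k' < n \<Longrightarrow> l' < m \<Longrightarrow> k' + l' < k + l \<Longrightarrow> Y k' l' = 0"
      show "Y k l = 0"
      proof (cases "l = 0")
        case True
        then show ?thesis using S(2)[OF kl] kl c by simp
      next
        case False
        then obtain l' where "l = Suc l'" by (cases l) auto
        then show ?thesis using comm[of k l'] kl IH[of "k - 1" l'] by (cases k) auto
      qed
    qed fact+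
  next
    case c: 2
    show ?thesis
    proof (rule rank_induct2[where n = n and m = m and \<rho> = "\<lambda>k l. (n - k) + (m - l)"])
      fix k l assume kl: "k < n" "l < m"
        and IH: "\<And>k' l'. k' < n \<Longrightarrow> l' < m \<Longrightarrow> n - k' + (m - l') < n - k + (m - l) \<Longrightarrow> Y k' l' = 0"
      show "Y k l = 0"
      proof (cases "Suc k = n")
        case True
        then show ?thesis using S(2)[OF kl] kl c by simp
      next
        case False
        then show ?thesis using comm[of "Suc k" l] kl IH[of "Suc k" "Suc l"] by (auto split: if_splits)
      qed
    qed fact+
  qed
  show ?thesis using 1[OF kl] Y[OF kl] Y[OF kl(1), of "Suc l"] kl by (auto split: if_splits)
qed
subsection \<open>Pairs of nonsingular blocks: spanning\<close>

lemma four_block_zeros_index: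
  assumes "k < n" "l < m" "Z \<in> carrier_mat n m" "Z' \<in> carrier_mat n m"
  shows "four_block_mat (zeros n m) Z Z' (zeros n m) $$ (k, l) = Zero"
    "four_block_mat (zeros n m) Z Z' (zeros n m) $$ (k, m + l) = Z $$ (k, l)"
    "four_block_mat (zeros n m) Z Z' (zeros n m) $$ (n + k, l) = Z' $$ (k, l)"
    "four_block_mat (zeros n m) Z Z' (zeros n m) $$ (n + k, m + l) = Zero"
  using assms by auto

lemma z_carrier:
  "Z \<in> z_ne n m \<Longrightarrow> Z \<in> carrier_mat n m" "Z \<in> z_sw n m \<Longrightarrow> Z \<in> carrier_mat n m"
  "Z \<in> z_nw n m \<Longrightarrow> Z \<in> carrier_mat n m" "zeros n m \<in> carrier_mat n m"
  by (auto simp: z_ne_def z_sw_def z_nw_def)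

lemma less_doubleE:
  assumes "k < 2 * (n::nat)"
  obtains "k < n" | j where "k = n + j" "j < n"
  using assms by (metis add.commute add_diff_inverse_nat less_diff_conv2 linorder_not_less mult_2)

section \<open>The annihilator between two \<open>H\<close> blocks\<close>

lemma H_H_dual_eqs:
  assumes "dual_eqs (HBlock m \<nu>) (HBlock n \<nu>') y z" "k < n" "l < m"
  shows "(\<nu> * z k (m + l) + (if l = 0 then 0 else z k (m + (l - 1)))) + y k (m + l) = 0"
    "z k l + (cnj \<nu> * y k l + (if Suc l < m then y k (Suc l) else 0)) = 0"
    "(\<nu> * z (n + k) (m + l) + (if l = 0 then 0 else z (n + k) (m + (l - 1)))) + y (n + k) (m + l) = 0"
    "z (n + k) l + (cnj \<nu> * y (n + k) l + (if Suc l < m then y (n + k) (Suc l) else 0)) = 0"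
    "z (n + k) l + (cnj \<nu>' * y (n + k) l + (if k = 0 then 0 else y (n + (k - 1)) l)) = 0"
    "(\<nu>' * z k l + (if Suc k < n then z (Suc k) l else 0)) + y k l = 0"
    "z (n + k) (m + l) + (cnj \<nu>' * y (n + k) (m + l) + (if k = 0 then 0 else y (n + (k - 1)) (m + l))) = 0"
    "(\<nu>' * z k (m + l) + (if Suc k < n then z (Suc k) (m + l) else 0)) + y k (m + l) = 0"
proof -
  have *: "row_mult (HBlock m \<nu>) (z i) j + row_mult_adj (HBlock m \<nu>) (y i) j = 0"
    "mult_col (HBlock n \<nu>') (\<lambda>k. z k j) i + adj_mult_col (HBlock n \<nu>') (\<lambda>k. y k j) i = 0"
    if "i < 2 * n" "j < 2 * m" for i j
    using assms(1) that unfolding dual_eqs_def by auto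
  show "(\<nu> * z k (m + l) + (if l = 0 then 0 else z k (m + (l - 1)))) + y k (m + l) = 0"
    using *(1)[of k l] assms by (auto simp: block_mult)
  show "z k l + (cnj \<nu> * y k l + (if Suc l < m then y k (Suc l) else 0)) = 0"
    using *(1)[of k "m + l"] assms by (auto simp: block_mult)
  show "(\<nu> * z (n + k) (m + l) + (if l = 0 then 0 else z (n + k) (m + (l - 1)))) + y (n + k) (m + l) = 0"
    using *(1)[of "n + k" l] assms by (auto simp: block_mult)
  show "z (n + k) l + (cnj \<nu> * y (n + k) l + (if Suc l < m then y (n + k) (Suc l) else 0)) = 0"
    using *(1)[of "n + k" "m + l"] assms by (auto simp: block_mult)
  show "z (n + k) l + (cnj \<nu>' * y (n + k) l + (if k = 0 then 0 else y (n + (k - 1)) l)) = 0"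
    using *(2)[of k l] assms by (auto simp: block_mult)
  show "(\<nu>' * z k l + (if Suc k < n then z (Suc k) l else 0)) + y k l = 0"
    using *(2)[of "n + k" l] assms by (auto simp: block_mult)
  show "z (n + k) (m + l) + (cnj \<nu>' * y (n + k) (m + l) + (if k = 0 then 0 else y (n + (k - 1)) (m + l))) = 0"
    using *(2)[of k "m + l"] assms by (auto simp: block_mult)
  show "(\<nu>' * z k (m + l) + (if Suc k < n then z (Suc k) (m + l) else 0)) + y k (m + l) = 0"
    using *(2)[of "n + k" "m + l"] assms by (auto simp: block_mult)
qed

lemma mult_cnj_ne_one: "1 < cmod a \<Longrightarrow> 1 < cmod b \<Longrightarrow> a * cnj b \<noteq> 1"
proof
  assume "1 < cmod a" "1 < cmod b" "a * cnj b = 1"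
  then have "cmod a * cmod b = 1" by (metis complex_mod_cnj norm_mult norm_one)
  with \<open>1 < cmod a\<close> \<open>1 < cmod b\<close> show False
    by (metis less_1_mult less_irrefl)
qed

text \<open>Both determinants have the form \<open>1 - a * b\<close> with
  \<open>|a * b| > 1\<close>. This is why the pattern is zero in these two blocks even for equal
  eigenvalues.\<close>

lemma H_H_dual_diagonal_blocks:
  assumes "dual_eqs (HBlock m \<nu>) (HBlock n \<nu>') y z" "1 < cmod \<nu>" "1 < cmod \<nu>'" "k < n" "l < m"
  shows "y k l = 0 \<and> z k l = 0" "y (n + k) (m + l) = 0 \<and> z (n + k) (m + l) = 0"
proof -
  show "y k l = 0 \<and> z k l = 0"
    by (rule zero_of_upper_left[where a = "cnj \<nu>" and b = \<nu>' and n = n and m = m])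
      (use H_H_dual_eqs(2,6)[OF assms(1)] mult_cnj_ne_one[OF assms(3,2)] assms in \<open>auto simp: mult.commute\<close>)
  show "y (n + k) (m + l) = 0 \<and> z (n + k) (m + l) = 0"
    by (rule zero_of_lower_right[where a = "\<nu>" and b = "cnj \<nu>'" and n = n and m = m
          and Y = "\<lambda>k l. y (n + k) (m + l)" and Z = "\<lambda>k l. z (n + k) (m + l)"])
      (use H_H_dual_eqs(3,7)[OF assms(1)] mult_cnj_ne_one[OF assms(2,3)] assms in auto)
qed

lemma pair_spanning_H_H:
  assumes D: "D \<in> D_off (HBlock m \<nu>) (HBlock n \<nu>')" and \<nu>: "1 < cmod \<nu>" "1 < cmod \<nu>'"
  shows "pair_spanning (HBlock m \<nu>) (HBlock n \<nu>') D"
  unfolding pair_spanning_def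
proof (intro allI impI)
  fix y z k l
  assume E: "dual_eqs (HBlock m \<nu>) (HBlock n \<nu>') y z"
    and ok: "\<forall>k<summand_size (HBlock n \<nu>'). \<forall>l<summand_size (HBlock m \<nu>).
      dual_ok (fst D $$ (k, l)) (y k l) \<and> dual_ok (snd D $$ (l, k)) (z k l)"
    and "k < summand_size (HBlock n \<nu>')" "l < summand_size (HBlock m \<nu>)"
  then have kl: "k < 2 * n" "l < 2 * m" by auto
  have ne: "\<nu> \<noteq> \<nu>' \<or> \<nu> \<noteq> 0 \<and> (\<exists>S\<in>z_ne n m. \<forall>k<n. \<forall>l<m. dual_ok (S $$ (k, l)) (y k (m + l)))"
  proof (cases "\<nu> = \<nu>'")
    case True
    with D obtain S S' where D': "D = (four_block_mat (zeros n m) S S' (zeros n m), zeros (2 * m) (2 * n))"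
      "S \<in> z_ne n m" "S' \<in> z_sw n m" by auto
    have "dual_ok (S $$ (k, l)) (y k (m + l))" if "k < n" "l < m" for k l
    proof -
      have "fst D $$ (k, m + l) = S $$ (k, l)"
        unfolding D'(1) fst_conv by (rule four_block_zeros_index) (use that D' z_carrier in auto)
      then show ?thesis using ok[rule_format, of k "m + l"] that by simp
    qed
    moreover have "\<nu> \<noteq> 0" using \<nu> by auto
    ultimately show ?thesis using D' by blast
  qed simp
  have sw: "cnj \<nu> \<noteq> cnj \<nu>' \<or> (\<exists>S\<in>z_sw n m. \<forall>k<n. \<forall>l<m. dual_ok (S $$ (k, l)) (y (n + k) l))"
  proof (cases "\<nu> = \<nu>'")
    case True
    with D obtain S S' where D': "D = (four_block_mat (zeros n m) S S' (zeros n m), zeros (2 * m) (2 * n))"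
      "S \<in> z_ne n m" "S' \<in> z_sw n m" by auto
    have "dual_ok (S' $$ (k, l)) (y (n + k) l)" if "k < n" "l < m" for k l
    proof -
      have "fst D $$ (n + k, l) = S' $$ (k, l)"
        unfolding D'(1) fst_conv by (rule four_block_zeros_index) (use that D' z_carrier in auto)
      then show ?thesis using ok[rule_format, of "n + k" l] that by simp
    qed
    then show ?thesis using D' by blast
  qed simp
  have ur: "y k (m + l) = 0 \<and> z k (m + l) = 0" if "k < n" "l < m" for k l
    by (rule zero_of_upper_right[where a = \<nu> and b = \<nu>' and n = n and m = m
          and Y = "\<lambda>k l. y k (m + l)" and Z = "\<lambda>k l. z k (m + l)"])
      (use H_H_dual_eqs(1,8)[OF E] ne that in auto)
  have ll: "y (n + k) l = 0 \<and> z (n + k) l = 0" if "k < n" "l < m" for k l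
    by (rule zero_of_lower_left[where a = "cnj \<nu>" and b = "cnj \<nu>'" and n = n and m = m
          and Y = "\<lambda>k l. y (n + k) l" and Z = "\<lambda>k l. z (n + k) l"])
      (use H_H_dual_eqs(4,5)[OF E] sw that in auto)
  show "y k l = 0 \<and> z k l = 0"
    using H_H_dual_diagonal_blocks[OF E \<nu>] ur ll kl
    by (elim less_doubleE[of k n] less_doubleE[of l m]) auto
qed

text \<open>Reversing the row index turns \<open>\<Delta>\<^sub>n\<close> into
  \<open>I + \<i> N\<close> with the nilpotent shift \<open>N\<close>, so the equations of these
  blocks resemble those of Jordan blocks.\<close>

lemma mult_col_Delta_flip:
  assumes "k < n"
  shows "mult_col (DeltaBlock n \<mu>) g (n - 1 - k) = \<mu> * (g k + (if Suc k < n then \<i> * g (Suc k) else 0))"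
    "adj_mult_col (DeltaBlock n \<mu>) g (n - 1 - k) = cnj \<mu> * (g k - (if Suc k < n then \<i> * g (Suc k) else 0))"
proof -
  have "n - 1 - (n - 1 - k) = k" "n - (n - 1 - k) = Suc k" "n - 1 - k = 0 \<longleftrightarrow> \<not> Suc k < n"
    using assms by auto
  then show "mult_col (DeltaBlock n \<mu>) g (n - 1 - k) = \<mu> * (g k + (if Suc k < n then \<i> * g (Suc k) else 0))"
    "adj_mult_col (DeltaBlock n \<mu>) g (n - 1 - k) = cnj \<mu> * (g k - (if Suc k < n then \<i> * g (Suc k) else 0))"
    using assms by (auto simp: mult_col_Delta adj_mult_col_Delta)
qed

text \<open>Each determinant is a difference of a number of modulus 1 and a number of modulus
  \<open>cmod \<nu> > 1\<close>, so the annihilator is already trivial for the zero pattern.\<close>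

lemma pair_spanning_H_Delta:
  assumes \<nu>: "1 < cmod \<nu>" and \<mu>: "cmod \<mu> = 1"
  shows "pair_spanning (HBlock m \<nu>) (DeltaBlock n \<mu>) D"
  unfolding pair_spanning_def
proof (intro allI impI)
  fix y z k l
  assume E: "dual_eqs (HBlock m \<nu>) (DeltaBlock n \<mu>) y z"
    and "k < summand_size (DeltaBlock n \<mu>)" "l < summand_size (HBlock m \<nu>)"
  then have kl: "k < n" "l < 2 * m" by auto
  have E1: "row_mult (HBlock m \<nu>) (z k) l + row_mult_adj (HBlock m \<nu>) (y k) l = 0" if "k < n" "l < 2 * m" for k l
    using E that unfolding dual_eqs_def by auto
  have E2: "\<mu> * (z k l + (if Suc k < n then \<i> * z (Suc k) l else 0)) +
      cnj \<mu> * (y k l - (if Suc k < n then \<i> * y (Suc k) l else 0)) = 0" if "k < n" "l < 2 * m" for k l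
  proof -
    have "mult_col (DeltaBlock n \<mu>) (\<lambda>j. z j l) (n - 1 - k) + adj_mult_col (DeltaBlock n \<mu>) (\<lambda>j. y j l) (n - 1 - k) = 0"
      using E that unfolding dual_eqs_def by auto
    then show ?thesis unfolding mult_col_Delta_flip[OF that(1)] .
  qed
  have norm_ne: "\<mu> * cnj \<nu> \<noteq> cnj \<mu>" "\<nu> * cnj \<mu> \<noteq> \<mu>"
    using \<nu> \<mu> by (metis complex_mod_cnj less_irrefl mult.left_neutral mult.right_neutral norm_mult)+
  have left: "y k l = 0 \<and> z k l = 0" if "k < n" "l < m" for k l
  proof (rule rank_induct2[where n = n and m = m and \<rho> = "\<lambda>k l. (n - k) + (m - l)"])
    fix k l assume kl: "k < n" "l < m"
      and IH: "\<And>k' l'. k' < n \<Longrightarrow> l' < m \<Longrightarrow> n - k' + (m - l') < n - k + (m - l) \<Longrightarrow> y k' l' = 0 \<and> z k' l' = 0"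
    have "Suc l < m \<Longrightarrow> y k (Suc l) = 0" "Suc k < n \<Longrightarrow> z (Suc k) l = 0" "Suc k < n \<Longrightarrow> y (Suc k) l = 0"
      using IH[of k "Suc l"] IH[of "Suc k" l] kl by auto
    with E1[of k "m + l"] E2[of k l] kl have "1 * z k l + cnj \<nu> * y k l = 0" "\<mu> * z k l + cnj \<mu> * y k l = 0"
      by (auto simp: block_mult split: if_splits)
    then show "y k l = 0 \<and> z k l = 0"
      by (rule two_by_two_zero) (use norm_ne in \<open>simp add: mult.commute\<close>)
  qed (use that in auto)
  have right: "y k (m + l) = 0 \<and> z k (m + l) = 0" if "k < n" "l < m" for k l
  proof (rule rank_induct2[where n = n and m = m and \<rho> = "\<lambda>k l. (n - k) + l"
        and P = "\<lambda>k l. y k (m + l) = 0 \<and> z k (m + l) = 0"])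
    fix k l assume kl: "k < n" "l < m"
      and IH: "\<And>k' l'. k' < n \<Longrightarrow> l' < m \<Longrightarrow> n - k' + l' < n - k + l \<Longrightarrow> y k' (m + l') = 0 \<and> z k' (m + l') = 0"
    have "0 < l \<Longrightarrow> z k (m + l - 1) = 0" "Suc k < n \<Longrightarrow> z (Suc k) (m + l) = 0" "Suc k < n \<Longrightarrow> y (Suc k) (m + l) = 0"
      using IH[of k "l - 1"] IH[of "Suc k" l] kl by auto
    with E1[of k l] E2[of k "m + l"] kl have "\<nu> * z k (m + l) + 1 * y k (m + l) = 0" "\<mu> * z k (m + l) + cnj \<mu> * y k (m + l) = 0"
      by (auto simp: block_mult split: if_splits)
    then show "y k (m + l) = 0 \<and> z k (m + l) = 0"
      by (rule two_by_two_zero) (use norm_ne in simp)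
  qed (use that in auto)
  show "y k l = 0 \<and> z k l = 0"
    using left right kl by (elim less_doubleE[of l m]) auto
qed
text \<open>Such a \<open>Z\<close> is constant along diagonals, and it vanishes on a diagonal that
  leaves through the bottom row before the last column or begins in the first column below the
  corner. It is therefore determined by its last column, and likewise by its first row.\<close>

lemma commuting_zero:
  fixes Z :: "nat \<Rightarrow> nat \<Rightarrow> complex"
  assumes comm: "\<And>k l. k < n \<Longrightarrow> l < m \<Longrightarrow> (if l = 0 then 0 else Z k (l - 1)) = (if Suc k < n then Z (Suc k) l else 0)"
    and S: "(\<forall>k<n. Z k (m - 1) = 0) \<or> (\<forall>l<m. Z 0 l = 0)"
    and kl: "k < n" "l < m"
  shows "Z k l = 0"
  using S
proof
  assume Y0: "\<forall>k<n. Z k (m - 1) = 0"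
  show ?thesis
  proof (rule rank_induct2[where n = n and m = m and \<rho> = "\<lambda>k l. (n - k) + (m - l)"])
    fix k l assume kl: "k < n" "l < m"
      and IH: "\<And>k' l'. k' < n \<Longrightarrow> l' < m \<Longrightarrow> n - k' + (m - l') < n - k + (m - l) \<Longrightarrow> Z k' l' = 0"
    show "Z k l = 0"
    proof (cases "l = m - 1")
      case False
      then show ?thesis using comm[of k "Suc l"] kl IH[of "Suc k" "Suc l"] by (auto split: if_splits)
    qed (use Y0 kl in auto)
  qed fact+
next
  assume Y0: "\<forall>l<m. Z 0 l = 0"
  show ?thesis
  proof (rule rank_induct2[where n = n and m = m and \<rho> = "\<lambda>k l. k + l"])
    fix k l assume kl: "k < n" "l < m"
      and IH: "\<And>k' l'. k' < n \<Longrightarrow> l' < m \<Longrightarrow> k' + l' < k + l \<Longrightarrow> Z k' l' = 0"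
    show "Z k l = 0"
    proof (cases k)
      case (Suc k')
      then show ?thesis using comm[of k' l] kl IH[of k' "l - 1"] by (cases l) auto
    qed (use Y0 kl in auto)
  qed fact+
qed

text \<open>Reversing the columns of the unknowns and the rows of the second equation removes both
  antidiagonals: what remains is multiplication by \<open>I \<plusminus> \<i> N\<close> on either
  side.\<close>

lemma Delta_Delta_dual_eqs:
  assumes E: "dual_eqs (DeltaBlock m \<mu>) (DeltaBlock n \<mu>') y z"
    and y'_def: "y' = (\<lambda>k l. y k (m - 1 - l))" and z'_def: "z' = (\<lambda>k l. z k (m - 1 - l))"
    and kl: "k < n" "l < m"
  shows "\<mu> * (z' k l + (if l = 0 then 0 else \<i> * z' k (l - 1))) +
      cnj \<mu> * (y' k l - (if l = 0 then 0 else \<i> * y' k (l - 1))) = 0"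
    "\<mu>' * (z' k l + (if Suc k < n then \<i> * z' (Suc k) l else 0)) +
      cnj \<mu>' * (y' k l - (if Suc k < n then \<i> * y' (Suc k) l else 0)) = 0"
proof -
  have "row_mult (DeltaBlock m \<mu>) (z k) l + row_mult_adj (DeltaBlock m \<mu>) (y k) l = 0"
    using E kl unfolding dual_eqs_def by auto
  then show "\<mu> * (z' k l + (if l = 0 then 0 else \<i> * z' k (l - 1))) +
      cnj \<mu> * (y' k l - (if l = 0 then 0 else \<i> * y' k (l - 1))) = 0"
    using kl by (cases l) (simp_all add: block_mult y'_def z'_def)
  have "mult_col (DeltaBlock n \<mu>') (\<lambda>j. z' j l) (n - 1 - k) + adj_mult_col (DeltaBlock n \<mu>') (\<lambda>j. y' j l) (n - 1 - k) = 0"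
    using E kl unfolding dual_eqs_def y'_def z'_def by auto
  then show "\<mu>' * (z' k l + (if Suc k < n then \<i> * z' (Suc k) l else 0)) +
      cnj \<mu>' * (y' k l - (if Suc k < n then \<i> * y' (Suc k) l else 0)) = 0"
    unfolding mult_col_Delta_flip[OF kl(1)] .
qed

lemma unit_mult_cnj: "cmod \<mu> = 1 \<Longrightarrow> \<mu> * cnj \<mu> = 1"
  by (metis complex_norm_square mult.commute of_real_1 one_power2)

text \<open>Equality would make the quotient of \<open>\<mu>\<close> and \<open>\<mu>'\<close> real,
  and the only real numbers of modulus 1 are 1 and -1. The distinction of cases in the pattern for
  two \<open>\<Delta>\<close> blocks comes from this determinant.\<close>

lemma unit_square_ne:
  assumes "cmod \<mu> = 1" "cmod \<mu>' = 1" "\<mu> \<noteq> \<mu>'" "\<mu> \<noteq> - \<mu>'"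
  shows "\<mu> * cnj \<mu>' \<noteq> cnj \<mu> * \<mu>'"
proof
  assume "\<mu> * cnj \<mu>' = cnj \<mu> * \<mu>'"
  then have "\<mu> * \<mu> * (\<mu>' * cnj \<mu>') = \<mu>' * \<mu>' * (\<mu> * cnj \<mu>)"
  proof -
    have "\<mu> * \<mu> * (\<mu>' * cnj \<mu>') = (\<mu> * cnj \<mu>') * (\<mu> * \<mu>')" by (simp add: mult_ac)
    also have "\<dots> = (cnj \<mu> * \<mu>') * (\<mu> * \<mu>')" using \<open>\<mu> * cnj \<mu>' = cnj \<mu> * \<mu>'\<close> by simp
    finally show ?thesis by (simp add: mult_ac)
  qed
  then have "(\<mu> - \<mu>') * (\<mu> + \<mu>') = 0"
    using unit_mult_cnj assms(1,2) by (simp add: algebra_simps)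
  with assms(3,4) show False by (simp add: eq_neg_iff_add_eq_0)
qed

text \<open>The unknowns \<open>a = \<mu> z\<close> and \<open>b = \<mu>\<^sup>* y\<close> satisfy \<open>a + b = - \<i> (a - b) N = - \<i> N (a - b)\<close>, so \<open>a - b\<close>, hence
  also \<open>a + b\<close> and \<open>b\<close>, commute with the nilpotent shift \<open>N\<close>.\<close>

lemma Delta_commute:
  fixes a b :: "nat \<Rightarrow> nat \<Rightarrow> complex"
  assumes 1: "\<And>k l. k < n \<Longrightarrow> l < m \<Longrightarrow> (a k l + (if l = 0 then 0 else \<i> * a k (l - 1))) +
      (b k l - (if l = 0 then 0 else \<i> * b k (l - 1))) = 0"
    and 2: "\<And>k l. k < n \<Longrightarrow> l < m \<Longrightarrow> (a k l + (if Suc k < n then \<i> * a (Suc k) l else 0)) +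
      (b k l - (if Suc k < n then \<i> * b (Suc k) l else 0)) = 0"
    and kl: "k < n" "l < m"
  shows "(if l = 0 then 0 else b k (l - 1)) = (if Suc k < n then b (Suc k) l else 0)"
proof -
  define w where "w = (\<lambda>k l. a k l - b k l)"
  define s where "s = (\<lambda>k l. a k l + b k l)"
  have s1: "s k l = - \<i> * (if l = 0 then 0 else w k (l - 1))" if "k < n" "l < m" for k l
    using 1[OF that] unfolding s_def w_def
    by (cases l) (auto simp: algebra_simps eq_neg_iff_add_eq_0)
  have s2: "s k l = - \<i> * (if Suc k < n then w (Suc k) l else 0)" if "k < n" "l < m" for k l
    using 2[OF that] unfolding s_def w_def
    by (cases "Suc k < n") (auto simp: algebra_simps eq_neg_iff_add_eq_0)
  have w: "(if l = 0 then 0 else w k (l - 1)) = (if Suc k < n then w (Suc k) l else 0)"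
    using trans[OF s1[OF kl, symmetric] s2[OF kl]] by (simp only: mult_cancel_left) simp
  have s: "(if l = 0 then 0 else s k (l - 1)) = (if Suc k < n then s (Suc k) l else 0)"
  proof (cases l)
    case 0
    then show ?thesis using s1[of "Suc k" 0] kl by auto
  next
    case (Suc l')
    then show ?thesis using s2[of k l'] s1[of "Suc k" l] kl by auto
  qed
  have "b = (\<lambda>k l. (s k l - w k l) / 2)"
    by (simp add: s_def w_def)
  then show ?thesis
    using s w by (auto split: if_splits)
qed

lemma pair_spanning_Delta_Delta:
  assumes D: "D \<in> D_off (DeltaBlock m \<mu>) (DeltaBlock n \<mu>')" and \<mu>: "cmod \<mu> = 1" "cmod \<mu>' = 1"
  shows "pair_spanning (DeltaBlock m \<mu>) (DeltaBlock n \<mu>') D"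
  unfolding pair_spanning_def
proof (intro allI impI)
  fix y z k l
  assume E: "dual_eqs (DeltaBlock m \<mu>) (DeltaBlock n \<mu>') y z"
    and ok: "\<forall>k<summand_size (DeltaBlock n \<mu>'). \<forall>l<summand_size (DeltaBlock m \<mu>).
      dual_ok (fst D $$ (k, l)) (y k l) \<and> dual_ok (snd D $$ (l, k)) (z k l)"
    and "k < summand_size (DeltaBlock n \<mu>')" "l < summand_size (DeltaBlock m \<mu>)"
  then have kl: "k < n" "l < m" by auto
  define y' where "y' = (\<lambda>k l. y k (m - 1 - l))"
  define z' where "z' = (\<lambda>k l. z k (m - 1 - l))"
  note E' = Delta_Delta_dual_eqs[OF E y'_def z'_def]
  have *: "y' k l = 0 \<and> z' k l = 0" if kl: "k < n" "l < m" for k l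
  proof (cases "\<mu> = \<mu>' \<or> \<mu> = - \<mu>'")
    case False
    then have det: "\<mu> * cnj \<mu>' \<noteq> cnj \<mu> * \<mu>'" using unit_square_ne \<mu> by auto
    show ?thesis
    proof (rule rank_induct2[where n = n and m = m and \<rho> = "\<lambda>k l. (n - k) + l"])
      fix k l assume kl: "k < n" "l < m"
        and IH: "\<And>k' l'. k' < n \<Longrightarrow> l' < m \<Longrightarrow> n - k' + l' < n - k + l \<Longrightarrow> y' k' l' = 0 \<and> z' k' l' = 0"
      have "0 < l \<Longrightarrow> z' k (l - 1) = 0 \<and> y' k (l - 1) = 0" "Suc k < n \<Longrightarrow> z' (Suc k) l = 0 \<and> y' (Suc k) l = 0"
        using IH[of k "l - 1"] IH[of "Suc k" l] kl by auto
      with E'[OF kl] have "\<mu> * z' k l + cnj \<mu> * y' k l = 0" "\<mu>' * z' k l + cnj \<mu>' * y' k l = 0"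
        by (auto split: if_splits)
      then show "y' k l = 0 \<and> z' k l = 0"
        by (rule two_by_two_zero) (rule det)
    qed fact+
  next
    case True
    \<comment> \<open>For \<open>\<mu>' = - \<mu>\<close> the second equation is merely negated, so
      both signs lead to the same homogeneous system.\<close>
    have E2: "\<mu> * (z' k l + (if Suc k < n then \<i> * z' (Suc k) l else 0)) +
      cnj \<mu> * (y' k l - (if Suc k < n then \<i> * y' (Suc k) l else 0)) = 0" if "k < n" "l < m" for k l
      using True
    proof
      assume "\<mu> = - \<mu>'"
      then show ?thesis using arg_cong[OF E'(2)[OF that], of uminus]
        by (simp only: minus_add_distrib mult_minus_left complex_cnj_minus minus_zero)
    qed (use E'(2)[OF that] in simp)
    define a where "a = (\<lambda>k l. \<mu> * z' k l)"
    define b where "b = (\<lambda>k l. cnj \<mu> * y' k l)"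
    have a1: "(a k l + (if l = 0 then 0 else \<i> * a k (l - 1))) + (b k l - (if l = 0 then 0 else \<i> * b k (l - 1))) = 0"
      and a2: "(a k l + (if Suc k < n then \<i> * a (Suc k) l else 0)) + (b k l - (if Suc k < n then \<i> * b (Suc k) l else 0)) = 0"
      if "k < n" "l < m" for k l
      using E'(1)[OF that] E2[OF that] unfolding a_def b_def
      by (auto simp: algebra_simps split: if_splits)
    obtain S where S: "S \<in> z_nw n m" "fst D = S" using D True by auto
    have ok': "dual_ok (S $$ (k, m - 1 - l)) (y' k l)" if "k < n" "l < m" for k l
      using ok S(2) that unfolding y'_def by auto
    \<comment> \<open>The reversal of columns moves the starred first column of \<open>y\<close> to
      the last column of \<open>y'\<close>; a starred first row stays where it is.\<close>
    have "(\<forall>k<n. b k (m - 1) = 0) \<or> (\<forall>l<m. b 0 l = 0)"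
    proof -
      consider "S = stars n m (\<lambda>k l. l = 1)" | "S = stars n m (\<lambda>k l. k = 1)"
        using S(1) by (auto simp: z_nw_def)
      then show ?thesis
      proof cases
        case 1
        then show ?thesis using ok'[of _ "m - 1"] \<open>l < m\<close> unfolding b_def by auto
      next
        case 2
        then show ?thesis using ok'[of 0] \<open>k < n\<close> unfolding b_def by auto
      qed
    qed
    then have b: "b k l = 0" if "k < n" "l < m" for k l
      by (rule commuting_zero[where n = n and m = m, rotated]) (use Delta_commute[OF a1 a2] that in auto)
    \<comment> \<open>With \<open>b = 0\<close> the first equation is the nilpotent recursion
      \<open>a k l = - \<i> * a k (l - 1)\<close>.\<close>
    have a: "a k l = 0" if "k < n" "l < m" for k l
      using that
    proof (induction l)
      case 0
      then show ?case using a1[of k 0] b by simp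
    next
      case (Suc l)
      then show ?case using a1[of k "Suc l"] b[of k l] b[of k "Suc l"] by simp
    qed
    from a[OF kl] b[OF kl] \<mu> show ?thesis unfolding a_def b_def by auto
  qed
  have "m - 1 - (m - 1 - l) = l" "m - 1 - l < m" using kl by auto
  then show "y k l = 0 \<and> z k l = 0"
    using *[of k "m - 1 - l"] kl unfolding y'_def z'_def by simp
qed
subsection \<open>Pairs of nonsingular blocks: transversality\<close>

text \<open>The inequality \<open>l + n < m + k\<close> says that the diagonal through
  \<open>(k, l)\<close> reaches the bottom row before the last column, and there the recursion ends
  with the value 0.\<close>

lemma shift_down_zero:
  fixes p :: "nat \<Rightarrow> nat \<Rightarrow> complex"
  assumes step: "\<And>k l. k < n \<Longrightarrow> Suc l < m \<Longrightarrow> p k l = (if Suc k < n then p (Suc k) (Suc l) else 0)"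
    and kl: "k < n" "l + n < m + k"
  shows "p k l = 0"
  using kl
proof (induction "n - k" arbitrary: k l rule: less_induct)
  case less
  then show ?case using step[of k l] less.hyps[of "Suc k" "Suc l"] by auto
qed

text \<open>For \<open>l < k\<close> the diagonal, followed upwards, reaches the first column before
  the first row, and there the recursion ends with the value 0.\<close>

lemma shift_up_zero:
  fixes r :: "nat \<Rightarrow> nat \<Rightarrow> complex"
  assumes step: "\<And>k l. Suc k < n \<Longrightarrow> l < m \<Longrightarrow> r (Suc k) l = (if l = 0 then 0 else r k (l - 1))"
    and kl: "l < k" "k < n" "l < m"
  shows "r k l = 0"
  using kl
proof (induction l arbitrary: k)
  case 0
  then show ?case using step[of "k - 1" 0] by auto
next
  case (Suc l)
  then show ?case using step[of "k - 1" "Suc l"] Suc.IH[of "k - 1"] by auto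
qed

text \<open>Away from the starred edge \<open>R\<close> is constant along diagonals. On the edge the
  surviving part of the commutator is a single entry of \<open>R\<close>, and the comparison of
  \<open>n\<close> and \<open>m\<close> in \<open>z_sw\<close> guarantees that its diagonal runs
  into a zero at the border.\<close>

lemma commutator_sw_zero:
  fixes R :: "nat \<Rightarrow> nat \<Rightarrow> complex"
  assumes S: "S \<in> z_sw n m"
    and ok: "\<And>k l. k < n \<Longrightarrow> l < m \<Longrightarrow>
      sym_ok (S $$ (k, l)) ((if Suc k < n then R (Suc k) l else 0) - (if l = 0 then 0 else R k (l - 1)))"
    and kl: "k < n" "l < m"
  shows "(if Suc k < n then R (Suc k) l else 0) - (if l = 0 then 0 else R k (l - 1)) = 0"
proof -
  consider "n \<le> m" "S = stars n m (\<lambda>k l. l = 1)" | "m \<le> n" "S = stars n m (\<lambda>k l. k = n)"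
    using S by (auto simp: z_sw_def)
  then show ?thesis
  proof cases
    case 1
    have step: "R k l = (if Suc k < n then R (Suc k) (Suc l) else 0)" if "k < n" "Suc l < m" for k l
      using ok[OF that] that 1 by simp
    show ?thesis
    proof (cases l)
      case 0
      then show ?thesis using shift_down_zero[of n m R "Suc k" 0, OF step] kl 1 by auto
    next
      case (Suc l')
      then show ?thesis using ok[OF kl] kl 1 by simp
    qed
  next
    case 2
    have step: "R (Suc k) l = (if l = 0 then 0 else R k (l - 1))" if "Suc k < n" "l < m" for k l
      using ok[of k l] that 2 by simp
    show ?thesis
    proof (cases "Suc k < n")
      case False
      then show ?thesis using shift_up_zero[of n m R "l - 1" k, OF step] kl 2 by auto
    next
      case True
      then show ?thesis using ok[OF kl] kl 2 by simp
    qed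
  qed
qed

text \<open>Off the starred edge \<open>r = - p\<close>, and the equation then makes
  \<open>p\<close> and \<open>r\<close> constant along diagonals, which forces zeros on one side of
  the diagonal through the corner. With these zeros the sums \<open>p + r\<close> on the edge
  satisfy a recursion in which only division by \<open>c\<close> is required.\<close>

lemma upper_right_ne_zero:
  fixes p r :: "nat \<Rightarrow> nat \<Rightarrow> complex"
  assumes S: "S \<in> z_ne n m" and c: "c \<noteq> 0"
    and eq: "\<And>k l. k < n \<Longrightarrow> l < m \<Longrightarrow>
      c * (p k l + r k l) + (if Suc l < m then p k (Suc l) else 0) + (if k = 0 then 0 else r (k - 1) l) = 0"
    and ok: "\<And>k l. k < n \<Longrightarrow> l < m \<Longrightarrow> sym_ok (S $$ (k, l)) (p k l + r k l)"
    and kl: "k < n" "l < m"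
  shows "p k l + r k l = 0"
proof -
  consider "n \<le> m" "S = stars n m (\<lambda>k l. l = m)" | "m \<le> n" "S = stars n m (\<lambda>k l. k = 1)"
    using S by (auto simp: z_ne_def)
  then show ?thesis
  proof cases
    case 1
    have off: "p k l + r k l = 0" if "k < n" "Suc l < m" for k l
      using ok[of k l] that 1 by simp
    have step: "p k (Suc l) = (if k = 0 then 0 else p (k - 1) l)" if "k < n" "Suc l < m" for k l
      using eq[of k l] off[of k l] off[of "k - 1" l] that
      by (auto simp: add_eq_0_iff split: if_splits)
    have p: "p k l = 0" if "k < l" "k < n" "l < m" for k l
      by (rule shift_up_zero[where r = "\<lambda>l k. p k l" and n = m and m = n]) (use step that in auto)
    have "p k (m - 1) + r k (m - 1) = 0" if "k < n" for k
      using that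
    proof (induction k)
      case 0
      then show ?case using eq[of 0 "m - 1"] kl c by auto
    next
      case (Suc k)
      then show ?case using eq[of "Suc k" "m - 1"] p[of k "m - 1"] kl c 1 by auto
    qed
    moreover have "l = m - 1" if "\<not> Suc l < m" using kl that by simp
    ultimately show ?thesis using off[of k l] kl by (cases "Suc l < m") auto
  next
    case 2
    have off: "p k l + r k l = 0" if "k < n" "l < m" "k > 0" for k l
      using ok[of k l] that 2 by simp
    have step: "r k l = (if Suc l < m then r (Suc k) (Suc l) else 0)" if "Suc k < n" "l < m" for k l
      using eq[of "Suc k" l] off[of "Suc k" l] off[of "Suc k" "Suc l"] that
      by (auto simp: add_eq_0_iff split: if_splits)
    have r: "r 0 (Suc l) = 0" if "Suc l < m" for l
      by (rule shift_down_zero[where p = "\<lambda>l k. r k l" and n = m and m = n]) (use step that 2 kl in auto)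
    have "p 0 l + r 0 l = 0" if "l < m" for l
      using that
    proof (induction "m - l" arbitrary: l rule: less_induct)
      case less
      have "Suc l < m \<Longrightarrow> p 0 (Suc l) = 0" using less.hyps[of "Suc l"] r[of l] less.prems by auto
      then show ?case using eq[of 0 l] kl c less.prems by (auto split: if_splits)
    qed
    then show ?thesis using off kl by (cases k) auto
  qed
qed

text \<open>The mechanism is the same as for \<open>H\<close> blocks: the residual vanishes off the
  starred edge, so \<open>p\<close> and \<open>r\<close> are constant along diagonals there, and the
  border supplies the zeros that start and carry the induction along the edge.\<close>

lemma Delta_residual_zero:
  fixes p r :: "nat \<Rightarrow> nat \<Rightarrow> complex"
  assumes S: "S \<in> z_sw n m"
    and eq: "\<And>k l. k < n \<Longrightarrow> l < m \<Longrightarrow>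
      p k l + r k l = \<i> * ((if l = 0 then 0 else p k (l - 1)) + (if Suc k < n then r (Suc k) l else 0))"
    and ok: "\<And>k l. k < n \<Longrightarrow> l < m \<Longrightarrow> sym_ok (S $$ (k, l)) (p k l + r k l)"
    and kl: "k < n" "l < m"
  shows "p k l + r k l = 0"
proof -
  consider "n \<le> m" "S = stars n m (\<lambda>k l. l = 1)" | "m \<le> n" "S = stars n m (\<lambda>k l. k = n)"
    using S by (auto simp: z_sw_def)
  then show ?thesis
  proof cases
    case 1
    have off: "p k l + r k l = 0" if "k < n" "l < m" "l > 0" for k l
      using ok[of k l] that 1 by simp
    have step: "p k l = (if Suc k < n then p (Suc k) (Suc l) else 0)" if "k < n" "Suc l < m" for k l
      using eq[of k "Suc l"] off[of k "Suc l"] off[of "Suc k" "Suc l"] that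
      by (auto simp: add_eq_0_iff split: if_splits)
    have p: "p (Suc k) 0 = 0" if "Suc k < n" for k
      by (rule shift_down_zero[where n = n and m = m]) (use step that 1 in auto)
    have "p k 0 + r k 0 = 0" if "k < n" for k
      using that
    proof (induction "n - k" arbitrary: k rule: less_induct)
      case less
      have "Suc k < n \<Longrightarrow> r (Suc k) 0 = 0" using less.hyps[of "Suc k"] p[of k] less.prems by auto
      then show ?case using eq[of k 0] kl less.prems by (auto split: if_splits)
    qed
    then show ?thesis using off kl by (cases l) auto
  next
    case 2
    have off: "p k l + r k l = 0" if "Suc k < n" "l < m" for k l
      using ok[of k l] that 2 by simp
    have step: "r (Suc k) l = (if l = 0 then 0 else r k (l - 1))" if "Suc k < n" "l < m" for k l
      using eq[of k l] off[of k l] off[of k "l - 1"] that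
      by (auto simp: add_eq_0_iff split: if_splits)
    have r: "r (n - 1) l = 0" if "Suc l < m" for l
      by (rule shift_up_zero[where n = n and m = m]) (use step that 2 kl in auto)
    have "p (n - 1) l + r (n - 1) l = 0" if "l < m" for l
      using that
    proof (induction l)
      case 0
      then show ?case using eq[of "n - 1" 0] kl by auto
    next
      case (Suc l)
      then show ?case using eq[of "n - 1" "Suc l"] r[of l] kl by auto
    qed
    moreover have "k = n - 1" if "\<not> Suc k < n" using kl that by simp
    ultimately show ?thesis using off[of k l] kl by (cases "Suc k < n") auto
  qed
qed

text \<open>The vanishing part of \<open>congr2\<close> identifies the lower right block of
  \<open>P\<close> with minus the upper left block of \<open>R\<close>. The lower left part of
  \<open>congr1\<close> then becomes the commutator of \<open>R\<close> with a Jordan block, from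
  which \<open>\<nu>\<close> cancels. The argument serves pairs with equal eigenvalues and diagonal
  blocks alike.\<close>

lemma H_H_lower_left_zero:
  assumes S: "S \<in> z_sw n m"
    and V: "\<And>k l. k < n \<Longrightarrow> l < m \<Longrightarrow> congr2 (HBlock m \<nu>) (HBlock n \<nu>) P R (n + k) l = 0"
    and ok: "\<And>k l. k < n \<Longrightarrow> l < m \<Longrightarrow> sym_ok (S $$ (k, l)) (congr1 (HBlock m \<nu>) (HBlock n \<nu>) P R (n + k) l)"
    and kl: "k < n" "l < m"
  shows "congr1 (HBlock m \<nu>) (HBlock n \<nu>) P R (n + k) l = 0"
proof -
  have V': "P (n + k) (m + l) = - R k l" if "k < n" "l < m" for k l
    using V[OF that] that by (simp add: congr2_def block_mult eq_neg_iff_add_eq_0)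
  have U: "congr1 (HBlock m \<nu>) (HBlock n \<nu>) P R (n + k) l =
      (if Suc k < n then R (Suc k) l else 0) - (if l = 0 then 0 else R k (l - 1))" if "k < n" "l < m" for k l
    using that V'[of k l] V'[of k "l - 1"] by (cases l) (simp_all add: congr1_def block_mult)
  show ?thesis
    using commutator_sw_zero[OF S, of R k l] ok kl by (simp add: U)
qed

lemma pair_transversal_H_H:
  assumes D: "D \<in> D_off (HBlock m \<nu>) (HBlock n \<nu>')" and \<nu>: "1 < cmod \<nu>"
  shows "pair_transversal (HBlock m \<nu>) (HBlock n \<nu>') D"
proof (cases "\<nu> = \<nu>'")
  case False
  then show ?thesis using D by (intro pair_transversal_zeros) auto
next
  case True
  then obtain S S' where D': "D = (four_block_mat (zeros n m) S S' (zeros n m), zeros (2 * m) (2 * n))"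
    and SS: "S \<in> z_ne n m" "S' \<in> z_sw n m" using D by auto
  show ?thesis
    unfolding pair_transversal_def
  proof (intro allI impI)
    fix P R k l
    let ?U = "congr1 (HBlock m \<nu>) (HBlock n \<nu>') P R" and ?V = "congr2 (HBlock m \<nu>) (HBlock n \<nu>') P R"
    assume ok: "\<forall>k<summand_size (HBlock n \<nu>'). \<forall>l<summand_size (HBlock m \<nu>).
        sym_ok (fst D $$ (k, l)) (?U k l) \<and> sym_ok (snd D $$ (l, k)) (?V k l)"
      and "k < summand_size (HBlock n \<nu>')" "l < summand_size (HBlock m \<nu>)"
    then have kl: "k < 2 * n" "l < 2 * m" by auto
    have V: "?V k l = 0" if "k < 2 * n" "l < 2 * m" for k l
      using ok that D' by auto
    have U: "sym_ok (four_block_mat (zeros n m) S S' (zeros n m) $$ (k, l)) (?U k l)" if "k < 2 * n" "l < 2 * m" for k l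
      using ok that D' by auto
    note four = four_block_zeros_index[OF _ _ z_carrier(1)[OF SS(1)] z_carrier(2)[OF SS(2)]]
    have ul: "?U k l = 0" if "k < n" "l < m" for k l
      using U[of k l] four(1)[OF that] that by simp
    have lr: "?U (n + k) (m + l) = 0" if "k < n" "l < m" for k l
      using U[of "n + k" "m + l"] four(4)[OF that] that by simp
    have ll: "?U (n + k) l = 0" if "k < n" "l < m" for k l
      unfolding True[symmetric]
    proof (rule H_H_lower_left_zero[OF SS(2) _ _ that])
      show "congr2 (HBlock m \<nu>) (HBlock n \<nu>) P R (n + k) l = 0" if "k < n" "l < m" for k l
        using V[of "n + k" l] that True by simp
      show "sym_ok (S' $$ (k, l)) (congr1 (HBlock m \<nu>) (HBlock n \<nu>) P R (n + k) l)" if "k < n" "l < m" for k l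
        using U[of "n + k" l] four(3)[OF that] that True by simp
    qed
    have ur: "?U k (m + l) = 0" if kl: "k < n" "l < m" for k l
    proof -
      have U': "?U k (m + l) = P k l + R (n + k) (m + l)" if "k < n" "l < m" for k l
        using that by (simp add: congr1_def block_mult)
      have "P k l + R (n + k) (m + l) = 0"
      proof (rule upper_right_ne_zero[OF SS(1), where c = "cnj \<nu>" and r = "\<lambda>k l. R (n + k) (m + l)"])
        show "cnj \<nu> * (P k l + R (n + k) (m + l)) + (if Suc l < m then P k (Suc l) else 0) +
            (if k = 0 then 0 else R (n + (k - 1)) (m + l)) = 0" if "k < n" "l < m" for k l
        proof -
          have "?V k (m + l) = (cnj \<nu> * P k l + (if Suc l < m then P k (Suc l) else 0)) +
              (cnj \<nu> * R (n + k) (m + l) + (if k = 0 then 0 else R (n + (k - 1)) (m + l)))"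
            using that True by (simp add: congr2_def block_mult)
          with V[of k "m + l"] that show ?thesis by (simp add: distrib_left add_ac)
        qed
        show "sym_ok (S $$ (k, l)) (P k l + R (n + k) (m + l))" if "k < n" "l < m" for k l
          using U[of k "m + l"] four(2)[OF that] that U' by simp
      qed (use \<nu> kl in auto)
      then show ?thesis using U' kl by simp
    qed
    show "?U k l = 0 \<and> ?V k l = 0"
      using V[OF kl] ul ur ll lr kl by (elim less_doubleE[of k n] less_doubleE[of l m]) auto
  qed
qed

text \<open>In the coordinates \<open>p\<close> and \<open>r\<close> the residuals are
  \<open>s + \<i> * c\<close> and, after multiplication by \<open>\<mu> * \<mu>\<close>,
  \<open>s - \<i> * c\<close> with the same \<open>s = p + r\<close> and \<open>c\<close>. If the
  second one vanishes, the first one is \<open>2 * s\<close>. The sign \<open>\<epsilon>\<close>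
  treats \<open>\<mu>' = \<mu>\<close> and \<open>\<mu>' = - \<mu>\<close> together.\<close>

lemma Delta_congr_flip:
  assumes "k < n" "l < m"
    and p_def: "p = (\<lambda>k l. \<mu> * P (n - 1 - k) (m - 1 - l))" and r_def: "r = (\<lambda>k l. \<epsilon> * \<mu> * R k l)"
    and \<mu>: "cmod \<mu> = 1" and \<epsilon>: "\<epsilon> = 1 \<or> \<epsilon> = -1"
  shows "congr1 (DeltaBlock m \<mu>) (DeltaBlock n (\<epsilon> * \<mu>)) P R (n - 1 - k) l =
      p k l + r k l + \<i> * ((if l = 0 then 0 else p k (l - 1)) + (if Suc k < n then r (Suc k) l else 0))"
    "\<mu> * \<mu> * congr2 (DeltaBlock m \<mu>) (DeltaBlock n (\<epsilon> * \<mu>)) P R (n - 1 - k) l =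
      p k l + r k l - \<i> * ((if l = 0 then 0 else p k (l - 1)) + (if Suc k < n then r (Suc k) l else 0))"
proof -
  show "congr1 (DeltaBlock m \<mu>) (DeltaBlock n (\<epsilon> * \<mu>)) P R (n - 1 - k) l =
      p k l + r k l + \<i> * ((if l = 0 then 0 else p k (l - 1)) + (if Suc k < n then r (Suc k) l else 0))"
    unfolding congr1_def mult_col_Delta_flip[OF assms(1)] p_def r_def
    using assms(2) by (cases l) (auto simp: row_mult_Delta algebra_simps)
  have *: "\<mu> * \<mu> * congr2 (DeltaBlock m \<mu>) (DeltaBlock n (\<epsilon> * \<mu>)) P R (n - 1 - k) l =
      (\<mu> * cnj \<mu>) * (p k l + r k l - \<i> * ((if l = 0 then 0 else p k (l - 1)) + (if Suc k < n then r (Suc k) l else 0)))"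
    unfolding congr2_def mult_col_Delta_flip[OF assms(1)] p_def r_def
    using assms(2) \<epsilon> by (cases l) (auto simp: row_mult_adj_Delta algebra_simps)
  then show "\<mu> * \<mu> * congr2 (DeltaBlock m \<mu>) (DeltaBlock n (\<epsilon> * \<mu>)) P R (n - 1 - k) l =
      p k l + r k l - \<i> * ((if l = 0 then 0 else p k (l - 1)) + (if Suc k < n then r (Suc k) l else 0))"
    unfolding unit_mult_cnj[OF \<mu>] by simp
qed

lemma pair_transversal_Delta_Delta:
  assumes D: "D \<in> D_off (DeltaBlock m \<mu>) (DeltaBlock n \<mu>')" and \<mu>: "cmod \<mu> = 1"
  shows "pair_transversal (DeltaBlock m \<mu>) (DeltaBlock n \<mu>') D"
proof (cases "\<mu> = \<mu>' \<or> \<mu> = - \<mu>'")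
  case False
  then show ?thesis using D by (intro pair_transversal_zeros) auto
next
  case True
  then obtain \<epsilon> where \<epsilon>: "\<mu>' = \<epsilon> * \<mu>" "\<epsilon> = 1 \<or> \<epsilon> = -1"
    by (metis mult_1 mult_minus1 neg_equal_iff_equal verit_minus_simplify(4))
  obtain S where S: "S \<in> z_nw n m" "D = (S, zeros m n)" using D True by auto
  \<comment> \<open>The residual is read with reversed rows, and this reversal turns a pattern of
    \<open>z_nw\<close> into one of \<open>z_sw\<close>.\<close>
  define S' where "S' = mat n m (\<lambda>(k, l). S $$ (n - 1 - k, l))"
  have S': "S' \<in> z_sw n m"
  proof -
    consider "n \<le> m" "S = stars n m (\<lambda>k l. l = 1)" | "m \<le> n" "S = stars n m (\<lambda>k l. k = 1)"
      using S(1) by (auto simp: z_nw_def)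
    then show ?thesis
    proof cases
      case 1
      have "S' = stars n m (\<lambda>k l. l = 1)"
        by (rule eq_matI) (auto simp: S'_def 1)
      then show ?thesis using 1 by (auto simp: z_sw_def)
    next
      case 2
      have "S' = stars n m (\<lambda>k l. k = n)"
        by (rule eq_matI) (auto simp: S'_def 2)
      then show ?thesis using 2 by (auto simp: z_sw_def)
    qed
  qed
  show ?thesis
    unfolding pair_transversal_def
  proof (intro allI impI)
    fix P R k l
    let ?U = "congr1 (DeltaBlock m \<mu>) (DeltaBlock n \<mu>') P R" and ?V = "congr2 (DeltaBlock m \<mu>) (DeltaBlock n \<mu>') P R"
    assume ok: "\<forall>k<summand_size (DeltaBlock n \<mu>'). \<forall>l<summand_size (DeltaBlock m \<mu>).
        sym_ok (fst D $$ (k, l)) (?U k l) \<and> sym_ok (snd D $$ (l, k)) (?V k l)"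
      and "k < summand_size (DeltaBlock n \<mu>')" "l < summand_size (DeltaBlock m \<mu>)"
    then have kl: "k < n" "l < m" by auto
    have V: "?V k l = 0" if "k < n" "l < m" for k l
      using ok that S by auto
    define p where "p = (\<lambda>k l. \<mu> * P (n - 1 - k) (m - 1 - l))"
    define r where "r = (\<lambda>k l. \<epsilon> * \<mu> * R k l)"
    note flip = Delta_congr_flip[OF _ _ p_def r_def \<mu> \<epsilon>(2), folded \<epsilon>(1)]
    have V': "p k l + r k l = \<i> * ((if l = 0 then 0 else p k (l - 1)) + (if Suc k < n then r (Suc k) l else 0))"
      if "k < n" "l < m" for k l
    proof -
      have "?V (n - 1 - k) l = 0" using V that by simp
      then show ?thesis using flip(2)[OF that] by simp
    qed
    have U': "?U (n - 1 - k) l = 2 * (p k l + r k l)" if "k < n" "l < m" for k l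
      using flip(1)[OF that] V'[OF that] by simp
    have *: "p k l + r k l = 0" if "k < n" "l < m" for k l
    proof (rule Delta_residual_zero[OF S' V'])
      fix k l assume "k < n" "l < m"
      then have "sym_ok (S' $$ (k, l)) (?U (n - 1 - k) l)"
        using ok S(2) unfolding S'_def by simp
      then have "sym_ok (S' $$ (k, l)) (2 * (p k l + r k l))"
        using U'[OF \<open>k < n\<close> \<open>l < m\<close>] by simp
      moreover have "sym_ok s (2 * z) = sym_ok s z" for s z
        by (cases s) auto
      ultimately show "sym_ok (S' $$ (k, l)) (p k l + r k l)" by blast
    qed (use that in auto)
    have "n - 1 - (n - 1 - k) = k" "n - 1 - k < n" using kl by auto
    moreover have "?U (n - 1 - (n - 1 - k)) l = 0"
      unfolding U'[OF \<open>n - 1 - k < n\<close> kl(2)] *[OF \<open>n - 1 - k < n\<close> kl(2)] by simp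
    ultimately show "?U k l = 0 \<and> ?V k l = 0"
      using V[OF kl] by simp
  qed
qed
subsection \<open>A nonsingular block and a nilpotent block\<close>

text \<open>Invertibility is phrased for row vectors because, against a nilpotent block, whole rows
  of the unknowns are propagated.\<close>

definition nonsingular_summand :: "summand \<Rightarrow> bool" where
  "nonsingular_summand s \<longleftrightarrow>
     (\<forall>v. (\<forall>l<summand_size s. row_mult s v l = 0) \<longrightarrow> (\<forall>l<summand_size s. v l = 0)) \<and>
     (\<forall>v. (\<forall>l<summand_size s. row_mult_adj s v l = 0) \<longrightarrow> (\<forall>l<summand_size s. v l = 0))"

lemma nonsingular_H:
  assumes "1 < cmod \<nu>"
  shows "nonsingular_summand (HBlock m \<nu>)"
proof -
  have \<nu>: "\<nu> \<noteq> 0" using assms by auto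
  have 1: "v l = 0" if v: "\<And>l. l < 2 * m \<Longrightarrow> row_mult (HBlock m \<nu>) v l = 0" and l: "l < 2 * m" for v l
  proof -
    have a: "v l = 0" if "l < m" for l using v[of "m + l"] that by (simp add: block_mult)
    have b: "v (m + l) = 0" if "l < m" for l
      using that
    proof (induction l)
      case 0
      then show ?case using v[of 0] row_mult_H(1)[of 0 m \<nu> v] \<nu> by auto
    next
      case (Suc l)
      then show ?case using v[of "Suc l"] row_mult_H(1)[of "Suc l" m \<nu> v] \<nu> by auto
    qed
    show ?thesis using l a b by (elim less_doubleE) auto
  qed
  have 2: "v l = 0" if v: "\<And>l. l < 2 * m \<Longrightarrow> row_mult_adj (HBlock m \<nu>) v l = 0" and l: "l < 2 * m" for v l
  proof -
    have a: "v (m + l) = 0" if "l < m" for l using v[of l] that by (simp add: block_mult)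
    have b: "v l = 0" if "l < m" for l
      using that
    proof (induction "m - l" arbitrary: l rule: less_induct)
      case less
      then show ?case using v[of "m + l"] row_mult_adj_H(2)[of l m \<nu> v] \<nu> less.hyps[of "Suc l"] less.prems
        by (auto split: if_splits)
    qed
    show ?thesis using l a b by (elim less_doubleE) auto
  qed
  show ?thesis
    unfolding nonsingular_summand_def
  proof (intro conjI allI impI)
    fix v l
    assume "\<forall>l<summand_size (HBlock m \<nu>). row_mult (HBlock m \<nu>) v l = 0" "l < summand_size (HBlock m \<nu>)"
    then show "v l = 0" by (intro 1[where v = v]) simp_all
  next
    fix v l
    assume "\<forall>l<summand_size (HBlock m \<nu>). row_mult_adj (HBlock m \<nu>) v l = 0" "l < summand_size (HBlock m \<nu>)"
    then show "v l = 0" by (intro 2[where v = v]) simp_all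
  qed
qed

lemma nonsingular_Delta:
  assumes "cmod \<mu> = 1"
  shows "nonsingular_summand (DeltaBlock m \<mu>)"
proof -
  have \<mu>: "\<mu> \<noteq> 0" using assms by auto
  \<comment> \<open>Both row products lead to this recursion, with \<open>c = - \<i>\<close> and
    \<open>c = \<i>\<close>.\<close>
  have 0: "v l = 0" if v: "\<And>l. l < m \<Longrightarrow> v (m - 1 - l) = (if l = 0 then 0 else c * v (m - l))" and l: "l < m"
    for c :: complex and v l
  proof -
    have "v (m - 1 - l) = 0" if "l < m" for l
      using that
    proof (induction l)
      case 0
      then show ?case using v[of 0] by simp
    next
      case (Suc l)
      then show ?case using v[of "Suc l"] by simp
    qed
    from this[of "m - 1 - l"] l show ?thesis by simp
  qed
  have 1: "v l = 0" if v: "\<And>l. l < m \<Longrightarrow> row_mult (DeltaBlock m \<mu>) v l = 0" and l: "l < m" for v l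
  proof (rule 0[OF _ l, of v "- \<i>"])
    fix l assume "l < m"
    then show "v (m - 1 - l) = (if l = 0 then 0 else - \<i> * v (m - l))"
      using v[of l] \<mu> by (auto simp: block_mult add_eq_0_iff2 split: if_splits)
  qed
  have 2: "v l = 0" if v: "\<And>l. l < m \<Longrightarrow> row_mult_adj (DeltaBlock m \<mu>) v l = 0" and l: "l < m" for v l
  proof (rule 0[OF _ l, of v "\<i>"])
    fix l assume "l < m"
    then show "v (m - 1 - l) = (if l = 0 then 0 else \<i> * v (m - l))"
      using v[of l] \<mu> by (simp add: block_mult)
  qed
  show ?thesis
    unfolding nonsingular_summand_def
  proof (intro conjI allI impI)
    fix v l
    assume "\<forall>l<summand_size (DeltaBlock m \<mu>). row_mult (DeltaBlock m \<mu>) v l = 0" "l < summand_size (DeltaBlock m \<mu>)"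
    then show "v l = 0" by (intro 1[where v = v]) simp_all
  next
    fix v l
    assume "\<forall>l<summand_size (DeltaBlock m \<mu>). row_mult_adj (DeltaBlock m \<mu>) v l = 0" "l < summand_size (DeltaBlock m \<mu>)"
    then show "v l = 0" by (intro 2[where v = v]) simp_all
  qed
qed

lemma row_mult_zero: "(\<And>l. l < summand_size s \<Longrightarrow> v l = 0) \<Longrightarrow> row_mult s v l = 0"
  "(\<And>l. l < summand_size s \<Longrightarrow> v l = 0) \<Longrightarrow> row_mult_adj s v l = 0"
  by (auto simp: row_mult_def row_mult_adj_def)

text \<open>Rows propagate in steps of two: a zero row of \<open>y\<close> is a zero row of \<open>z\<close> because the first block is
  nonsingular, and \<open>N z + N\<^sup>* y = 0\<close> identifies row \<open>k + 2\<close> of \<open>z\<close> with row \<open>k\<close> of \<open>- y\<close>.\<close>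

lemma pair_spanning_nonsingular_J:
  assumes ns: "nonsingular_summand s" and n: "0 < n"
    and D: "odd n \<Longrightarrow> fst D \<in> z_updown n (summand_size s)"
  shows "pair_spanning s (JBlock n) D"
  unfolding pair_spanning_def
proof (intro allI impI)
  fix y z k l
  let ?m = "summand_size s"
  assume E: "dual_eqs s (JBlock n) y z"
    and ok: "\<forall>k<summand_size (JBlock n). \<forall>l<?m. dual_ok (fst D $$ (k, l)) (y k l) \<and> dual_ok (snd D $$ (l, k)) (z k l)"
    and "k < summand_size (JBlock n)" "l < ?m"
  then have kl: "k < n" "l < ?m" by auto
  have E1: "row_mult s (z k) l + row_mult_adj s (y k) l = 0" if "k < n" "l < ?m" for k l
    using E that unfolding dual_eqs_def by auto
  have E2: "(if Suc k < n then z (Suc k) l else 0) + (if k = 0 then 0 else y (k - 1) l) = 0" if "k < n" "l < ?m" for k l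
    using E that unfolding dual_eqs_def by (auto simp: block_mult split: if_splits)
  define Z where "Z k \<longleftrightarrow> (\<forall>l<?m. y k l = 0 \<and> z k l = 0)" for k
  have Zz: "Z k" if "k < n" "\<And>l. l < ?m \<Longrightarrow> z k l = 0" for k
  proof -
    have "row_mult_adj s (y k) l = 0" if "l < ?m" for l
      using E1[OF \<open>k < n\<close> that] row_mult_zero(1)[of s "z k" l] \<open>\<And>l. l < ?m \<Longrightarrow> z k l = 0\<close> by simp
    then show ?thesis using ns that unfolding Z_def nonsingular_summand_def by blast
  qed
  have Zy: "Z k" if "k < n" "\<And>l. l < ?m \<Longrightarrow> y k l = 0" for k
  proof -
    have "row_mult s (z k) l = 0" if "l < ?m" for l
      using E1[OF \<open>k < n\<close> that] row_mult_zero(2)[of s "y k" l] \<open>\<And>l. l < ?m \<Longrightarrow> y k l = 0\<close> by simp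
    then show ?thesis using ns that unfolding Z_def nonsingular_summand_def by blast
  qed
  have up: "Z (Suc (Suc k))" if "Z k" "Suc (Suc k) < n" for k
    by (rule Zz) (use E2[of "Suc k"] that in \<open>auto simp: Z_def\<close>)
  have down: "Z k" if "Z (Suc (Suc k))" "Suc (Suc k) < n" for k
    by (rule Zy) (use E2[of "Suc k"] that in \<open>auto simp: Z_def\<close>)
  have ups: "Z (k + 2 * j)" if "Z k" "k + 2 * j < n" for k j
    using that by (induction j) (auto intro: up)
  have downs: "Z k" if "Z (k + 2 * j)" "k + 2 * j < n" for k j
    using that by (induction j) (auto intro: down)
  have odds: "Z (1 + 2 * j)" if "1 + 2 * j < n" for j
    by (rule ups) (use Zz[of 1] E2[of 0] that in auto)
  \<comment> \<open>The odd rows started from row 1 of \<open>z\<close>, which is always zero. For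
    even \<open>n\<close> the last equation gives \<open>y (n - 2) = 0\<close>, the start of a
    descent through the even rows. For odd \<open>n\<close> this chain has two free ends, and the
    starred first or last row supplies the missing start.\<close>
  have evens: "Z (2 * j)" if "2 * j < n" for j
  proof (cases "even n")
    case True
    then obtain i where i: "n = 2 * i" by (elim evenE)
    then have *: "2 * j + 2 * (i - 1 - j) = n - 2" "2 \<le> n" using that by auto
    have "Z (n - 2)"
      by (rule Zy) (use E2[of "n - 1"] * in \<open>auto simp: numeral_2_eq_2\<close>)
    then show ?thesis using downs[of "2 * j" "i - 1 - j"] * by auto
  next
    case False
    then obtain i where i: "n = 2 * i + 1" by (elim oddE)
    consider "fst D = stars n ?m (\<lambda>k l. k = 1)" | "fst D = stars n ?m (\<lambda>k l. k = n)"
      using D False unfolding z_updown_def by auto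
    then show ?thesis
    proof cases
      case 1
      have "Z 0" by (rule Zy) (use ok[rule_format, of 0] 1 i in auto)
      then show ?thesis using ups[of 0 j] that by simp
    next
      case 2
      have "Z (n - 1)" by (rule Zy) (use ok[rule_format, of "n - 1"] 2 i in auto)
      moreover have "2 * j + 2 * (i - j) = n - 1" using that i by auto
      ultimately show ?thesis using downs[of "2 * j" "i - j"] n by auto
    qed
  qed
  have "Z k"
  proof (cases "even k")
    case True
    then show ?thesis using evens kl by (elim evenE) auto
  next
    case False
    then show ?thesis using odds kl by (elim oddE) (auto simp: add.commute)
  qed
  then show "y k l = 0 \<and> z k l = 0" using kl unfolding Z_def by auto
qed

text \<open>The equations transport zeros along the rows \<open>P 0\<close>, \<open>R 1\<close>,
  \<open>P 2\<close>, up to \<open>P (n - 1)\<close>. Both ends are available: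
  \<open>P 0 = 0\<close> always, and \<open>P (n - 1) = 0\<close> if the residual vanishes in the
  last row. Starting from the end away from the starred row, the chain arrives at the two terms of
  the residual in that row.\<close>

lemma pair_transversal_nonsingular_J:
  assumes ns: "nonsingular_summand s" and "odd n"
    and D: "fst D \<in> z_updown n (summand_size s)" "snd D = zeros (summand_size s) n"
  shows "pair_transversal s (JBlock n) D"
  unfolding pair_transversal_def
proof (intro allI impI)
  fix P R k l
  let ?m = "summand_size s"
  let ?U = "congr1 s (JBlock n) P R" and ?V = "congr2 s (JBlock n) P R"
  assume ok: "\<forall>k<summand_size (JBlock n). \<forall>l<?m. sym_ok (fst D $$ (k, l)) (?U k l) \<and> sym_ok (snd D $$ (l, k)) (?V k l)"
    and "k < summand_size (JBlock n)" "l < ?m"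
  then have kl: "k < n" "l < ?m" by auto
  obtain i where i: "n = 2 * i + 1" using \<open>odd n\<close> by (elim oddE)
  have V0: "?V k l = 0" if "k < n" "l < ?m" for k l
    using ok that D(2) by auto
  then have V: "row_mult_adj s (P k) l + (if k = 0 then 0 else R (k - 1) l) = 0" if "k < n" "l < ?m" for k l
    using that V0[OF that] by (simp add: congr2_def block_mult)
  have U: "?U k l = row_mult s (P k) l + (if Suc k < n then R (Suc k) l else 0)" if "k < n" "l < ?m" for k l
    using that by (simp add: congr1_def block_mult)
  have P: "\<And>l. l < ?m \<Longrightarrow> P k l = 0" if "\<And>l. l < ?m \<Longrightarrow> row_mult_adj s (P k) l = 0" for k
    using ns that unfolding nonsingular_summand_def by blast
  have P': "\<And>l. l < ?m \<Longrightarrow> P k l = 0" if "\<And>l. l < ?m \<Longrightarrow> row_mult s (P k) l = 0" for k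
    using ns that unfolding nonsingular_summand_def by blast
  have P0: "P 0 l = 0" if "l < ?m" for l
    by (rule P) (use V[of 0] i that in auto)
  consider "fst D = stars n ?m (\<lambda>k l. k = 1)" | "fst D = stars n ?m (\<lambda>k l. k = n)"
    using D unfolding z_updown_def by auto
  then have "?U k l = 0"
  proof cases
    case 1
    have U0: "row_mult s (P k) l + (if Suc k < n then R (Suc k) l else 0) = 0" if "k < n" "l < ?m" "k \<noteq> 0" for k l
      using U[of k l] ok[rule_format, of k l] that 1 by auto
    have odd_R: "R (2 * j + 1) l = 0" if "j < i" "l < ?m" for j l
      using that
    proof (induction "i - j" arbitrary: j l rule: less_induct)
      case less
      have row: "row_mult s (P (2 * j + 2)) l = 0" if l: "l < ?m" for l
      proof (cases "Suc j < i")
        case True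
        then have "R (2 * Suc j + 1) l = 0" using less.hyps[of "Suc j" l] less.prems l by auto
        then show ?thesis using U0[of "2 * j + 2" l] l True i by (auto split: if_splits)
      next
        case False
        then show ?thesis using U0[of "2 * j + 2" l] less.prems i l by (auto split: if_splits)
      qed
      have "row_mult_adj s (P (2 * j + 2)) l = 0"
        by (rule row_mult_zero) (rule P'[OF row])
      then show ?case using V[of "2 * j + 2" l] less.prems i by auto
    qed
    show ?thesis
    proof (cases "k = 0")
      case True
      have "row_mult s (P 0) l = 0" by (rule row_mult_zero) (rule P0)
      then show ?thesis using U[OF kl] odd_R[of 0 l] True kl i by (auto split: if_splits)
    next
      case False
      then show ?thesis using U0[of k l] U[OF kl] kl by simp
    qed
  next
    case 2
    have U0: "row_mult s (P k) l + (if Suc k < n then R (Suc k) l else 0) = 0" if "Suc k < n" "l < ?m" for k l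
      using U[of k l] ok[rule_format, of k l] that 2 by auto
    have even_P: "P (2 * j) l = 0" if "j \<le> i" "l < ?m" for j l
      using that
    proof (induction j arbitrary: l)
      case 0
      then show ?case using P0 by simp
    next
      case (Suc j)
      show ?case
      proof (rule P)
        fix l assume l: "l < ?m"
        have "row_mult s (P (2 * j)) l = 0" by (rule row_mult_zero) (use Suc in auto)
        then have "R (2 * j + 1) l = 0" using U0[of "2 * j" l] Suc.prems i l by auto
        then show "row_mult_adj s (P (2 * Suc j)) l = 0" using V[of "2 * Suc j" l] Suc.prems i l by auto
      qed fact
    qed
    show ?thesis
    proof (cases "Suc k < n")
      case True
      then show ?thesis using U0[of k l] U[OF kl] kl by simp
    next
      case False
      then have "k = 2 * i" using kl i by simp
      moreover have "row_mult s (P (2 * i)) l = 0" by (rule row_mult_zero) (use even_P in auto)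
      ultimately show ?thesis using U[OF kl] False by simp
    qed
  qed
  then show "?U k l = 0 \<and> ?V k l = 0" using V0 kl by simp
qed

subsection \<open>Diagonal blocks\<close>

lemma diag_spanning_H:
  assumes D: "D \<in> D_diag (HBlock m \<nu>)" and \<nu>: "1 < cmod \<nu>"
  shows "diag_spanning (HBlock m \<nu>) D"
  unfolding diag_spanning_def
proof (intro allI impI)
  fix x k l
  assume E: "dual_eqs (HBlock m \<nu>) (HBlock m \<nu>) x (\<lambda>k l. cnj (x l k))"
    and ok: "\<forall>k<summand_size (HBlock m \<nu>). \<forall>l<summand_size (HBlock m \<nu>). dual_ok (D $$ (k, l)) (x k l)"
    and "k < summand_size (HBlock m \<nu>)" "l < summand_size (HBlock m \<nu>)"
  then have kl: "k < 2 * m" "l < 2 * m" by auto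
  obtain S where S: "D = four_block_mat (zeros m m) (zeros m m) S (zeros m m)" "S \<in> z_sw m m"
    using D by auto
  have "dual_ok (S $$ (k, l)) (x (m + k) l)" if "k < m" "l < m" for k l
  proof -
    have "D $$ (m + k, l) = S $$ (k, l)"
      unfolding S(1) by (rule four_block_zeros_index) (use that S z_carrier in auto)
    then show ?thesis using ok[rule_format, of "m + k" l] that by simp
  qed
  then have sw: "\<exists>S\<in>z_sw m m. \<forall>k<m. \<forall>l<m. dual_ok (S $$ (k, l)) (x (m + k) l)"
    using S(2) by blast
  have ll: "x (m + k) l = 0" if "k < m" "l < m" for k l
    by (rule conjunct1[OF zero_of_lower_left[where a = "cnj \<nu>" and b = "cnj \<nu>" and n = m and m = m
          and Y = "\<lambda>k l. x (m + k) l" and Z = "\<lambda>k l. cnj (x l (m + k))"]])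
      (use H_H_dual_eqs(4,5)[OF E] sw that in auto)
  \<comment> \<open>Since \<open>z\<close> is the adjoint of \<open>x\<close>, the first equation
    expresses the upper right block through the lower left one.\<close>
  have ur: "x k (m + l) = 0" if "k < m" "l < m" for k l
    using H_H_dual_eqs(1)[OF E that] ll[of l k] ll[of "l - 1" k] that by (auto split: if_splits)
  show "x k l = 0"
    using H_H_dual_diagonal_blocks[OF E \<nu> \<nu>] ur ll kl
    by (elim less_doubleE[of k m] less_doubleE[of l m]) auto
qed

lemma diag_transversal_H:
  assumes D: "D \<in> D_diag (HBlock m \<nu>)"
  shows "diag_transversal (HBlock m \<nu>) D"
  unfolding diag_transversal_def
proof (intro allI impI)
  fix C k l
  let ?P = "\<lambda>(k::nat) (j::nat). cnj (C j k)"
  let ?U = "congr1 (HBlock m \<nu>) (HBlock m \<nu>) ?P C"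
  assume ok: "\<forall>k<summand_size (HBlock m \<nu>). \<forall>l<summand_size (HBlock m \<nu>). sym_ok (D $$ (k, l)) (?U k l)"
    and "k < summand_size (HBlock m \<nu>)" "l < summand_size (HBlock m \<nu>)"
  then have kl: "k < 2 * m" "l < 2 * m" by auto
  obtain S where S: "D = four_block_mat (zeros m m) (zeros m m) S (zeros m m)" "S \<in> z_sw m m"
    using D by auto
  note four = four_block_zeros_index[OF _ _ z_carrier(4) z_carrier(2)[OF S(2)], folded S(1)]
  have ul: "?U k l = 0" if "k < m" "l < m" for k l
    using ok[rule_format, of k l] four(1)[OF that] that by simp
  have lr: "?U (m + k) (m + l) = 0" if "k < m" "l < m" for k l
    using ok[rule_format, of "m + k" "m + l"] four(4)[OF that] that by simp
  have ur: "?U k (m + l) = 0" if "k < m" "l < m" for k l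
    using ok[rule_format, of k "m + l"] four(2)[OF that] that by simp
  have ll: "?U (m + k) l = 0" if "k < m" "l < m" for k l
  proof (rule H_H_lower_left_zero[OF S(2) _ _ that])
    \<comment> \<open>The lower left part of the second residual is the adjoint of the upper right
      part of the first, where the pattern is zero.\<close>
    show "congr2 (HBlock m \<nu>) (HBlock m \<nu>) ?P C (m + k) l = 0" if "k < m" "l < m" for k l
      using ur that by (simp add: congr2_self)
    show "sym_ok (S $$ (k, l)) (?U (m + k) l)" if "k < m" "l < m" for k l
      using ok[rule_format, of "m + k" l] four(3)[OF that] that by simp
  qed
  show "?U k l = 0"
    using ul ur ll lr kl by (elim less_doubleE[of k m] less_doubleE[of l m]) auto
qed
text \<open>The content is that the real line described by the middle symbol, \<open>\<real>\<close>
  for a circle and \<open>\<i> \<real>\<close> for a bullet, differs from the line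
  \<open>\<mu> \<real>\<close>.\<close>

lemma D_diag_Delta:
  assumes "D \<in> D_diag (DeltaBlock n \<mu>)" "cmod \<mu> = 1"
  obtains s where "D = z_diag s n" "s = Circ \<and> Im \<mu> \<noteq> 0 \<or> s = Bullet \<and> Re \<mu> \<noteq> 0"
proof -
  have "\<not> (Re \<mu> = 0 \<and> Im \<mu> = 0)" using assms(2) by (metis complex_eq_0 norm_zero zero_neq_one complex_eqI zero_complex.simps)
  then show ?thesis using assms(1) that by (auto simp: complex_is_Real_iff split: if_splits)
qed

text \<open>After reversal \<open>x\<close> becomes, up to the factor \<open>cnj \<mu>\<close>, an
  upper triangular Toeplitz matrix with coefficients \<open>\<tau>\<close>, and the fact that
  \<open>z\<close> is the adjoint of \<open>x\<close> couples neighbours by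
  \<open>Re (\<tau> l) = - Im (\<tau> (l - 1))\<close>. The stars kill every second coefficient of
  positive index, the coupling kills those in between, and for odd \<open>n\<close> the coefficient
  \<open>\<tau> 0\<close> is left to the middle symbol.\<close>

lemma diag_spanning_Delta:
  assumes D: "D \<in> D_diag (DeltaBlock n \<mu>)" and \<mu>: "cmod \<mu> = 1"
  shows "diag_spanning (DeltaBlock n \<mu>) D"
  unfolding diag_spanning_def
proof (intro allI impI)
  fix x :: "nat \<Rightarrow> nat \<Rightarrow> complex" and k l
  let ?z = "\<lambda>k l. cnj (x l k)"
  assume E: "dual_eqs (DeltaBlock n \<mu>) (DeltaBlock n \<mu>) x ?z"
    and ok: "\<forall>k<summand_size (DeltaBlock n \<mu>). \<forall>l<summand_size (DeltaBlock n \<mu>). dual_ok (D $$ (k, l)) (x k l)"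
    and "k < summand_size (DeltaBlock n \<mu>)" "l < summand_size (DeltaBlock n \<mu>)"
  then have kl: "k < n" "l < n" by auto
  obtain s where s: "D = z_diag s n" "s = Circ \<and> Im \<mu> \<noteq> 0 \<or> s = Bullet \<and> Re \<mu> \<noteq> 0"
    using D_diag_Delta[OF D \<mu>] .
  define y' where "y' = (\<lambda>k l. x k (n - 1 - l))"
  define z' where "z' = (\<lambda>k l. ?z k (n - 1 - l))"
  note E' = Delta_Delta_dual_eqs[OF E y'_def z'_def]
  define a where "a = (\<lambda>k l. \<mu> * z' k l)"
  define b where "b = (\<lambda>k l. cnj \<mu> * y' k l)"
  have a1: "(a k l + (if l = 0 then 0 else \<i> * a k (l - 1))) + (b k l - (if l = 0 then 0 else \<i> * b k (l - 1))) = 0"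
    and a2: "(a k l + (if Suc k < n then \<i> * a (Suc k) l else 0)) + (b k l - (if Suc k < n then \<i> * b (Suc k) l else 0)) = 0"
    if "k < n" "l < n" for k l
    using E'[OF that] unfolding a_def b_def
    by (auto simp: algebra_simps split: if_splits)
  have comm: "b (Suc k) l = (if l = 0 then 0 else b k (l - 1))" if "Suc k < n" "l < n" for k l
  proof -
    have "(if l = 0 then 0 else b k (l - 1)) = (if Suc k < n then b (Suc k) l else 0)"
      by (rule Delta_commute[OF a1 a2]) (use that in auto)
    then show ?thesis using that by simp
  qed
  define \<tau> where "\<tau> = b 0"
  have toeplitz: "b k l = (if k \<le> l then \<tau> (l - k) else 0)" if "k < n" "l < n" for k l
    using that
  proof (induction k arbitrary: l)
    case (Suc k)
    then show ?case using comm[of k l] by (cases l) auto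
  qed (simp add: \<tau>_def)
  have b_x: "b k (n - 1 - l) = cnj \<mu> * x k l" if "l < n" for k l
    using that by (simp add: b_def y'_def)
  have a_\<tau>: "a 0 l = cnj (\<tau> l)" if "l < n" for l
  proof -
    have "cnj \<mu> * x (n - 1 - l) 0 = \<tau> l"
      using b_x[of 0 "n - 1 - l"] toeplitz[of "n - 1 - l" "n - 1"] that by simp
    from arg_cong[OF this, of cnj] show ?thesis by (simp add: a_def z'_def)
  qed
  have Re_\<tau>: "Re (\<tau> l) = (if l = 0 then 0 else - Im (\<tau> (l - 1)))" if "l < n" for l
  proof (cases l)
    case 0
    then show ?thesis using arg_cong[OF a1[of 0 0], of Re] a_\<tau>[of 0] that by (simp add: \<tau>_def)
  next
    case (Suc l')
    then have "cnj (\<tau> l) + \<i> * cnj (\<tau> l') + (\<tau> l - \<i> * \<tau> l') = 0"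
      using a1[of 0 l] a_\<tau>[of l] a_\<tau>[of l'] that by (simp add: \<tau>_def)
    from arg_cong[OF this, of Re] show ?thesis using Suc by simp
  qed
  \<comment> \<open>After the reversal of columns the entry \<open>(k, k)\<close> lies on the
    diagonal with index \<open>n - 1 - 2 * k\<close>.\<close>
  have star: "\<tau> (n - 1 - 2 * k) = 0" if "2 * k + 2 \<le> n" for k
  proof -
    have "D $$ (k, k) = Star" using that s by (auto simp: z_diag_def)
    then have "x k k = 0" using ok[rule_format, of k k] that by auto
    then have "b k (n - 1 - k) = 0" using b_x[of k k] that by simp
    then show ?thesis using toeplitz[of k "n - 1 - k"] that by (simp add: mult_2 split: if_splits)
  qed
  have same: "\<tau> d = 0" if "d < n" "even (n - 1 - d)" "0 < d" for d
  proof -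
    from that(2) obtain k where "n - 1 - d = 2 * k" by (elim evenE)
    then have "d = n - 1 - 2 * k" "2 * k + 2 \<le> n" using that by auto
    then show ?thesis using star by simp
  qed
  have zero: "\<tau> 0 = 0" if "odd n"
  proof -
    have n: "Suc (2 * (n div 2)) = n" "n div 2 < n" using that by presburger+
    have Re0: "Re (\<tau> 0) = 0" using Re_\<tau>[of 0] n by auto
    have "D $$ (n div 2, n div 2) = s" using that s n by (auto simp: z_diag_def)
    then have dok: "dual_ok s (x (n div 2) (n div 2))"
      using ok[rule_format, of "n div 2" "n div 2"] n by simp
    have "n - 1 - n div 2 = n div 2" using n by linarith
    then have "\<tau> 0 = cnj \<mu> * x (n div 2) (n div 2)"
      using b_x[of "n div 2" "n div 2"] toeplitz[of "n div 2" "n div 2"] n by simp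
    then have "\<mu> * \<tau> 0 = (\<mu> * cnj \<mu>) * x (n div 2) (n div 2)" by simp
    then have x: "x (n div 2) (n div 2) = \<mu> * \<tau> 0" using unit_mult_cnj[OF \<mu>] by simp
    \<comment> \<open>The middle entry of \<open>x\<close> is \<open>\<mu>\<close> times an
      imaginary number, hence orthogonal to \<open>\<mu>\<close>. It is also orthogonal to the line
      of the middle symbol, which is a different line, so it vanishes.\<close>
    have "Im (\<tau> 0) = 0" using s(2) dok unfolding x by (auto simp: Re0)
    with Re0 show ?thesis by (simp add: complex_eq_iff)
  qed
  have other: "\<tau> d = 0" if "d < n" "odd (n - 1 - d)" for d
  proof -
    have d1: "Suc d < n"
    proof (rule ccontr)
      assume "\<not> Suc d < n"
      then have "n - 1 - d = 0" by simp
      with that(2) show False by simp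
    qed
    then have "n - 1 - d = Suc (n - 1 - Suc d)" by simp
    with that(2) d1 have d: "Suc d < n" "even (n - 1 - Suc d)" by simp_all
    have "Im (\<tau> d) = 0" using Re_\<tau>[of "Suc d"] same[of "Suc d"] d by simp
    moreover have "Re (\<tau> d) = 0"
    proof (cases d)
      case (Suc d')
      have "\<tau> d' = 0"
      proof (cases d')
        case 0
        then have "odd n" using that Suc by (auto simp: even_diff_nat)
        then show ?thesis using zero 0 by simp
      next
        case (Suc d'')
        then show ?thesis using same[of d'] that \<open>d = Suc d'\<close> by (auto simp: even_diff_nat)
      qed
      then show ?thesis using Re_\<tau>[of d] Suc that by simp
    qed (use Re_\<tau>[of d] that in simp)
    ultimately show ?thesis by (simp add: complex_eq_iff)
  qed
  have "\<tau> d = 0" if "d < n" for d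
  proof (cases "even (n - 1 - d) \<and> 0 < d")
    case False
    then show ?thesis using other[of d] zero that by (cases "d = 0") (auto simp: even_diff_nat)
  qed (use same that in auto)
  then have "b k (n - 1 - l) = 0" using toeplitz[of k "n - 1 - l"] kl by simp
  then show "x k l = 0" using b_x[OF kl(2), of k] \<mu> by auto
qed

text \<open>The tangent vector is diagonal with entries \<open>u = \<mu> * \<alpha>\<close>.
  Eliminating \<open>r\<close> leaves differences of neighbouring entries of \<open>p\<close> along
  a diagonal, which telescope to zero. The right-hand side of the telescoped identity contains at
  most one term, \<open>Im (\<alpha> i)\<close> or \<open>Re (\<alpha> i)\<close> according to the
  parity of the offset, so both parts vanish in the starred half.\<close>

lemma diag_transversal_Delta:
  assumes D: "D \<in> D_diag (DeltaBlock n \<mu>)" and \<mu>: "cmod \<mu> = 1"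
  shows "diag_transversal (DeltaBlock n \<mu>) D"
  unfolding diag_transversal_def
proof (intro allI impI)
  fix C k l
  let ?P = "\<lambda>(k::nat) (j::nat). cnj (C j k)"
  let ?U = "congr1 (DeltaBlock n \<mu>) (DeltaBlock n \<mu>) ?P C" and ?V = "congr2 (DeltaBlock n \<mu>) (DeltaBlock n \<mu>) ?P C"
  assume ok: "\<forall>k<summand_size (DeltaBlock n \<mu>). \<forall>l<summand_size (DeltaBlock n \<mu>). sym_ok (D $$ (k, l)) (?U k l)"
    and "k < summand_size (DeltaBlock n \<mu>)" "l < summand_size (DeltaBlock n \<mu>)"
  then have kl: "k < n" "l < n" by auto
  obtain s where s: "D = z_diag s n" "s = Circ \<and> Im \<mu> \<noteq> 0 \<or> s = Bullet \<and> Re \<mu> \<noteq> 0"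
    using D_diag_Delta[OF D \<mu>] .
  define u where "u = (\<lambda>k. ?U k k)"
  define \<alpha> where "\<alpha> = (\<lambda>k. cnj \<mu> * u k)"
  have off: "?U k l = 0" if "k < n" "l < n" "k \<noteq> l" for k l
    using ok[rule_format, of k l] that s by (simp add: z_diag_def)
  define p where "p = (\<lambda>k l. \<mu> * ?P (n - 1 - k) (n - 1 - l))"
  define r where "r = (\<lambda>k l. 1 * \<mu> * C k l)"
  define c where "c = (\<lambda>k l. (if l = 0 then 0 else p k (l - 1)) + (if Suc k < n then r (Suc k) l else 0))"
  note flip = Delta_congr_flip[where P = ?P and R = C and n = n and m = n and \<epsilon> = 1,
      OF _ _ p_def r_def \<mu> disjI1[OF refl], unfolded mult_1_left]
  text \<open>The transformed tangent vector splits into its part \<open>p + r\<close> along \<open>Re \<alpha>\<close> and its part \<open>c\<close> along \<open>Im \<alpha>\<close>.\<close>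
  have half: "p k l + r k l = (if k + l = n - 1 then \<mu> * of_real (Re (\<alpha> l)) else 0)"
    "c k l = (if k + l = n - 1 then \<mu> * of_real (Im (\<alpha> l)) else 0)" if kl: "k < n" "l < n" for k l
  proof -
    have e: "n - 1 - k < n" "n - 1 - k = l \<longleftrightarrow> k + l = n - 1" using kl by auto
    have U: "?U (n - 1 - k) l = (if k + l = n - 1 then u l else 0)"
      using off[OF e(1) kl(2)] e(2) by (auto simp: u_def)
    have V: "?V (n - 1 - k) l = (if k + l = n - 1 then cnj (u l) else 0)"
      using off[OF kl(2) e(1)] e(2) by (auto simp: u_def congr2_self)
    have u: "u l = \<mu> * \<alpha> l" "\<mu> * \<mu> * cnj (u l) = \<mu> * cnj (\<alpha> l)"
      using unit_mult_cnj[OF \<mu>] by (simp_all add: \<alpha>_def mult.assoc[symmetric])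
    have 1: "p k l + r k l + \<i> * c k l = (if k + l = n - 1 then \<mu> * \<alpha> l else 0)"
      using flip(1)[OF kl] U u(1) unfolding c_def by simp
    have 2: "p k l + r k l - \<i> * c k l = (if k + l = n - 1 then \<mu> * cnj (\<alpha> l) else 0)"
    proof -
      have "p k l + r k l - \<i> * c k l = \<mu> * \<mu> * (if k + l = n - 1 then cnj (u l) else 0)"
        unfolding V[symmetric] c_def by (rule flip(2)[OF kl, symmetric])
      then show ?thesis
        by (cases "k + l = n - 1") (simp_all only: u(2) if_True if_False mult_zero_right simp_thms)
    qed
    have "p k l + r k l = ((p k l + r k l + \<i> * c k l) + (p k l + r k l - \<i> * c k l)) / 2"
      by simp
    also have "\<dots> = (if k + l = n - 1 then \<mu> * ((\<alpha> l + cnj (\<alpha> l)) / 2) else 0)"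
      unfolding 1 2 by (simp add: algebra_simps)
    finally show "p k l + r k l = (if k + l = n - 1 then \<mu> * of_real (Re (\<alpha> l)) else 0)"
      by (simp add: complex_add_cnj)
    have "c k l = ((p k l + r k l + \<i> * c k l) - (p k l + r k l - \<i> * c k l)) / (2 * \<i>)"
      by simp
    also have "\<dots> = (if k + l = n - 1 then \<mu> * ((\<alpha> l - cnj (\<alpha> l)) / (2 * \<i>)) else 0)"
      unfolding 1 2 by (simp add: algebra_simps)
    also have "(\<alpha> l - cnj (\<alpha> l)) / (2 * \<i>) = of_real (Im (\<alpha> l))"
    proof -
      have *: "\<alpha> l - cnj (\<alpha> l) = of_real (Im (\<alpha> l)) * (2 * \<i>)" by (simp add: complex_eq_iff)
      show ?thesis unfolding * by (rule nonzero_mult_div_cancel_right) simp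
    qed
    finally show "c k l = (if k + l = n - 1 then \<mu> * of_real (Im (\<alpha> l)) else 0)" .
  qed
  \<comment> \<open>The entry \<open>r (Suc k) l\<close> occurs in \<open>c k l\<close> and in the
    sum \<open>p + r\<close> of the next row; taking the difference cancels it.\<close>
  have diff: "(if l = 0 then 0 else p k (l - 1)) - (if Suc k < n then p (Suc k) l else 0) =
      (if k + l = n - 1 then \<mu> * of_real (Im (\<alpha> l)) else 0) - (if Suc k + l = n - 1 then \<mu> * of_real (Re (\<alpha> l)) else 0)"
    if "k < n" "l < n" for k l
  proof (cases "Suc k < n")
    case True
    have "(if l = 0 then 0 else p k (l - 1)) - p (Suc k) l = c k l - (p (Suc k) l + r (Suc k) l)"
      unfolding c_def using True by simp
    also have "\<dots> = (if k + l = n - 1 then \<mu> * of_real (Im (\<alpha> l)) else 0) - (if Suc k + l = n - 1 then \<mu> * of_real (Re (\<alpha> l)) else 0)"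
      unfolding half(2)[OF that] half(1)[OF True that(2)] ..
    finally show ?thesis using True by simp
  next
    case False
    then have "\<not> Suc k + l = n - 1" using that by simp
    then show ?thesis using half(2)[OF that] False unfolding c_def by simp
  qed
  have sum0: "(\<Sum>j<n - d. (if d + j + j = n - 1 then \<mu> * of_real (Im (\<alpha> j)) else 0) -
      (if Suc (d + j) + j = n - 1 then \<mu> * of_real (Re (\<alpha> j)) else 0)) = 0" (is "?S = 0") if "d < n" for d
  proof -
    \<comment> \<open>The entries of \<open>p\<close> along a diagonal, extended by zero at both
      ends so that the telescoping sum has no boundary terms.\<close>
    define g where "g = (\<lambda>j. if j = 0 \<or> n \<le> d + j then 0 else p (d + j) (j - 1))"
    have "?S = (\<Sum>j<n - d. g j - g (Suc j))"
    proof (rule sum.cong[OF refl])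
      fix j assume "j \<in> {..<n - d}"
      then have j: "d + j < n" "j < n" by auto
      have g: "g j = (if j = 0 then 0 else p (d + j) (j - 1))" "g (Suc j) = (if Suc (d + j) < n then p (Suc (d + j)) j else 0)"
        using j by (auto simp: g_def)
      show "(if d + j + j = n - 1 then \<mu> * of_real (Im (\<alpha> j)) else 0) -
          (if Suc (d + j) + j = n - 1 then \<mu> * of_real (Re (\<alpha> j)) else 0) = g j - g (Suc j)"
        unfolding g by (rule diff[OF j, symmetric])
    qed
    also have "\<dots> = g 0 - g (n - d)" by (rule sum_lessThan_telescope')
    finally show ?thesis using that by (simp add: g_def)
  qed
  have Im0: "Im (\<alpha> i) = 0" if "2 * i < n" for i
  proof -
    \<comment> \<open>The offset for which position \<open>i\<close> is the one where the shifted
      diagonal meets the antidiagonal. By parity the terms with \<open>Re\<close> are absent; in the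
      next step the offset is one less and the terms with \<open>Im\<close> are absent.\<close>
    define d where "d = n - 1 - 2 * i"
    have d: "d + 2 * i = n - 1" "d < n" "i < n - d" using that unfolding d_def by auto
    have e: "(d + j + j = n - 1) = (j = i)" "(Suc (d + j) + j = n - 1) = False" for j
      using d(1) by presburger+
    have "(\<Sum>j<n - d. if j = i then \<mu> * of_real (Im (\<alpha> j)) else 0) = 0"
      using sum0[OF d(2)] unfolding e if_False diff_zero by simp
    then show ?thesis using d(3) \<mu> by auto
  qed
  have Re0: "Re (\<alpha> i) = 0" if "2 * i + 2 \<le> n" for i
  proof -
    define d where "d = n - 2 - 2 * i"
    have d: "d + 2 * i + 1 = n - 1" "d < n" "i < n - d" using that unfolding d_def by auto
    have e: "(Suc (d + j) + j = n - 1) = (j = i)" "(d + j + j = n - 1) = False" for j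
      using d(1) by presburger+
    have "(\<Sum>j<n - d. if j = i then - (\<mu> * of_real (Re (\<alpha> j))) else 0) = 0"
      using sum0[OF d(2)] unfolding e if_False by (simp add: if_distrib cong: if_cong)
    then show ?thesis using d(3) \<mu> by auto
  qed
  have "u i = 0" if "i < n" for i
  proof -
    have u: "u i = \<mu> * \<alpha> i"
      using unit_mult_cnj[OF \<mu>] by (simp add: \<alpha>_def mult.assoc[symmetric])
    consider "2 * i + 2 \<le> n" | "n = 2 * i + 1" | "n \<le> 2 * i" by linarith
    then show ?thesis
    proof cases
      case 1
      then show ?thesis unfolding u using Im0[of i] Re0[of i] by (simp add: complex_eq_iff)
    next
      case 2
      then have "D $$ (i, i) = s" using s by (simp add: z_diag_def)
      then have "sym_ok s (u i)" using ok[rule_format, of i i] that by (simp add: u_def)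
      \<comment> \<open>In the middle position the telescoping controls only \<open>Im\<close>; what
        remains is a real multiple of \<open>\<mu>\<close>, which the middle symbol excludes unless
        it is zero.\<close>
      moreover have "\<alpha> i = of_real (Re (\<alpha> i))" using Im0[of i] 2 by (simp add: complex_eq_iff)
      then have "u i = \<mu> * of_real (Re (\<alpha> i))" using u by simp
      ultimately show ?thesis using s(2) by auto
    next
      case 3
      then have "D $$ (i, i) = Zero" using s that by (auto simp: z_diag_def)
      then show ?thesis using ok[rule_format, of i i] that by (simp add: u_def)
    qed
  qed
  then show "?U k l = 0" using off kl by (cases "k = l") (auto simp: u_def)
qed
subsection \<open>Pairs of nilpotent blocks\<close>

text \<open>The equations \<open>z N + y N\<^sup>* = 0\<close> and \<open>N z + N\<^sup>* y = 0\<close> tie the entries of \<open>y\<close> and \<open>z\<close> together along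
  paths \<open>y\<^sub>k\<^sub>l, z\<^sub>k\<^sub>+\<^sub>2\<^sub>,\<^sub>l, y\<^sub>k\<^sub>+\<^sub>2\<^sub>,\<^sub>l\<^sub>+\<^sub>2, \<dots>\<close>. The stars sit on exactly those paths none of whose ends forces
  the entries to vanish.\<close>

lemma nat_cases2:
  obtains "l = 0" | "l = Suc 0" | l' where "l = Suc (Suc l')"
proof (cases l)
  case (Suc k)
  then show ?thesis using that by (cases k) auto
qed (use that in auto)

locale J_dual =
  fixes n m :: nat and y z :: "nat \<Rightarrow> nat \<Rightarrow> complex"
  assumes E1: "\<And>k l. k < n \<Longrightarrow> l < m \<Longrightarrow>
      (if l = 0 then 0 else z k (l - 1)) + (if Suc l < m then y k (Suc l) else 0) = 0"
    and E2: "\<And>k l. k < n \<Longrightarrow> l < m \<Longrightarrow>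
      (if Suc k < n then z (Suc k) l else 0) + (if k = 0 then 0 else y (k - 1) l) = 0"
begin

lemma y_right: "k < n \<Longrightarrow> Suc (Suc l) < m \<Longrightarrow> y k (Suc (Suc l)) = - z k l"
  using E1[of k "Suc l"] by (simp add: add_eq_0_iff)

lemma z_down: "Suc (Suc k) < n \<Longrightarrow> l < m \<Longrightarrow> z (Suc (Suc k)) l = - y k l"
  using E2[of "Suc k" l] by (simp add: add_eq_0_iff2)

lemma y_diag: "Suc (Suc k) < n \<Longrightarrow> Suc (Suc l) < m \<Longrightarrow> y (Suc (Suc k)) (Suc (Suc l)) = y k l"
  using y_right[of "Suc (Suc k)" l] z_down[of k l] by simp

lemma z_diag: "Suc (Suc k) < n \<Longrightarrow> Suc (Suc l) < m \<Longrightarrow> z (Suc (Suc k)) (Suc (Suc l)) = z k l"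
  using y_right[of k l] z_down[of k "Suc (Suc l)"] by simp

lemma ends:
  "Suc 0 < n \<Longrightarrow> l < m \<Longrightarrow> z (Suc 0) l = 0"
  "k < n \<Longrightarrow> Suc 0 < m \<Longrightarrow> y k (Suc 0) = 0"
  "Suc (Suc k) = n \<Longrightarrow> l < m \<Longrightarrow> y k l = 0"
  "k < n \<Longrightarrow> Suc (Suc l) = m \<Longrightarrow> z k l = 0"
  using E2[of 0 l] E1[of k 0] E2[of "Suc k" l] E1[of k "Suc l"] by auto

text \<open>The path either continues two steps down the diagonal or leaves the matrix. Leaving
  through the bottom makes \<open>y k l\<close> itself zero; leaving on the right makes
  \<open>z (k + 2) l\<close> zero, which equals \<open>- y k l\<close>.\<close>

lemma y_down_step:
  assumes "Suc k < n" "Suc l < m" "Suc (Suc k) < n \<Longrightarrow> Suc (Suc l) < m \<Longrightarrow> y (Suc (Suc k)) (Suc (Suc l)) = 0"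
  shows "y k l = 0"
proof (cases "Suc (Suc k) < n")
  case True
  then show ?thesis
    using assms y_diag[of k l] z_down[of k l] ends(4)[of "Suc (Suc k)" l]
    by (cases "Suc (Suc l) < m") (auto simp: not_less_eq less_Suc_eq)
next
  case False
  then show ?thesis using ends(3)[of k l] assms by simp
qed

lemma z_from_y:
  assumes "\<And>l. l < m \<Longrightarrow> y k l = 0" "k < n" "l < m" "z k (m - 1) = 0"
  shows "z k l = 0"
proof -
  consider "Suc (Suc l) < m" | "Suc (Suc l) = m" | "l = m - 1" using assms(3) by linarith
  then show ?thesis
    using y_right[of k l] ends(4)[of k l] assms by cases auto
qed

text \<open>\<open>F\<close> and \<open>G\<close> are the conditions of the alternating stars in the
  two blocks, and \<open>Q\<close> is that of the additional stars \<open>P_stars\<close>. Each path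
  is followed to an end at which it is forced, upwards or downwards according to the parities of
  \<open>n\<close> and of the row. For odd \<open>n\<close> the even rows far right of the diagonal
  contain paths that reach the last row with neither end forced; \<open>Q\<close> closes exactly
  these.\<close>

lemma all_zero:
  assumes nm: "n \<le> m"
    and F: "\<And>k. k < n \<Longrightarrow> even (n - 1 - k) \<Longrightarrow> y k 0 = 0"
    and G: "\<And>k. k < n \<Longrightarrow> even k \<Longrightarrow> z k (m - 1) = 0"
    and Q: "\<And>l. odd n \<Longrightarrow> n < l \<Longrightarrow> l < m \<Longrightarrow> y (n - 1) l = 0"
    and kl: "k < n" "l < m"
  shows "y k l = 0 \<and> z k l = 0"
proof (cases "even n")
  case True
  note n = True
  have y_even: "y k l = 0" if "k < n" "l < m" "even k" for k l
    using that
  proof (induction "n - k" arbitrary: k l rule: less_induct)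
    case less
    have k: "Suc k < n" using less.prems n by presburger
    show ?case
    proof (cases "Suc l < m")
      case True
      then show ?thesis by (rule y_down_step[OF k]) (rule less.hyps, use less.prems in auto)
    next
      case False
      then have "l = m - 1" using less.prems by simp
      then show ?thesis using z_down[of k l] ends(3)[of k l] G[of "Suc (Suc k)"] less.prems k
        by (cases "Suc (Suc k) < n") auto
    qed
  qed
  have z_even: "z k l = 0" if "k < n" "l < m" "even k" for k l
    by (rule z_from_y) (use y_even G that in auto)
  have y_odd: "y k l = 0" if "k < n" "l < m" "odd k" for k l
    using that
  proof (induction k arbitrary: l rule: less_induct)
    case (less k)
    consider "l = 0" | "l = Suc 0" | l' where "l = Suc (Suc l')" by (cases l rule: nat_cases2)
    then show ?case
    proof cases
      case 1
      then show ?thesis using F[of k] less.prems n by auto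
    next
      case 2
      then show ?thesis using ends(2) less.prems by auto
    next
      case 3
      show ?thesis
      proof (cases "k = 1")
        case True
        then show ?thesis using 3 y_right[of k l'] ends(1)[of l'] less.prems by auto
      next
        case False
        then have "k = Suc (Suc (k - 2))" using less.prems(3) by presburger
        then obtain k' where "k = Suc (Suc k')" by blast
        then show ?thesis using 3 y_diag[of k' l'] less.IH[of k' l'] less.prems by auto
      qed
    qed
  qed
  have z_odd: "z k l = 0" if "k < n" "l < m" "odd k" for k l
  proof (cases "k = 1")
    case False
    then have "k = Suc (Suc (k - 2))" using that(3) by presburger
    then obtain k' where "k = Suc (Suc k')" by blast
    then show ?thesis using z_down[of k' l] y_odd[of k' l] that by auto
  qed (use ends that in auto)
  show ?thesis using y_even y_odd z_even z_odd kl by blast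
next
  case False
  note n = False
  have y_odd_low: "y k l = 0" if "k < n" "l \<le> k" "odd k" for k l
    using that
  proof (induction "n - k" arbitrary: k l rule: less_induct)
    case less
    have k: "Suc k < n" using less.prems n by presburger
    then have "Suc l < m" using less.prems nm by simp
    then show ?case by (rule y_down_step[OF k]) (rule less.hyps, use less.prems in auto)
  qed
  have y_odd_high: "y k l = 0" if "k < l" "k < n" "l < m" "odd k" for k l
    using that
  proof (induction k arbitrary: l rule: less_induct)
    case (less k)
    then have "l = Suc (Suc (l - 2))" by presburger
    then obtain l' where l: "l = Suc (Suc l')" by blast
    show ?case
    proof (cases "k = 1")
      case True
      then show ?thesis using l y_right[of k l'] ends(1)[of l'] less.prems by auto
    next
      case False
      then have "k = Suc (Suc (k - 2))" using less.prems(4) by presburger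
      then obtain k' where "k = Suc (Suc k')" by blast
      then show ?thesis using l y_diag[of k' l'] less.IH[of k' l'] less.prems by auto
    qed
  qed
  have y_odd: "y k l = 0" if "k < n" "l < m" "odd k" for k l
    using y_odd_low y_odd_high that by (metis not_le)
  have z_odd: "z k l = 0" if "k < n" "l < m" "odd k" for k l
  proof (cases "k = 1")
    case False
    then have "k = Suc (Suc (k - 2))" using that(3) by presburger
    then obtain k' where "k = Suc (Suc k')" by blast
    then show ?thesis using z_down[of k' l] y_odd[of k' l] that by auto
  qed (use ends that in auto)
  have y_even_low: "y k l = 0" if "l \<le> Suc k" "k < n" "l < m" "even k" for k l
    using that
  proof (induction k arbitrary: l rule: less_induct)
    case (less k)
    consider "l = 0" | "l = Suc 0" | l' where "l = Suc (Suc l')" by (cases l rule: nat_cases2)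
    then show ?case
    proof cases
      case 1
      then show ?thesis using F[of k] less.prems n by auto
    next
      case 2
      then show ?thesis using ends(2) less.prems by auto
    next
      case 3
      then have "k = Suc (Suc (k - 2))" using less.prems by presburger
      then obtain k' where "k = Suc (Suc k')" by blast
      then show ?thesis using 3 y_diag[of k' l'] less.IH[of k' l'] less.prems by auto
    qed
  qed
  have y_even_high: "y k l = 0" if "Suc k < l" "k < n" "l < m" "even k" for k l
    using that
  proof (induction "n - k" arbitrary: k l rule: less_induct)
    case less
    show ?case
    proof (cases "Suc k < n")
      case False
      then have "k = n - 1" using less.prems by simp
      then show ?thesis using Q[of l] less.prems n False by auto
    next
      case k: True
      then have k2: "Suc (Suc k) < n" using less.prems n by presburger
      show ?thesis
      proof (cases "Suc l < m")
        case True
        then show ?thesis by (rule y_down_step[OF k]) (rule less.hyps, use less.prems in auto)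
      next
        case False
        then have "l = m - 1" using less.prems by simp
        then show ?thesis using z_down[of k l] G[of "Suc (Suc k)"] less.prems k2 by auto
      qed
    qed
  qed
  have y_even: "y k l = 0" if "k < n" "l < m" "even k" for k l
    using y_even_low y_even_high that by (metis not_le)
  have z_even: "z k l = 0" if "k < n" "l < m" "even k" for k l
    by (rule z_from_y) (use y_even G that in auto)
  show ?thesis using y_even y_odd z_even z_odd kl by blast
qed

text \<open>In a square block the stars may sit in the last row. Moving along the diagonal converts
  their condition into the one on the first column that \<open>all_zero\<close> expects.\<close>

lemma y_square:
  assumes "n = m"
  shows "k < n \<Longrightarrow> l < m \<Longrightarrow> l \<le> k \<Longrightarrow> even l \<Longrightarrow> y k l = y (k - l) 0"
proof (induction l arbitrary: k rule: less_induct)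
  case (less l)
  show ?case
  proof (cases "l = 0")
    case False
    then have "l = Suc (Suc (l - 2))" "k = Suc (Suc (k - 2))" using less.prems by presburger+
    then obtain l' k' where "l = Suc (Suc l')" "k = Suc (Suc k')" by blast
    then show ?thesis using y_diag[of k' l'] less.IH[of l' k'] less.prems by auto
  qed simp
qed

lemma z_square:
  assumes "n = m"
  shows "k < n \<Longrightarrow> l < m \<Longrightarrow> k \<le> l \<Longrightarrow> even k \<Longrightarrow> z k l = z 0 (l - k)"
proof (induction k arbitrary: l rule: less_induct)
  case (less k)
  show ?case
  proof (cases "k = 0")
    case False
    then have "l = Suc (Suc (l - 2))" "k = Suc (Suc (k - 2))" using less.prems by presburger+
    then obtain l' k' where "l = Suc (Suc l')" "k = Suc (Suc k')" by blast
    then show ?thesis using z_diag[of k' l'] less.IH[of k' l'] less.prems by auto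
  qed simp
qed

end
text \<open>The residuals \<open>P N + N R\<close> and \<open>P N\<^sup>* + N\<^sup>* R\<close> of
  two nilpotent blocks. Each lemma treats one admissible place of the stars: the residual there is a
  single entry of \<open>P\<close> or \<open>R\<close>, or zero, and the vanishing residuals
  elsewhere lead from this entry to the border.\<close>

locale J_primal =
  fixes n m :: nat and P R U V :: "nat \<Rightarrow> nat \<Rightarrow> complex"
  assumes U: "\<And>k l. k < n \<Longrightarrow> l < m \<Longrightarrow>
      U k l = (if l = 0 then 0 else P k (l - 1)) + (if Suc k < n then R (Suc k) l else 0)"
    and V: "\<And>k l. k < n \<Longrightarrow> l < m \<Longrightarrow>
      V k l = (if Suc l < m then P k (Suc l) else 0) + (if k = 0 then 0 else R (k - 1) l)"
begin

text \<open>The residual is \<open>R (Suc k) 0\<close>, and this entry moves two steps down the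
  diagonal at a time. The parity in \<open>z_alt\<close> is the one for which the path runs out of
  the matrix at row \<open>n\<close>, where the second term of \<open>U\<close> is absent.\<close>

lemma U_first_column:
  assumes nm: "n \<le> m"
    and V0: "\<And>k l. k < n \<Longrightarrow> 0 < k \<Longrightarrow> Suc l < m \<Longrightarrow> V k l = 0"
    and U0: "\<And>k l. k < n \<Longrightarrow> l < m \<Longrightarrow> 0 < l \<Longrightarrow> l \<le> k \<Longrightarrow> U k l = 0"
    and k: "k < n" "even (n - 1 - k)"
  shows "U k 0 = 0"
proof -
  have R: "R k l = 0" if "l < k" "k < n" "even (n - k)" for k l
    using that
  proof (induction "n - k" arbitrary: k l rule: less_induct)
    case less
    have k: "Suc k < n" using less.prems by presburger
    have 1: "P (Suc k) (Suc l) + R k l = 0"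
      using V0[of "Suc k" l] V[of "Suc k" l] k less.prems nm by auto
    have 2: "P (Suc k) (Suc l) + (if Suc (Suc k) < n then R (Suc (Suc k)) (Suc (Suc l)) else 0) = 0"
      using U0[of "Suc k" "Suc (Suc l)"] U[of "Suc k" "Suc (Suc l)"] k less.prems nm by auto
    show ?case
    proof (cases "Suc (Suc k) < n")
      case True
      then have "R (Suc (Suc k)) (Suc (Suc l)) = 0" by (intro less.hyps) (use less.prems in auto)
      then show ?thesis using 1 2 True by simp
    qed (use 1 2 in simp)
  qed
  show ?thesis
  proof (cases "Suc k < n")
    case True
    then have "even (n - Suc k)" using k(2) by simp
    then show ?thesis using U[of k 0] R[of 0 "Suc k"] True k nm by auto
  qed (use U[of k 0] k nm in auto)
qed

text \<open>The residual is \<open>P (n - 1) (l - 1)\<close>, and the path runs up and to the left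
  until \<open>U\<close> loses its first term in column 0.\<close>

lemma U_last_row:
  assumes nm: "n = m"
    and V0: "\<And>k l. k < n \<Longrightarrow> 0 < k \<Longrightarrow> Suc l < m \<Longrightarrow> V k l = 0"
    and U0: "\<And>k l. Suc k < n \<Longrightarrow> l < m \<Longrightarrow> U k l = 0"
    and l: "l < m" "even l"
  shows "U (n - 1) l = 0"
proof -
  have P: "P k (Suc l) = 0" if "Suc l < k" "k < n" "even l" for k l
    using that
  proof (induction l arbitrary: k rule: less_induct)
    case (less l)
    then have "k = Suc (Suc (k - 2))" by presburger
    then obtain k' where k': "k = Suc (Suc k')" by blast
    have 1: "P k (Suc l) + R (Suc k') l = 0"
      using V0[of k l] V[of k l] k' less.prems nm by auto
    have 2: "(if l = 0 then 0 else P k' (l - 1)) + R (Suc k') l = 0"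
      using U0[of k' l] U[of k' l] k' less.prems nm by auto
    show ?case
    proof (cases "l = 0")
      case False
      then have "l = Suc (Suc (l - 2))" using less.prems by presburger
      then obtain l' where l': "l = Suc (Suc l')" by blast
      then have "P k' (Suc l') = 0" by (intro less.IH) (use less.prems k' in auto)
      then show ?thesis using 1 2 l' by simp
    qed (use 1 2 in simp)
  qed
  show ?thesis
  proof (cases "l = 0")
    case False
    then have "l = Suc (Suc (l - 2))" using l by presburger
    then obtain l' where l': "l = Suc (Suc l')" by blast
    then show ?thesis using U[of "n - 1" l] P[of l' "n - 1"] l nm by auto
  qed (use U[of "n - 1" l] l nm in auto)
qed

text \<open>The case of \<open>P_stars\<close>. For \<open>n < l\<close> the path from
  \<open>P (n - 1) (l - 1)\<close> stays right of the diagonal, and since \<open>n - 1\<close> is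
  even it hits row 0, where \<open>V\<close> consists of one term.\<close>

lemma U_last_row_right:
  assumes V0: "\<And>k l. k < n \<Longrightarrow> Suc l < m \<Longrightarrow> V k l = 0"
    and U0: "\<And>k l. Suc k < n \<Longrightarrow> l < m \<Longrightarrow> 0 < l \<Longrightarrow> U k l = 0"
    and l: "l < m" "n < l" and n: "odd n"
  shows "U (n - 1) l = 0"
proof -
  have P: "P k (Suc l) = 0" if "k \<le> l" "k < n" "Suc l < m" "even k" for k l
    using that
  proof (induction k arbitrary: l rule: less_induct)
    case (less k)
    have 1: "P k (Suc l) + (if k = 0 then 0 else R (k - 1) l) = 0"
      using V0[of k l] V[of k l] less.prems by auto
    show ?case
    proof (cases "k = 0")
      case False
      then have "k = Suc (Suc (k - 2))" "l = Suc (Suc (l - 2))" using less.prems by presburger+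
      then obtain k' l' where k': "k = Suc (Suc k')" "l = Suc (Suc l')" by blast
      have 2: "P k' (Suc l') + R (Suc k') l = 0"
        using U0[of k' l] U[of k' l] k' less.prems by auto
      have "P k' (Suc l') = 0" by (intro less.IH) (use less.prems k' in auto)
      then show ?thesis using 1 2 k' by simp
    qed (use 1 in simp)
  qed
  from l have "l = Suc (l - 1)" by simp
  then obtain l' where l': "l = Suc l'" by blast
  have "n - 1 = 0 \<or> l' = Suc (l' - 1)" using l l' by auto
  then have "P (n - 1) l' = 0"
    using P[of "n - 1" "l' - 1"] l l' n odd_pos[OF n] by (cases l') auto
  then show ?thesis using U[of "n - 1" l] l l' n odd_pos[OF n] by auto
qed

text \<open>The residual is \<open>R (k - 1) (m - 1)\<close> with \<open>k - 1\<close> odd; the path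
  goes up to row 1 of \<open>R\<close>, and row 0 of \<open>U\<close> and \<open>V\<close> ends
  it.\<close>

lemma V_last_column:
  assumes nm: "n \<le> m"
    and V0: "\<And>k l. k < n \<Longrightarrow> Suc l < m \<Longrightarrow> V k l = 0"
    and U0: "\<And>k l. Suc k < n \<Longrightarrow> l < m \<Longrightarrow> 0 < l \<Longrightarrow> U k l = 0"
    and k: "k < n" "even k"
  shows "V k (m - 1) = 0"
proof -
  have R: "R (Suc k) l = 0" if "Suc k < l" "Suc k < n" "l < m" "even k" for k l
    using that
  proof (induction k arbitrary: l rule: less_induct)
    case (less k)
    then have "l = Suc (Suc (l - 2))" by presburger
    then obtain l' where l': "l = Suc (Suc l')" by blast
    have 1: "P k (Suc l') + R (Suc k) l = 0"
      using U0[of k l] U[of k l] l' less.prems by auto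
    have 2: "P k (Suc l') + (if k = 0 then 0 else R (k - 1) l') = 0"
      using V0[of k l'] V[of k l'] l' less.prems by auto
    show ?case
    proof (cases "k = 0")
      case False
      then have "k = Suc (Suc (k - 2))" using less.prems by presburger
      then obtain k' where k': "k = Suc (Suc k')" by blast
      then have "R (Suc k') l' = 0" by (intro less.IH) (use less.prems l' in auto)
      then show ?thesis using 1 2 k' by simp
    qed (use 1 2 in simp)
  qed
  show ?thesis
  proof (cases "k = 0")
    case False
    then have "k = Suc (Suc (k - 2))" using k by presburger
    then obtain k' where k': "k = Suc (Suc k')" by blast
    then show ?thesis using V[of k "m - 1"] R[of k' "m - 1"] k nm by auto
  qed (use V[of k "m - 1"] k nm in auto)
qed

lemma V_first_row:
  assumes nm: "n = m"
    and V0: "\<And>k l. k < n \<Longrightarrow> 0 < k \<Longrightarrow> l < m \<Longrightarrow> V k l = 0"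
    and U0: "\<And>k l. Suc k < n \<Longrightarrow> l < m \<Longrightarrow> 0 < l \<Longrightarrow> U k l = 0"
    and l: "l < m" "even (m - 1 - l)"
  shows "V 0 l = 0"
proof -
  have P: "P k l = 0" if "k < l" "l < m" "even (m - l)" for k l
    using that
  proof (induction "m - l" arbitrary: k l rule: less_induct)
    case less
    have l: "Suc l < m" using less.prems by presburger
    have 1: "P k l + R (Suc k) (Suc l) = 0"
      using U0[of k "Suc l"] U[of k "Suc l"] l less.prems nm by auto
    have 2: "(if Suc (Suc l) < m then P (Suc (Suc k)) (Suc (Suc l)) else 0) + R (Suc k) (Suc l) = 0"
      using V0[of "Suc (Suc k)" "Suc l"] V[of "Suc (Suc k)" "Suc l"] l less.prems nm by auto
    show ?case
    proof (cases "Suc (Suc l) < m")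
      case True
      then have "P (Suc (Suc k)) (Suc (Suc l)) = 0" by (intro less.hyps) (use less.prems in auto)
      then show ?thesis using 1 2 True by simp
    qed (use 1 2 in simp)
  qed
  show ?thesis
  proof (cases "Suc l < m")
    case True
    then have "even (m - Suc l)" using l(2) by simp
    then show ?thesis using V[of 0 l] P[of 0 "Suc l"] True l nm by auto
  qed (use V[of 0 l] l nm in auto)
qed

end

text \<open>A common form of the patterns for even and odd \<open>n\<close> that also covers a
  diagonal block, taken as a pair with itself. In 0-based columns the stars of
  \<open>P_stars\<close> are those with \<open>n < l\<close>.\<close>

definition J_pair_symbols :: "nat \<Rightarrow> nat \<Rightarrow> symb mat \<times> symb mat \<Rightarrow> bool" where
  "J_pair_symbols m n D \<longleftrightarrow> n \<le> m \<and> (\<exists>S\<in>z_alt n m. \<forall>k<n. \<forall>l<m. fst D $$ (k, l) =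
     (if S $$ (k, l) = Star \<or> odd n \<and> Suc k = n \<and> n < l then Star else Zero)) \<and> snd D \<in> z_alt m n"

lemma z_alt_cases:
  assumes "S \<in> z_alt n m"
  obtains "n \<le> m" "\<And>k l. k < n \<Longrightarrow> l < m \<Longrightarrow> S $$ (k, l) = (if l = 0 \<and> even (n - 1 - k) then Star else Zero)"
  | "m \<le> n" "\<And>k l. k < n \<Longrightarrow> l < m \<Longrightarrow> S $$ (k, l) = (if k = n - 1 \<and> even l then Star else Zero)"
proof -
  from assms consider "n \<le> m" "S = stars n m (\<lambda>k l. l = 1 \<and> even (n - k))" | "m \<le> n" "S = stars n m (\<lambda>k l. k = n \<and> odd l)"
    by (auto simp: z_alt_def)
  then show ?thesis
  proof cases
    case 1
    then show ?thesis by (intro that(1)) auto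
  next
    case 2
    then show ?thesis by (intro that(2)) auto
  qed
qed

lemma pair_spanning_J_J:
  assumes D: "J_pair_symbols m n D"
  shows "pair_spanning (JBlock m) (JBlock n) D"
  unfolding pair_spanning_def
proof (intro allI impI)
  fix y z k l
  assume E: "dual_eqs (JBlock m) (JBlock n) y z"
    and ok: "\<forall>k<summand_size (JBlock n). \<forall>l<summand_size (JBlock m).
      dual_ok (fst D $$ (k, l)) (y k l) \<and> dual_ok (snd D $$ (l, k)) (z k l)"
    and "k < summand_size (JBlock n)" "l < summand_size (JBlock m)"
  then have kl: "k < n" "l < m" by auto
  have nm: "n \<le> m" using D by (simp add: J_pair_symbols_def)
  obtain S where S: "S \<in> z_alt n m" "\<And>k l. k < n \<Longrightarrow> l < m \<Longrightarrow> fst D $$ (k, l) =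
     (if S $$ (k, l) = Star \<or> odd n \<and> Suc k = n \<and> n < l then Star else Zero)"
    using D unfolding J_pair_symbols_def by blast
  have S': "snd D \<in> z_alt m n" using D by (simp add: J_pair_symbols_def)
  interpret J_dual n m y z
  proof
    fix k l assume "k < n" "l < m"
    then have "row_mult (JBlock m) (z k) l + row_mult_adj (JBlock m) (y k) l = 0"
      "mult_col (JBlock n) (\<lambda>j. z j l) k + adj_mult_col (JBlock n) (\<lambda>j. y j l) k = 0"
      using E unfolding dual_eqs_def by auto
    then show "(if l = 0 then 0 else z k (l - 1)) + (if Suc l < m then y k (Suc l) else 0) = 0"
      "(if Suc k < n then z (Suc k) l else 0) + (if k = 0 then 0 else y (k - 1) l) = 0"
      using \<open>k < n\<close> \<open>l < m\<close> by (simp_all add: block_mult)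
  qed
  have ys: "y k l = 0" if "S $$ (k, l) = Star" "k < n" "l < m" for k l
    using ok[rule_format, of k l] S(2)[of k l] that by simp
  have zs: "z k l = 0" if "snd D $$ (l, k) = Star" "k < n" "l < m" for k l
    using ok[rule_format, of k l] that by simp
  have F: "y k 0 = 0" if "k < n" "even (n - 1 - k)" for k
    using S(1)
  proof (cases rule: z_alt_cases)
    case 1
    then show ?thesis using ys[of k 0] that nm by auto
  next
    case 2
    then have "y (n - 1) (n - 1 - k) = 0" using ys[of "n - 1" "n - 1 - k"] that nm by auto
    then show ?thesis using y_square[of "n - 1" "n - 1 - k"] 2 that nm by auto
  qed
  have G: "z k (m - 1) = 0" if "k < n" "even k" for k
    using S'
  proof (cases rule: z_alt_cases)
    case 1
    then have "z 0 (m - 1 - k) = 0" using zs[of "m - 1 - k" 0] that nm by auto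
    then show ?thesis using z_square[of k "m - 1"] 1 that nm by auto
  next
    case 2
    then show ?thesis using zs[of "m - 1" k] that nm by auto
  qed
  have Q: "y (n - 1) l = 0" if "odd n" "n < l" "l < m" for l
    using ok[rule_format, of "n - 1" l] S(2)[of "n - 1" l] that kl by auto
  show "y k l = 0 \<and> z k l = 0"
    by (rule all_zero[OF nm F G Q kl])
qed

lemma pair_transversal_J_J:
  assumes D: "J_pair_symbols m n D"
  shows "pair_transversal (JBlock m) (JBlock n) D"
  unfolding pair_transversal_def
proof (intro allI impI)
  fix P R k l
  let ?U = "congr1 (JBlock m) (JBlock n) P R" and ?V = "congr2 (JBlock m) (JBlock n) P R"
  assume ok: "\<forall>k<summand_size (JBlock n). \<forall>l<summand_size (JBlock m).
      sym_ok (fst D $$ (k, l)) (?U k l) \<and> sym_ok (snd D $$ (l, k)) (?V k l)"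
    and "k < summand_size (JBlock n)" "l < summand_size (JBlock m)"
  then have kl: "k < n" "l < m" by auto
  have nm: "n \<le> m" using D by (simp add: J_pair_symbols_def)
  obtain S where S: "S \<in> z_alt n m" "\<And>k l. k < n \<Longrightarrow> l < m \<Longrightarrow> fst D $$ (k, l) =
     (if S $$ (k, l) = Star \<or> odd n \<and> Suc k = n \<and> n < l then Star else Zero)"
    using D unfolding J_pair_symbols_def by blast
  have S': "snd D \<in> z_alt m n" using D by (simp add: J_pair_symbols_def)
  interpret J_primal n m P R ?U ?V
    by unfold_locales (simp_all add: congr1_def congr2_def block_mult)
  have us: "?U k l = 0" if "S $$ (k, l) \<noteq> Star" "\<not> (odd n \<and> Suc k = n \<and> n < l)" "k < n" "l < m" for k l
    using ok[rule_format, of k l] S(2)[of k l] that by auto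
  have vs: "?V k l = 0" if "snd D $$ (l, k) = Zero" "k < n" "l < m" for k l
    using ok[rule_format, of k l] that by auto
  have V0: "?V k l = 0" if "k < n" "0 < k" "Suc l < m" for k l
  proof -
    have l: "l \<noteq> m - 1" using that by simp
    have "snd D $$ (l, k) = Zero"
      using S' by (cases rule: z_alt_cases) (use that l in auto)
    then show ?thesis using vs that by auto
  qed
  have U0: "?U k l = 0" if "Suc k < n" "l < m" "0 < l" for k l
  proof -
    have "S $$ (k, l) = Zero"
      using S(1) by (cases rule: z_alt_cases) (use that in auto)
    then show ?thesis using us that by auto
  qed
  \<comment> \<open>\<open>V\<close> is cleared completely before the rest of \<open>U\<close>,
    because the path from a star of \<open>P_stars\<close> also uses row 0 of \<open>V\<close>,
    which may itself carry stars when \<open>n = m\<close>.\<close>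
  have V: "?V k l = 0" if "k < n" "l < m" for k l
    using S'
  proof (cases rule: z_alt_cases)
    case 1
    then have "n = m" using nm by simp
    then show ?thesis
      using V_first_row[OF \<open>n = m\<close> _ U0, of l] vs 1 that by (cases "k = 0 \<and> even (m - 1 - l)") auto
  next
    case 2
    have *: "?V k l = 0" if "k < n" "Suc l < m" for k l
    proof -
      have "l \<noteq> m - 1" using that by simp
      then show ?thesis using vs[of l k] 2(2)[of l k] that by simp
    qed
    show ?thesis
    proof (cases "l = m - 1 \<and> even k")
      case True
      then show ?thesis using V_last_column[OF nm * U0, of k] that by simp
    next
      case False
      then show ?thesis using vs[of l k] 2(2)[of l k] that by auto
    qed
  qed
  have right: "?U k l = 0" if "odd n" "Suc k = n" "n < l" "l < m" for k l
    using U_last_row_right[OF _ U0 that(4,3,1)] V that by auto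
  have off: "?U k l = 0" if "S $$ (k, l) \<noteq> Star" "k < n" "l < m" for k l
    using us[OF that(1) _ that(2,3)] right[OF _ _ _ that(3)] by blast
  have "?U k l = 0"
    using S(1)
  proof (cases rule: z_alt_cases)
    case 1
    have *: "?U k l = 0" if "k < n" "l < m" "0 < l" "l \<le> k" for k l
      using us[of k l] 1(2)[of k l] that by auto
    show ?thesis
    proof (cases "l = 0 \<and> even (n - 1 - k)")
      case True
      then show ?thesis using U_first_column[OF nm V0 *, of k] kl by simp
    next
      case False
      then show ?thesis using off[OF _ kl] 1(2)[OF kl] by auto
    qed
  next
    case 2
    then have "n = m" using nm by simp
    have *: "?U k l = 0" if "Suc k < n" "l < m" for k l
    proof -
      have "k \<noteq> n - 1" using that by simp
      then show ?thesis using us[of k l] 2(2)[of k l] that by simp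
    qed
    show ?thesis
    proof (cases "k = n - 1 \<and> even l")
      case True
      then show ?thesis using U_last_row[OF \<open>n = m\<close> V0 *, of l] kl by simp
    next
      case False
      then show ?thesis using off[OF _ kl] 2(2)[OF kl] by auto
    qed
  qed
  then show "?U k l = 0 \<and> ?V k l = 0" using V kl by simp
qed

lemma J_pair_symbols_D_off:
  assumes "D \<in> D_off (JBlock m) (JBlock n)"
  shows "J_pair_symbols m n D"
proof -
  have nm: "n \<le> m" using assms by (auto split: if_splits)
  show ?thesis
  proof (cases "even n")
    case True
    then have D: "fst D \<in> z_alt n m" "snd D \<in> z_alt m n" using assms nm by auto
    have "fst D $$ (k, l) = (if fst D $$ (k, l) = Star \<or> odd n \<and> Suc k = n \<and> n < l then Star else Zero)"
      if "k < n" "l < m" for k l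
      using D(1) by (cases rule: z_alt_cases) (use that True in auto)
    then show ?thesis using D nm unfolding J_pair_symbols_def by blast
  next
    case False
    then obtain S where S: "S \<in> z_alt n m" "fst D = join_stars S (P_stars n m)" "snd D \<in> z_alt m n"
      using assms nm by auto
    have "dim_row S = n" "dim_col S = m" using S(1) by (auto simp: z_alt_def)
    then have "fst D $$ (k, l) = (if S $$ (k, l) = Star \<or> odd n \<and> Suc k = n \<and> n < l then Star else Zero)"
      if "k < n" "l < m" for k l
      unfolding S(2) using that False by (auto simp: join_stars_def P_stars_def)
    then show ?thesis using S nm unfolding J_pair_symbols_def by blast
  qed
qed

text \<open>For a square block the additional stars are void since \<open>n < l\<close> is
  impossible, so a nilpotent diagonal block can be handled by the lemmas on pairs.\<close>

lemma J_pair_symbols_diag: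
  assumes "D \<in> z_alt n n"
  shows "J_pair_symbols n n (D, D)"
proof -
  have "D $$ (k, l) = (if D $$ (k, l) = Star \<or> odd n \<and> Suc k = n \<and> n < l then Star else Zero)"
    if "k < n" "l < n" for k l
    using assms by (cases rule: z_alt_cases) (use that in auto)
  then show ?thesis using assms unfolding J_pair_symbols_def by (intro conjI bexI[of _ D] allI impI) auto
qed

lemma diag_spanning_J:
  assumes "D \<in> D_diag (JBlock n)"
  shows "diag_spanning (JBlock n) D"
  unfolding diag_spanning_def
proof (intro allI impI)
  fix x k l
  assume E: "dual_eqs (JBlock n) (JBlock n) x (\<lambda>k l. cnj (x l k))"
    and ok: "\<forall>k<summand_size (JBlock n). \<forall>l<summand_size (JBlock n). dual_ok (D $$ (k, l)) (x k l)"
    and kl: "k < summand_size (JBlock n)" "l < summand_size (JBlock n)"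
  have "pair_spanning (JBlock n) (JBlock n) (D, D)"
    using pair_spanning_J_J[OF J_pair_symbols_diag] assms by simp
  from this[unfolded pair_spanning_def, rule_format, OF E _ kl] ok show "x k l = 0" by simp
qed

lemma diag_transversal_J:
  assumes "D \<in> D_diag (JBlock n)"
  shows "diag_transversal (JBlock n) D"
  unfolding diag_transversal_def
proof (intro allI impI)
  fix C k l
  assume ok: "\<forall>k<summand_size (JBlock n). \<forall>l<summand_size (JBlock n).
      sym_ok (D $$ (k, l)) (congr1 (JBlock n) (JBlock n) (\<lambda>k j. cnj (C j k)) C k l)"
    and kl: "k < summand_size (JBlock n)" "l < summand_size (JBlock n)"
  have "pair_transversal (JBlock n) (JBlock n) (D, D)"
    using pair_transversal_J_J[OF J_pair_symbols_diag] assms by simp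
  from this[unfolded pair_transversal_def, rule_format, OF _ kl, where P = "\<lambda>k j. cnj (C j k)" and R = C] ok
  show "congr1 (JBlock n) (JBlock n) (\<lambda>k j. cnj (C j k)) C k l = 0"
    by (simp only: congr2_self sym_ok_cnj fst_conv snd_conv)
qed

subsection \<open>All blocks of a canonical matrix\<close>

fun canonical_summand :: "summand \<Rightarrow> bool" where
  "canonical_summand (HBlock m \<nu>) \<longleftrightarrow> 0 < m \<and> 1 < cmod \<nu>"
| "canonical_summand (DeltaBlock n \<mu>) \<longleftrightarrow> 0 < n \<and> cmod \<mu> = 1"
| "canonical_summand (JBlock n) \<longleftrightarrow> 0 < n"

lemma diag_spanning_canonical:
  "canonical_summand s \<Longrightarrow> D \<in> D_diag s \<Longrightarrow> diag_spanning s D"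
  using diag_spanning_H diag_spanning_Delta diag_spanning_J by (cases s) auto

lemma diag_transversal_canonical:
  "canonical_summand s \<Longrightarrow> D \<in> D_diag s \<Longrightarrow> diag_transversal s D"
  using diag_transversal_H diag_transversal_Delta diag_transversal_J by (cases s) auto

lemma pair_spanning_canonical:
  assumes s: "canonical_summand s" "canonical_summand s'" and D: "D \<in> D_off s s'"
  shows "pair_spanning s s' D"
proof (cases s)
  case s1: (HBlock m \<nu>)
  show ?thesis
  proof (cases s')
    case (HBlock n \<nu>')
    then show ?thesis using pair_spanning_H_H s D s1 by auto
  next
    case (DeltaBlock n \<mu>)
    then show ?thesis using pair_spanning_H_Delta s s1 by auto
  next
    case (JBlock n)
    have "fst D \<in> z_updown n (summand_size s)" if "odd n" using D s1 JBlock that by auto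
    then show ?thesis unfolding JBlock s1
      using pair_spanning_nonsingular_J[OF nonsingular_H] s s1 JBlock by auto
  qed
next
  case s1: (DeltaBlock m \<mu>)
  show ?thesis
  proof (cases s')
    case (DeltaBlock n \<mu>')
    then show ?thesis using pair_spanning_Delta_Delta s D s1 by auto
  next
    case (JBlock n)
    have "fst D \<in> z_updown n (summand_size s)" if "odd n" using D s1 JBlock that by auto
    then show ?thesis unfolding JBlock s1
      using pair_spanning_nonsingular_J[OF nonsingular_Delta] s s1 JBlock by auto
  qed (use D s1 in simp)
next
  case s1: (JBlock m)
  then show ?thesis using D pair_spanning_J_J[OF J_pair_symbols_D_off] by (cases s') auto
qed

lemma pair_transversal_canonical:
  assumes s: "canonical_summand s" "canonical_summand s'" and D: "D \<in> D_off s s'"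
  shows "pair_transversal s s' D"
proof -
  have nsJ: ?thesis if ns: "nonsingular_summand s" and s': "s' = JBlock n"
    and D': "D \<in> (if even n then {(zeros n (summand_size s), zeros (summand_size s) n)}
      else z_updown n (summand_size s) \<times> {zeros (summand_size s) n})" for n
  proof (cases "even n")
    case True
    then show ?thesis using D' s' by (intro pair_transversal_zeros) auto
  next
    case False
    then show ?thesis unfolding s' using D' by (intro pair_transversal_nonsingular_J[OF ns]) auto
  qed
  show ?thesis
  proof (cases s)
    case s1: (HBlock m \<nu>)
    show ?thesis
    proof (cases s')
      case (HBlock n \<nu>')
      then show ?thesis using pair_transversal_H_H s D s1 by auto
    next
      case (DeltaBlock n \<mu>)
      then show ?thesis using D s1 by (intro pair_transversal_zeros) auto
    next
      case (JBlock n)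
      have "D \<in> (if even n then {(zeros n (summand_size s), zeros (summand_size s) n)}
          else z_updown n (summand_size s) \<times> {zeros (summand_size s) n})"
        using D unfolding s1 JBlock by (simp only: D_off.simps summand_size.simps)
      then show ?thesis using nsJ[of n] nonsingular_H s(1) s1 JBlock by simp
    qed
  next
    case s1: (DeltaBlock m \<mu>)
    show ?thesis
    proof (cases s')
      case (DeltaBlock n \<mu>')
      then show ?thesis using pair_transversal_Delta_Delta s D s1 by auto
    next
      case (JBlock n)
      have "D \<in> (if even n then {(zeros n (summand_size s), zeros (summand_size s) n)}
          else z_updown n (summand_size s) \<times> {zeros (summand_size s) n})"
        using D unfolding s1 JBlock by (simp only: D_off.simps summand_size.simps)
      then show ?thesis using nsJ[of n] nonsingular_Delta s(1) s1 JBlock by simp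
    qed (use D s1 in simp)
  next
    case s1: (JBlock m)
    then show ?thesis using D pair_transversal_J_J[OF J_pair_symbols_D_off] by (cases s') auto
  qed
qed
section \<open>The tangent space of a canonical matrix\<close>

definition tangent :: "nat \<Rightarrow> (nat \<Rightarrow> nat \<Rightarrow> complex) \<Rightarrow> (nat \<Rightarrow> nat \<Rightarrow> complex) \<Rightarrow> nat \<Rightarrow> nat \<Rightarrow> complex" where
  "tangent n a C i j = (\<Sum>k<n. cnj (C k i) * a k j) + (\<Sum>k<n. a i k * C k j)"

text \<open>The matrix \<open>W\<^sup>* A + W A\<^sup>*\<close>. It represents the adjoint of
  \<open>tangent\<close> up to conjugate transposition, so its zeros form the annihilator of the
  tangent space.\<close>

definition cotangent :: "nat \<Rightarrow> (nat \<Rightarrow> nat \<Rightarrow> complex) \<Rightarrow> (nat \<Rightarrow> nat \<Rightarrow> complex) \<Rightarrow> nat \<Rightarrow> nat \<Rightarrow> complex" where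
  "cotangent n a W i j = (\<Sum>k<n. cnj (W k i) * a k j) + (\<Sum>k<n. W i k * cnj (a j k))"

subsection \<open>Block decomposition\<close>

lemma block_offset_simps [simp]:
  "block_offset As 0 = 0"
  "block_offset (s # As) (Suc p) = summand_size s + block_offset As p"
  by (simp_all add: block_offset_def)

lemma summand_mat_carrier: "summand_mat s \<in> carrier_mat (summand_size s) (summand_size s)"
  by (cases s) (auto simp: H_mat_def Delta_mat_def)

lemma canonical_mat_Cons:
  "canonical_mat (s # As) = four_block_mat (summand_mat s)
     (0\<^sub>m (summand_size s) (dim_col (canonical_mat As))) (0\<^sub>m (dim_row (canonical_mat As)) (summand_size s)) (canonical_mat As)"
  using summand_mat_carrier[of s] by (auto simp: canonical_mat_def Let_def)

lemma canonical_mat_carrier: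
  "canonical_mat As \<in> carrier_mat (block_offset As (length As)) (block_offset As (length As))"
proof (induction As)
  case Nil
  then show ?case by (simp add: canonical_mat_def)
next
  case (Cons s As)
  then show ?case using summand_mat_carrier[of s] by (auto simp: canonical_mat_Cons)
qed

lemma block_offset_less:
  "p < length As \<Longrightarrow> k < summand_size (As ! p) \<Longrightarrow> block_offset As p + k < block_offset As (length As)"
proof (induction As arbitrary: p)
  case (Cons s As)
  then show ?case by (cases p) auto
qed simp

lemma block_indexE:
  assumes "i < block_offset As (length As)"
  obtains p k where "p < length As" "k < summand_size (As ! p)" "i = block_offset As p + k"
  using assms
proof (induction As arbitrary: i thesis)
  case (Cons s As)
  show ?case
  proof (cases "i < summand_size s")
    case True
    then show ?thesis using Cons.prems(1)[of 0 i] by simp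
  next
    case False
    then have "i - summand_size s < block_offset As (length As)" using Cons.prems(2) by simp
    then obtain p k where "p < length As" "k < summand_size (As ! p)" "i - summand_size s = block_offset As p + k"
      by (rule Cons.IH[rotated])
    then show ?thesis using Cons.prems(1)[of "Suc p" k] False by simp
  qed
qed simp

lemma sum_blocks:
  fixes f :: "nat \<Rightarrow> 'a :: comm_monoid_add"
  shows "(\<Sum>i<block_offset As (length As). f i) =
    (\<Sum>p<length As. \<Sum>k<summand_size (As ! p). f (block_offset As p + k))"
proof (induction As arbitrary: f)
  case (Cons s As)
  have "(\<Sum>i<block_offset (s # As) (length (s # As)). f i) =
      (\<Sum>k<summand_size s. f k) + (\<Sum>i<block_offset As (length As). f (summand_size s + i))"
    using sum.atLeastLessThan_concat[of 0 "summand_size s" "summand_size s + block_offset As (length As)" f]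
      sum.shift_bounds_nat_ivl[of f 0 "summand_size s" "block_offset As (length As)"]
    by (simp add: lessThan_atLeast0 add.commute)
  also have "(\<Sum>i<block_offset As (length As). f (summand_size s + i)) =
      (\<Sum>p<length As. \<Sum>k<summand_size (As ! p). f (summand_size s + (block_offset As p + k)))"
    by (rule Cons.IH)
  also have "(\<Sum>k<summand_size s. f k) + \<dots> =
      (\<Sum>p<Suc (length As). \<Sum>k<summand_size ((s # As) ! p). f (block_offset (s # As) p + k))"
    by (subst sum.lessThan_Suc_shift) (simp add: add.assoc)
  finally show ?case by simp
qed simp

lemma canonical_mat_block:
  assumes "p < length As" "q < length As" "k < summand_size (As ! p)" "l < summand_size (As ! q)"
  shows "canonical_mat As $$ (block_offset As p + k, block_offset As q + l) =
    (if p = q then summand_mat (As ! p) $$ (k, l) else 0)"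
  using assms
proof (induction As arbitrary: p q)
  case (Cons s As)
  note less = block_offset_less[of _ As]
  show ?case
    using Cons.prems Cons.IH summand_mat_carrier[of s] canonical_mat_carrier[of As] less
    by (cases p; cases q) (auto simp: canonical_mat_Cons)
qed simp

lemma sum_single_block:
  fixes f g :: "nat \<Rightarrow> complex"
  assumes q: "q < length As"
    and g: "\<And>p k. p < length As \<Longrightarrow> k < summand_size (As ! p) \<Longrightarrow> f (block_offset As p + k) = (if p = q then g k else 0)"
  shows "(\<Sum>i<block_offset As (length As). f i) = (\<Sum>k<summand_size (As ! q). g k)"
proof -
  have "(\<Sum>i<block_offset As (length As). f i) = (\<Sum>p<length As. if p = q then (\<Sum>k<summand_size (As ! p). g k) else 0)"
    unfolding sum_blocks by (intro sum.cong) (auto simp: g)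
  then show ?thesis using q by simp
qed

context
  fixes As :: "summand list" and n :: nat and a :: "nat \<Rightarrow> nat \<Rightarrow> complex" and pos :: "nat \<Rightarrow> nat \<Rightarrow> nat"
  defines "n \<equiv> block_offset As (length As)" and "a \<equiv> \<lambda>i j. canonical_mat As $$ (i, j)"
    and "pos \<equiv> \<lambda>p k. block_offset As p + k"
begin

lemma tangent_block:
  assumes "p < length As" "q < length As" "k < summand_size (As ! p)" "l < summand_size (As ! q)"
  shows "tangent n a C (pos p k) (pos q l) =
    congr1 (As ! q) (As ! p) (\<lambda>k j. cnj (C (pos q j) (pos p k))) (\<lambda>k l. C (pos p k) (pos q l)) k l"
proof -
  have "(\<Sum>i<n. cnj (C i (pos p k)) * a i (pos q l)) =
      (\<Sum>j<summand_size (As ! q). cnj (C (pos q j) (pos p k)) * summand_mat (As ! q) $$ (j, l))"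
    unfolding n_def pos_def a_def
    by (rule sum_single_block) (use assms canonical_mat_block in auto)
  moreover have "(\<Sum>i<n. a (pos p k) i * C i (pos q l)) =
      (\<Sum>j<summand_size (As ! p). summand_mat (As ! p) $$ (k, j) * C (pos p j) (pos q l))"
    unfolding n_def pos_def a_def
    by (rule sum_single_block) (use assms canonical_mat_block in auto)
  ultimately show ?thesis
    unfolding tangent_def congr1_def row_mult_def mult_col_def by simp
qed

lemma cotangent_block:
  assumes "p < length As" "q < length As" "k < summand_size (As ! p)" "l < summand_size (As ! q)"
  shows "cotangent n a W (pos p k) (pos q l) =
    row_mult (As ! q) (\<lambda>j. cnj (W (pos q j) (pos p k))) l + row_mult_adj (As ! q) (\<lambda>j. W (pos p k) (pos q j)) l"
proof -
  have "(\<Sum>i<n. cnj (W i (pos p k)) * a i (pos q l)) =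
      (\<Sum>j<summand_size (As ! q). cnj (W (pos q j) (pos p k)) * summand_mat (As ! q) $$ (j, l))"
    unfolding n_def pos_def a_def
    by (rule sum_single_block) (use assms canonical_mat_block in auto)
  moreover have "(\<Sum>i<n. W (pos p k) i * cnj (a (pos q l) i)) =
      (\<Sum>j<summand_size (As ! q). W (pos p k) (pos q j) * cnj (summand_mat (As ! q) $$ (l, j)))"
    unfolding n_def pos_def a_def
    by (rule sum_single_block) (use assms canonical_mat_block in auto)
  ultimately show ?thesis
    unfolding cotangent_def row_mult_def row_mult_adj_def by simp
qed

context
  fixes D :: "symb mat"
  assumes canonical: "\<forall>s\<in>set As. canonical_summand s" and D: "D \<in> D_matrices As"
begin

lemma D_diag_block: "p < length As \<Longrightarrow> subblock As D p p \<in> D_diag (As ! p)"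
  using D by (simp add: D_matrices_def)

lemma D_off_block: "p < q \<Longrightarrow> q < length As \<Longrightarrow> (subblock As D q p, subblock As D p q) \<in> D_off (As ! p) (As ! q)"
  using D by (simp add: D_matrices_def)

lemma subblock_index:
  "k < summand_size (As ! p) \<Longrightarrow> l < summand_size (As ! q) \<Longrightarrow> subblock As D p q $$ (k, l) = D $$ (pos p k, pos q l)"
  by (simp add: subblock_def pos_def)

lemma pos_less: "p < length As \<Longrightarrow> k < summand_size (As ! p) \<Longrightarrow> pos p k < n"
  unfolding pos_def n_def by (rule block_offset_less)

lemma tangent_transversal:
  assumes ok: "\<And>i j. i < n \<Longrightarrow> j < n \<Longrightarrow> sym_ok (D $$ (i, j)) (tangent n a C i j)"
    and ij: "i < n" "j < n"
  shows "tangent n a C i j = 0"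
proof -
  have diag: "tangent n a C (pos p k) (pos p l) = 0" if p: "p < length As" and kl: "k < summand_size (As ! p)" "l < summand_size (As ! p)" for p k l
  proof -
    let ?C = "\<lambda>k l. C (pos p k) (pos p l)"
    have *: "tangent n a C (pos p k) (pos p l) = congr1 (As ! p) (As ! p) (\<lambda>k j. cnj (?C j k)) ?C k l"
      if "k < summand_size (As ! p)" "l < summand_size (As ! p)" for k l
      using tangent_block[OF p p that] .
    have "diag_transversal (As ! p) (subblock As D p p)"
      by (rule diag_transversal_canonical[OF _ D_diag_block[OF p]]) (use canonical p in auto)
    from this[unfolded diag_transversal_def, rule_format, OF _ kl, of ?C]
    show ?thesis unfolding *[OF kl]
      using ok pos_less[OF p] by (simp add: subblock_index flip: *)
  qed
  have off: "tangent n a C (pos q k) (pos p l) = 0 \<and> tangent n a C (pos p l) (pos q k) = 0"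
    if pq: "p < q" "q < length As" and kl: "k < summand_size (As ! q)" "l < summand_size (As ! p)" for p q k l
  proof -
    let ?P = "\<lambda>k j. cnj (C (pos p j) (pos q k))" and ?R = "\<lambda>k l. C (pos q k) (pos p l)"
    have p: "p < length As" using pq by simp
    have 1: "tangent n a C (pos q k) (pos p l) = congr1 (As ! p) (As ! q) ?P ?R k l"
      if "k < summand_size (As ! q)" "l < summand_size (As ! p)" for k l
      using tangent_block[OF pq(2) p that] .
    \<comment> \<open>Conjugating the block above the diagonal makes it the second residual of the
      same pair \<open>(P, R)\<close>; the condition of a symbol is invariant under
      conjugation.\<close>
    have 2: "tangent n a C (pos p l) (pos q k) = cnj (congr2 (As ! p) (As ! q) ?P ?R k l)"
      if "k < summand_size (As ! q)" "l < summand_size (As ! p)" for k l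
      using tangent_block[OF p pq(2) that(2,1), of C]
      by (simp add: congr1_def congr2_def cnj_row_mult_adj cnj_adj_mult_col)
    have 3: "sym_ok (D $$ (pos q k, pos p l)) (congr1 (As ! p) (As ! q) ?P ?R k l)"
      "sym_ok (D $$ (pos p l, pos q k)) (congr2 (As ! p) (As ! q) ?P ?R k l)"
      if "k < summand_size (As ! q)" "l < summand_size (As ! p)" for k l
      using ok[OF pos_less[OF pq(2) that(1)] pos_less[OF p that(2)]] ok[OF pos_less[OF p that(2)] pos_less[OF pq(2) that(1)]]
      unfolding 1[OF that] 2[OF that] by simp_all
    have "pair_transversal (As ! p) (As ! q) (subblock As D q p, subblock As D p q)"
      by (rule pair_transversal_canonical[OF _ _ D_off_block[OF pq]]) (use canonical p pq in auto)
    from this[unfolded pair_transversal_def, rule_format, OF _ kl, of ?P ?R]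
    show ?thesis unfolding 1[OF kl] 2[OF kl] using 3 by (simp add: subblock_index)
  qed
  obtain p k where p: "p < length As" "k < summand_size (As ! p)" "i = pos p k"
    using ij(1) unfolding n_def pos_def by (rule block_indexE)
  obtain q l where q: "q < length As" "l < summand_size (As ! q)" "j = pos q l"
    using ij(2) unfolding n_def pos_def by (rule block_indexE)
  show ?thesis
    using diag[of p k l] off[of p q l k] off[of q p k l] p q
    by (cases p q rule: linorder_cases) auto
qed

lemma cotangent_spanning:
  assumes W: "\<And>i j. i < n \<Longrightarrow> j < n \<Longrightarrow> cotangent n a W i j = 0"
    and ok: "\<And>i j. i < n \<Longrightarrow> j < n \<Longrightarrow> dual_ok (D $$ (i, j)) (W i j)"
    and ij: "i < n" "j < n"
  shows "W i j = 0"
proof -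
  have eqs: "dual_eqs (As ! p) (As ! q) (\<lambda>k l. W (pos q k) (pos p l)) (\<lambda>k l. cnj (W (pos p l) (pos q k)))"
    if p: "p < length As" and q: "q < length As" for p q
    unfolding dual_eqs_def
  proof (intro allI impI conjI)
    fix k l assume kl: "k < summand_size (As ! q)" "l < summand_size (As ! p)"
    show "row_mult (As ! p) (\<lambda>l. cnj (W (pos p l) (pos q k))) l + row_mult_adj (As ! p) (\<lambda>l. W (pos q k) (pos p l)) l = 0"
      using cotangent_block[OF q p kl, of W] W pos_less p q kl by simp
    \<comment> \<open>The second family of dual equations is the adjoint of the block
      \<open>(p, q)\<close> of the cotangent equation.\<close>
    have "row_mult (As ! q) (\<lambda>j. cnj (W (pos q j) (pos p l))) k + row_mult_adj (As ! q) (\<lambda>j. W (pos p l) (pos q j)) k = 0"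
      using cotangent_block[OF p q kl(2,1), of W] W pos_less p q kl by simp
    from arg_cong[OF this, of cnj]
    show "mult_col (As ! q) (\<lambda>j. cnj (W (pos p l) (pos q j))) k + adj_mult_col (As ! q) (\<lambda>j. W (pos q j) (pos p l)) k = 0"
      by (simp add: cnj_row_mult cnj_row_mult_adj add.commute)
  qed
  have diag: "W (pos p k) (pos p l) = 0" if p: "p < length As" and kl: "k < summand_size (As ! p)" "l < summand_size (As ! p)" for p k l
  proof -
    have "diag_spanning (As ! p) (subblock As D p p)"
      by (rule diag_spanning_canonical[OF _ D_diag_block[OF p]]) (use canonical p in auto)
    from this[unfolded diag_spanning_def, rule_format, OF eqs[OF p p] _ kl]
    show ?thesis using ok pos_less[OF p] by (simp add: subblock_index)
  qed
  have off: "W (pos q k) (pos p l) = 0 \<and> W (pos p l) (pos q k) = 0"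
    if pq: "p < q" "q < length As" and kl: "k < summand_size (As ! q)" "l < summand_size (As ! p)" for p q k l
  proof -
    have p: "p < length As" using pq by simp
    have "pair_spanning (As ! p) (As ! q) (subblock As D q p, subblock As D p q)"
      by (rule pair_spanning_canonical[OF _ _ D_off_block[OF pq]]) (use canonical p pq in auto)
    from this[unfolded pair_spanning_def, rule_format, OF eqs[OF p pq(2)] _ kl]
    show ?thesis using ok pos_less[OF p] pos_less[OF pq(2)] by (simp add: subblock_index)
  qed
  obtain p k where p: "p < length As" "k < summand_size (As ! p)" "i = pos p k"
    using ij(1) unfolding n_def pos_def by (rule block_indexE)
  obtain q l where q: "q < length As" "l < summand_size (As ! q)" "j = pos q l"
    using ij(2) unfolding n_def pos_def by (rule block_indexE)
  show ?thesis
    using diag[of p k l] off[of p q l k] off[of q p k l] p q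
    by (cases p q rule: linorder_cases) auto
qed

end

end
subsection \<open>From a trivial annihilator to a complement\<close>

text \<open>Separation from a subspace, by induction on the coordinates. If some vector of
  \<open>W\<close> is nonzero at the new coordinate \<open>k\<close>, a normalized \<open>w1\<close>
  reduces everything to the vectors vanishing at \<open>k\<close>, and the weight \<open>b\<close>
  at \<open>k\<close> is the one for which the functional annihilates \<open>w1\<close>.\<close>

lemma separating_functional:
  fixes W :: "('i \<Rightarrow> real) set"
  assumes "finite K"
    and add: "\<And>v w. v \<in> W \<Longrightarrow> w \<in> W \<Longrightarrow> (\<lambda>i. v i + w i) \<in> W"
    and scale: "\<And>c w. w \<in> W \<Longrightarrow> (\<lambda>i. c * w i) \<in> W"
    and zero: "(\<lambda>_. 0) \<in> W"
    and none: "\<not> (\<exists>w\<in>W. \<forall>i\<in>K. w i = y i)"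
  shows "\<exists>u. (\<forall>w\<in>W. (\<Sum>i\<in>K. u i * w i) = 0) \<and> (\<Sum>i\<in>K. u i * y i) \<noteq> 0"
  using assms
proof (induction K arbitrary: W y rule: finite_induct)
  case empty
  then show ?case by auto
next
  case (insert k K)
  note add = insert.prems(1) and scale = insert.prems(2) and zero = insert.prems(3) and none = insert.prems(4)
  define W' where "W' = {w \<in> W. w k = 0}"
  have add': "(\<lambda>i. v i + w i) \<in> W'" if "v \<in> W'" "w \<in> W'" for v w
    using that add by (simp add: W'_def)
  have scale': "(\<lambda>i. c * w i) \<in> W'" if "w \<in> W'" for c w
    using that scale by (simp add: W'_def)
  have zero': "(\<lambda>_. 0) \<in> W'" using zero by (simp add: W'_def)
  have sum_upd: "(\<Sum>i\<in>insert k K. (u(k := b)) i * w i) = b * w k + (\<Sum>i\<in>K. u i * w i)" for u w :: "'i \<Rightarrow> real" and b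
    using insert.hyps by (simp add: sum.insert_if) (rule sum.cong, auto)
  show ?case
  proof (cases "W' = W")
    case True
    then have Wk: "w k = 0" if "w \<in> W" for w using that by (auto simp: W'_def)
    show ?thesis
    proof (cases "y k = 0")
      case True
      then have "\<not> (\<exists>w\<in>W. \<forall>i\<in>K. w i = y i)" using none Wk by auto
      from insert.IH[OF add scale zero this] obtain u where
        u: "\<forall>w\<in>W. (\<Sum>i\<in>K. u i * w i) = 0" "(\<Sum>i\<in>K. u i * y i) \<noteq> 0" by blast
      show ?thesis
        by (rule exI[of _ "u(k := 0)"]) (use u in \<open>simp only: sum_upd, simp\<close>)
    next
      case False
      show ?thesis
        by (rule exI[of _ "(\<lambda>_. 0)(k := 1)"]) (simp only: sum_upd, simp add: Wk False)
    qed
  next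
    case False
    then obtain w0 where "w0 \<in> W" "w0 k \<noteq> 0" by (auto simp: W'_def)
    define w1 where "w1 = (\<lambda>i. inverse (w0 k) * w0 i)"
    have w1: "w1 \<in> W" "w1 k = 1" using scale[OF \<open>w0 \<in> W\<close>] \<open>w0 k \<noteq> 0\<close> by (auto simp: w1_def)
    have red: "(\<lambda>i. w i + (- w k) * w1 i) \<in> W'" if "w \<in> W" for w
      unfolding W'_def using add[OF that scale[OF w1(1)]] by (intro CollectI conjI) (assumption, simp add: w1(2))
    define y' where "y' = (\<lambda>i. y i - y k * w1 i)"
    have "\<not> (\<exists>w\<in>W'. \<forall>i\<in>K. w i = y' i)"
    proof
      assume "\<exists>w\<in>W'. \<forall>i\<in>K. w i = y' i"
      then obtain w where w: "w \<in> W" "w k = 0" "\<forall>i\<in>K. w i = y' i" by (auto simp: W'_def)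
      have "(\<lambda>i. w i + y k * w1 i) \<in> W" using add[OF w(1) scale[OF w1(1)]] .
      moreover have "\<forall>i\<in>insert k K. w i + y k * w1 i = y i" using w w1(2) by (auto simp: y'_def)
      ultimately have "\<exists>w\<in>W. \<forall>i\<in>insert k K. w i = y i"
        by (intro bexI[of _ "\<lambda>i. w i + y k * w1 i"])
      with none show False by contradiction
    qed
    from insert.IH[OF add' scale' zero' this] obtain u where
      u: "\<forall>w\<in>W'. (\<Sum>i\<in>K. u i * w i) = 0" "(\<Sum>i\<in>K. u i * y' i) \<noteq> 0" by blast
    define b where "b = - (\<Sum>i\<in>K. u i * w1 i)"
    have lin: "(\<Sum>i\<in>K. u i * (w i + c * w1 i)) = (\<Sum>i\<in>K. u i * w i) + c * (\<Sum>i\<in>K. u i * w1 i)" for w c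
      by (simp add: algebra_simps sum.distrib sum_distrib_left)
    have "(\<Sum>i\<in>insert k K. (u(k := b)) i * w i) = 0" if "w \<in> W" for w
      using u(1)[rule_format, OF red[OF that]] unfolding sum_upd lin b_def by (simp add: algebra_simps)
    moreover have "(\<Sum>i\<in>insert k K. (u(k := b)) i * y i) \<noteq> 0"
      using u(2) lin[of y "- y k"] unfolding sum_upd b_def y'_def by (simp add: algebra_simps)
    ultimately show ?thesis by blast
  qed
qed

section \<open>Real linearity of the tangent map, its adjoint, and the complement\<close>

lemma tangent_add: "tangent n a (\<lambda>i j. C i j + C' i j) i j = tangent n a C i j + tangent n a C' i j"
  by (simp add: tangent_def algebra_simps sum.distrib)

lemma tangent_scale: "tangent n a (\<lambda>i j. complex_of_real c * C i j) i j = complex_of_real c * tangent n a C i j"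
  by (simp add: tangent_def algebra_simps sum_distrib_left)

lemma tangent_sum: "tangent n a (\<lambda>i j. \<Sum>p\<in>S. C p i j) i j = (\<Sum>p\<in>S. tangent n a (C p) i j)"
proof (induction S rule: infinite_finite_induct)
  case (insert x F)
  then show ?case using tangent_add[of n a "C x" "\<lambda>i j. \<Sum>p\<in>F. C p i j"] by simp
qed (simp_all add: tangent_def)

lemma sym_ok_add: "sym_ok s z \<Longrightarrow> sym_ok s w \<Longrightarrow> sym_ok s (z + w)"
  by (cases s) auto

lemma sym_ok_scale: "sym_ok s z \<Longrightarrow> sym_ok s (complex_of_real c * z)"
  by (cases s) auto

lemma sym_ok_zero: "sym_ok s 0"
  by (cases s) auto

lemma sym_ok_sum: "(\<And>p. p \<in> S \<Longrightarrow> sym_ok s (f p)) \<Longrightarrow> sym_ok s (sum f S)"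
  by (induction S rule: infinite_finite_induct) (auto simp: sym_ok_zero sym_ok_add)

text \<open>The adjoint of \<open>C \<mapsto> C\<^sup>* A + A C\<close> with respect to the real inner product.\<close>

lemma tangent_adjoint:
  "(\<Sum>i<n. \<Sum>j<n. Re (cnj (W i j) * tangent n a C i j)) = Re (\<Sum>k<n. \<Sum>i<n. C k i * cotangent n a W i k)"
proof -
  have "(\<Sum>i<n. \<Sum>j<n. Re (cnj (W i j) * tangent n a C i j)) =
      Re (\<Sum>i<n. \<Sum>j<n. \<Sum>k<n. cnj (W i j) * cnj (C k i) * a k j) + Re (\<Sum>i<n. \<Sum>j<n. \<Sum>k<n. cnj (W i j) * a i k * C k j)"
    by (simp add: tangent_def sum_distrib_left sum.distrib distrib_left mult.assoc)
  also have "(\<Sum>i<n. \<Sum>j<n. \<Sum>k<n. cnj (W i j) * cnj (C k i) * a k j) =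
      cnj (\<Sum>i<n. \<Sum>j<n. \<Sum>k<n. W i j * C k i * cnj (a k j))"
    by simp
  also have "Re (cnj (\<Sum>i<n. \<Sum>j<n. \<Sum>k<n. W i j * C k i * cnj (a k j))) = Re (\<Sum>i<n. \<Sum>j<n. \<Sum>k<n. W i j * C k i * cnj (a k j))"
    by (rule cnj.sel(1))
  also have "(\<Sum>i<n. \<Sum>j<n. \<Sum>k<n. W i j * C k i * cnj (a k j)) = (\<Sum>k<n. \<Sum>i<n. C k i * (\<Sum>j<n. W i j * cnj (a k j)))"
  proof -
    have "(\<Sum>i<n. \<Sum>j<n. \<Sum>k<n. W i j * C k i * cnj (a k j)) = (\<Sum>i<n. \<Sum>k<n. \<Sum>j<n. W i j * C k i * cnj (a k j))"
      by (intro sum.cong[OF refl] sum.swap)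
    also have "\<dots> = (\<Sum>k<n. \<Sum>i<n. \<Sum>j<n. W i j * C k i * cnj (a k j))"
      by (rule sum.swap)
    finally show ?thesis by (simp add: sum_distrib_left mult_ac)
  qed
  also have "(\<Sum>i<n. \<Sum>j<n. \<Sum>k<n. cnj (W i j) * a i k * C k j) = (\<Sum>k<n. \<Sum>j<n. C k j * (\<Sum>i<n. cnj (W i j) * a i k))"
  proof -
    have "(\<Sum>i<n. \<Sum>j<n. \<Sum>k<n. cnj (W i j) * a i k * C k j) = (\<Sum>i<n. \<Sum>k<n. \<Sum>j<n. cnj (W i j) * a i k * C k j)"
      by (intro sum.cong[OF refl] sum.swap)
    also have "\<dots> = (\<Sum>k<n. \<Sum>i<n. \<Sum>j<n. cnj (W i j) * a i k * C k j)"
      by (rule sum.swap)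
    also have "\<dots> = (\<Sum>k<n. \<Sum>j<n. \<Sum>i<n. cnj (W i j) * a i k * C k j)"
      by (intro sum.cong[OF refl] sum.swap)
    finally show ?thesis by (simp add: sum_distrib_left mult_ac)
  qed
  finally show ?thesis
    by (simp add: cotangent_def distrib_left sum.distrib add.commute)
qed

lemma tangent_complement:
  fixes D :: "symb mat" and n :: nat and a M :: "nat \<Rightarrow> nat \<Rightarrow> complex"
  assumes spanning: "\<And>W i j. (\<And>i j. i < n \<Longrightarrow> j < n \<Longrightarrow> cotangent n a W i j = 0) \<Longrightarrow>
      (\<And>i j. i < n \<Longrightarrow> j < n \<Longrightarrow> dual_ok (D $$ (i, j)) (W i j)) \<Longrightarrow> i < n \<Longrightarrow> j < n \<Longrightarrow> W i j = 0"
  shows "\<exists>C. \<forall>i<n. \<forall>j<n. sym_ok (D $$ (i, j)) (M i j - tangent n a C i j)"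
proof (rule ccontr)
  assume contra: "\<not> ?thesis"
  define coord where "coord N = (\<lambda>(i, j, b). if b then Im (N i j) else Re (N i j))" for N :: "nat \<Rightarrow> nat \<Rightarrow> complex"
  define K where "K = {..<n} \<times> {..<n} \<times> (UNIV :: bool set)"
  define V where "V = {coord (\<lambda>i j. tangent n a C i j + N i j) |C N. \<forall>i<n. \<forall>j<n. sym_ok (D $$ (i, j)) (N i j)}"
  have "\<exists>u. (\<forall>w\<in>V. (\<Sum>i\<in>K. u i * w i) = 0) \<and> (\<Sum>i\<in>K. u i * coord M i) \<noteq> 0"
  proof (rule separating_functional)
    show "finite K" by (simp add: K_def)
    fix v w assume "v \<in> V" "w \<in> V"
    then obtain C N C' N' where v: "v = coord (\<lambda>i j. tangent n a C i j + N i j)" "\<forall>i<n. \<forall>j<n. sym_ok (D $$ (i, j)) (N i j)"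
      and w: "w = coord (\<lambda>i j. tangent n a C' i j + N' i j)" "\<forall>i<n. \<forall>j<n. sym_ok (D $$ (i, j)) (N' i j)"
      by (auto simp: V_def)
    have "(\<lambda>i. v i + w i) = coord (\<lambda>i j. tangent n a (\<lambda>i j. C i j + C' i j) i j + (N i j + N' i j))"
      unfolding v(1) w(1) tangent_add by (auto simp: coord_def)
    moreover have "\<forall>i<n. \<forall>j<n. sym_ok (D $$ (i, j)) (N i j + N' i j)"
      using v(2) w(2) by (auto intro: sym_ok_add)
    ultimately show "(\<lambda>i. v i + w i) \<in> V" unfolding V_def
      by (intro CollectI exI[of _ "\<lambda>i j. C i j + C' i j"] exI[of _ "\<lambda>i j. N i j + N' i j"] conjI)
  next
    fix c w assume "w \<in> V"
    then obtain C N where w: "w = coord (\<lambda>i j. tangent n a C i j + N i j)" "\<forall>i<n. \<forall>j<n. sym_ok (D $$ (i, j)) (N i j)"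
      by (auto simp: V_def)
    have "(\<lambda>i. c * w i) = coord (\<lambda>i j. tangent n a (\<lambda>i j. complex_of_real c * C i j) i j + complex_of_real c * N i j)"
      unfolding w(1) tangent_scale by (auto simp: coord_def algebra_simps)
    moreover have "\<forall>i<n. \<forall>j<n. sym_ok (D $$ (i, j)) (complex_of_real c * N i j)"
      using w(2) by (auto intro: sym_ok_scale)
    ultimately show "(\<lambda>i. c * w i) \<in> V" unfolding V_def
      by (intro CollectI exI[of _ "\<lambda>i j. complex_of_real c * C i j"] exI[of _ "\<lambda>i j. complex_of_real c * N i j"] conjI)
  next
    have "(\<lambda>_. 0) = coord (\<lambda>i j. tangent n a (\<lambda>_ _. 0) i j + 0)"
      by (auto simp: coord_def tangent_def)
    then show "(\<lambda>_. 0) \<in> V" unfolding V_def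
      by (intro CollectI exI[of _ "\<lambda>_ _. 0"] conjI) (auto simp: sym_ok_zero)
  next
    show "\<not> (\<exists>w\<in>V. \<forall>i\<in>K. w i = coord M i)"
    proof
      assume "\<exists>w\<in>V. \<forall>i\<in>K. w i = coord M i"
      then obtain w where w: "w \<in> V" "\<forall>i\<in>K. w i = coord M i" by blast
      then obtain C N where N: "\<forall>i<n. \<forall>j<n. sym_ok (D $$ (i, j)) (N i j)"
        and w': "w = coord (\<lambda>i j. tangent n a C i j + N i j)"
        unfolding V_def by blast
      have eq: "coord (\<lambda>i j. tangent n a C i j + N i j) (i, j, b) = coord M (i, j, b)" if "i < n" "j < n" for i j b
        using w(2) that unfolding w' K_def by simp
      have "tangent n a C i j + N i j = M i j" if "i < n" "j < n" for i j
        using eq[OF that, of True] eq[OF that, of False] by (simp add: coord_def complex_eq_iff)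
      then have "M i j - tangent n a C i j = N i j" if "i < n" "j < n" for i j
        using that by (metis add_diff_cancel_left')
      then have "\<exists>C. \<forall>i<n. \<forall>j<n. sym_ok (D $$ (i, j)) (M i j - tangent n a C i j)"
        by (intro exI[of _ C]) (use N in simp)
      with contra show False by blast
    qed
  qed
  then obtain u where u: "\<And>w. w \<in> V \<Longrightarrow> (\<Sum>i\<in>K. u i * w i) = 0" "(\<Sum>i\<in>K. u i * coord M i) \<noteq> 0" by blast
  define W where "W = (\<lambda>i j. Complex (u (i, j, False)) (u (i, j, True)))"
  have inner: "(\<Sum>i\<in>K. u i * coord N i) = (\<Sum>i<n. \<Sum>j<n. Re (cnj (W i j) * N i j))" for N
    by (simp add: K_def sum.cartesian_product' UNIV_bool coord_def W_def)
  have "V_mem": "(\<Sum>i<n. \<Sum>j<n. Re (cnj (W i j) * (tangent n a C i j + N i j))) = 0"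
    if "\<forall>i<n. \<forall>j<n. sym_ok (D $$ (i, j)) (N i j)" for C N
    unfolding inner[symmetric] by (rule u(1)) (use that in \<open>auto simp: V_def\<close>)
  have cot: "cotangent n a W i j = 0" if ij: "i < n" "j < n" for i j
  proof -
    \<comment> \<open>Testing against the adjoint of the cotangent matrix itself turns the pairing
      into a sum of squares.\<close>
    let ?C = "\<lambda>k i. cnj (cotangent n a W i k)"
    have "(\<Sum>i<n. \<Sum>j<n. Re (cnj (W i j) * tangent n a ?C i j)) = 0"
      using V_mem[of "\<lambda>_ _. 0" ?C] by (simp add: sym_ok_zero)
    then have "(\<Sum>k<n. \<Sum>i<n. (cmod (cotangent n a W i k))\<^sup>2) = 0"
      unfolding tangent_adjoint by (simp add: complex_mult_cnj cmod_power2 mult.commute[of "cnj _"])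
    then have "\<forall>k<n. (\<Sum>i<n. (cmod (cotangent n a W i k))\<^sup>2) = 0"
      by (subst (asm) sum_nonneg_eq_0_iff) (auto intro: sum_nonneg)
    with ij(2) have "(\<Sum>i<n. (cmod (cotangent n a W i j))\<^sup>2) = 0" by blast
    then show ?thesis using ij(1)
      by (subst (asm) sum_nonneg_eq_0_iff) auto
  qed
  have dual: "dual_ok (D $$ (i, j)) (W i j)" if ij: "i < n" "j < n" for i j
  proof -
    have *: "Re (cnj (W i j) * z) = 0" if z: "sym_ok (D $$ (i, j)) z" for z
    proof -
      let ?N = "\<lambda>k l. if k = i \<and> l = j then z else 0"
      have "\<forall>k<n. \<forall>l<n. sym_ok (D $$ (k, l)) (?N k l)"
        using z by (auto simp: sym_ok_zero)
      from V_mem[OF this, of "\<lambda>_ _. 0"]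
      have "(\<Sum>k<n. \<Sum>l<n. Re (cnj (W k l) * ?N k l)) = 0"
        by (simp add: tangent_def)
      moreover have "(\<Sum>k<n. \<Sum>l<n. Re (cnj (W k l) * ?N k l)) = (\<Sum>k<n. \<Sum>l<n. if l = j then (if k = i then Re (cnj (W i j) * z) else 0) else 0)"
        by (intro sum.cong refl) auto
      ultimately show ?thesis using ij by simp
    qed
    show ?thesis
      using *[of 1] *[of \<i>] by (cases "D $$ (i, j)") (auto simp: complex_eq_iff)
  qed
  have "W i j = 0" if "i < n" "j < n" for i j
    using spanning[OF cot dual that] .
  then show False using u(2) unfolding inner by simp
qed

text \<open>A real-linear operator, written in terms of the entries of \<open>M\<close> and their conjugates.\<close>

definition real_linear_op :: "nat \<Rightarrow> (nat \<Rightarrow> nat \<Rightarrow> nat \<Rightarrow> nat \<Rightarrow> complex) \<Rightarrow> (nat \<Rightarrow> nat \<Rightarrow> nat \<Rightarrow> nat \<Rightarrow> complex) \<Rightarrow>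
    (nat \<Rightarrow> nat \<Rightarrow> complex) \<Rightarrow> nat \<Rightarrow> nat \<Rightarrow> complex" where
  "real_linear_op n \<alpha> \<beta> M i j = (\<Sum>k<n. \<Sum>l<n. \<alpha> i j k l * M k l + \<beta> i j k l * cnj (M k l))"

text \<open>Reductions are chosen only for the elementary matrices with entry 1 or
  \<open>\<i>\<close> and extended by real linearity. Writing the real and imaginary parts of an
  entry through the entry and its conjugate produces \<open>\<alpha>\<close> and
  \<open>\<beta>\<close>.\<close>

lemma tangent_complement_linear:
  fixes D :: "symb mat" and n :: nat and a :: "nat \<Rightarrow> nat \<Rightarrow> complex"
  assumes spanning: "\<And>W i j. (\<And>i j. i < n \<Longrightarrow> j < n \<Longrightarrow> cotangent n a W i j = 0) \<Longrightarrow>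
      (\<And>i j. i < n \<Longrightarrow> j < n \<Longrightarrow> dual_ok (D $$ (i, j)) (W i j)) \<Longrightarrow> i < n \<Longrightarrow> j < n \<Longrightarrow> W i j = 0"
  obtains \<alpha> \<beta> where "\<And>M i j. i < n \<Longrightarrow> j < n \<Longrightarrow> sym_ok (D $$ (i, j)) (M i j - tangent n a (real_linear_op n \<alpha> \<beta> M) i j)"
proof -
  define E :: "nat \<Rightarrow> nat \<Rightarrow> complex \<Rightarrow> nat \<Rightarrow> nat \<Rightarrow> complex"
    where "E k l z = (\<lambda>i j. if i = k \<and> j = l then z else 0)" for k l z
  have "\<forall>k l z. \<exists>C. \<forall>i<n. \<forall>j<n. sym_ok (D $$ (i, j)) (E k l z i j - tangent n a C i j)"
    by (intro allI tangent_complement) (rule spanning, blast+)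
  then obtain G where G: "\<And>k l z i j. i < n \<Longrightarrow> j < n \<Longrightarrow> sym_ok (D $$ (i, j)) (E k l z i j - tangent n a (G k l z) i j)"
    by metis
  define \<alpha> where "\<alpha> = (\<lambda>i j k l. (G k l 1 i j - \<i> * G k l \<i> i j) / 2)"
  define \<beta> where "\<beta> = (\<lambda>i j k l. (G k l 1 i j + \<i> * G k l \<i> i j) / 2)"
  show ?thesis
  proof (rule that)
    fix M :: "nat \<Rightarrow> nat \<Rightarrow> complex" and i j assume ij: "i < n" "j < n"
    define g where "g = (\<lambda>p i j. complex_of_real (Re (M (fst p) (snd p))) * G (fst p) (snd p) 1 i j +
        complex_of_real (Im (M (fst p) (snd p))) * G (fst p) (snd p) \<i> i j)"
    have op: "real_linear_op n \<alpha> \<beta> M = (\<lambda>i j. \<Sum>p\<in>{..<n} \<times> {..<n}. g p i j)"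
    proof (intro ext)
      fix i j
      have "\<alpha> i j k l * M k l + \<beta> i j k l * cnj (M k l) =
          complex_of_real (Re (M k l)) * G k l 1 i j + complex_of_real (Im (M k l)) * G k l \<i> i j" for k l
        unfolding \<alpha>_def \<beta>_def by (simp add: complex_eq_iff field_simps)
      then show "real_linear_op n \<alpha> \<beta> M i j = (\<Sum>p\<in>{..<n} \<times> {..<n}. g p i j)"
        unfolding real_linear_op_def g_def sum.cartesian_product by (simp add: case_prod_unfold)
    qed
    have "M i j = (\<Sum>k<n. \<Sum>l<n. complex_of_real (Re (M k l)) * E k l 1 i j + complex_of_real (Im (M k l)) * E k l \<i> i j)"
    proof -
      have "(\<Sum>k<n. \<Sum>l<n. complex_of_real (Re (M k l)) * E k l 1 i j + complex_of_real (Im (M k l)) * E k l \<i> i j) =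
          (\<Sum>k<n. \<Sum>l<n. if l = j then (if k = i then M i j else 0) else 0)"
        by (intro sum.cong refl) (auto simp: E_def complex_eq_iff)
      then show ?thesis using ij by simp
    qed
    then have M: "M i j = (\<Sum>p\<in>{..<n} \<times> {..<n}. complex_of_real (Re (M (fst p) (snd p))) * E (fst p) (snd p) 1 i j +
        complex_of_real (Im (M (fst p) (snd p))) * E (fst p) (snd p) \<i> i j)"
      unfolding sum.cartesian_product by (simp add: case_prod_unfold)
    have "M i j - tangent n a (real_linear_op n \<alpha> \<beta> M) i j =
      (\<Sum>p\<in>{..<n} \<times> {..<n}. complex_of_real (Re (M (fst p) (snd p))) * (E (fst p) (snd p) 1 i j - tangent n a (G (fst p) (snd p) 1) i j) +
        complex_of_real (Im (M (fst p) (snd p))) * (E (fst p) (snd p) \<i> i j - tangent n a (G (fst p) (snd p) \<i>) i j))"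
      unfolding op tangent_sum g_def tangent_add tangent_scale M sum_subtractf[symmetric]
      by (intro sum.cong refl) (simp only: right_diff_distrib add_diff_add)
    also have "sym_ok (D $$ (i, j)) \<dots>"
      by (intro sym_ok_sum sym_ok_add sym_ok_scale G ij)
    finally show "sym_ok (D $$ (i, j)) (M i j - tangent n a (real_linear_op n \<alpha> \<beta> M) i j)" .
  qed
qed
section \<open>Absolutely convergent power series\<close>

text \<open>Points of the space agree with \<open>p\<close> from coordinate \<open>r\<close> on, so
  a product neighbourhood restricts only the first \<open>r\<close> coordinates, and the smallest of
  their radii serves for all.\<close>

lemma eventually_near_iff:
  assumes p: "p \<in> topspace (Euclidean_space r)"
  shows "eventually P (near r p) \<longleftrightarrow>
    (\<exists>d>0. \<forall>x\<in>topspace (Euclidean_space r). (\<forall>i<r. \<bar>x i - p i\<bar> < d) \<longrightarrow> P x)"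
proof
  assume "eventually P (near r p)"
  then obtain S where S: "openin (Euclidean_space r) S" "p \<in> S" "\<And>x. x \<in> S \<Longrightarrow> P x"
    using p unfolding eventually_nhdsin by blast
  then obtain T where T: "openin (powertop_real UNIV) T" "S = T \<inter> {x. \<forall>i\<ge>r. x i = 0}"
    unfolding Euclidean_space_def openin_subtopology by blast
  have "\<exists>U. finite {i \<in> UNIV. U i \<noteq> topspace euclideanreal} \<and> (\<forall>i\<in>UNIV. openin euclideanreal (U i)) \<and>
      p \<in> Pi\<^sub>E UNIV U \<and> Pi\<^sub>E UNIV U \<subseteq> T"
    using T(1) S(2) unfolding T(2) openin_product_topology_alt by blast
  then obtain U where U: "\<And>i. open (U i)" "\<And>i. p i \<in> U i" "Pi\<^sub>E UNIV U \<subseteq> T"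
    by (auto simp: PiE_iff)
  have "\<exists>d>0. \<forall>y. \<bar>y - p i\<bar> < d \<longrightarrow> y \<in> U i" for i
    using U(1,2)[of i] unfolding open_dist by (auto simp: dist_real_def)
  then obtain d where d: "\<And>i. d i > 0" "\<And>i y. \<bar>y - p i\<bar> < d i \<Longrightarrow> y \<in> U i" by metis
  \<comment> \<open>The inserted 1 keeps the set nonempty when \<open>r = 0\<close>.\<close>
  define \<delta> where "\<delta> = Min (insert 1 (d ` {..<r}))"
  have \<delta>: "\<delta> > 0" "\<And>i. i < r \<Longrightarrow> \<delta> \<le> d i"
    unfolding \<delta>_def using d(1) by auto
  show "\<exists>d>0. \<forall>x\<in>topspace (Euclidean_space r). (\<forall>i<r. \<bar>x i - p i\<bar> < d) \<longrightarrow> P x"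
  proof (intro exI[of _ \<delta>] conjI ballI impI)
    fix x assume x: "x \<in> topspace (Euclidean_space r)" "\<forall>i<r. \<bar>x i - p i\<bar> < \<delta>"
    have "x i \<in> U i" for i
    proof (cases "i < r")
      case True
      then have "\<bar>x i - p i\<bar> < d i" using x(2) \<delta>(2)[of i] by force
      then show ?thesis by (rule d(2))
    next
      case False
      then have "x i = p i" using x(1) p by (simp add: topspace_Euclidean_space)
      then show ?thesis using U(2) by simp
    qed
    then have "x \<in> T" using U(3) by (auto simp: PiE_iff)
    then show "P x" using S(3) x(1) unfolding T(2) by (simp add: topspace_Euclidean_space)
  qed (rule \<delta>(1))
next
  assume "\<exists>d>0. \<forall>x\<in>topspace (Euclidean_space r). (\<forall>i<r. \<bar>x i - p i\<bar> < d) \<longrightarrow> P x"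
  then obtain d where d: "d > 0" "\<And>x. x \<in> topspace (Euclidean_space r) \<Longrightarrow> (\<forall>i<r. \<bar>x i - p i\<bar> < d) \<Longrightarrow> P x"
    by blast
  define U where "U = (\<lambda>i. if i < r then ball (p i) d else UNIV)"
  have "{i \<in> UNIV. U i \<noteq> topspace euclideanreal} \<subseteq> {..<r}" by (auto simp: U_def)
  then have "openin (powertop_real UNIV) (Pi\<^sub>E UNIV U)"
    unfolding openin_PiE_gen by (intro disjI2 conjI) (auto simp: U_def intro: finite_subset)
  then have "openin (Euclidean_space r) (Pi\<^sub>E UNIV U \<inter> {x. \<forall>i\<ge>r. x i = 0})"
    unfolding Euclidean_space_def openin_subtopology by blast
  moreover have "p \<in> Pi\<^sub>E UNIV U \<inter> {x. \<forall>i\<ge>r. x i = 0}"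
    using p d(1) by (auto simp: PiE_iff U_def topspace_Euclidean_space)
  moreover have "P x" if "x \<in> Pi\<^sub>E UNIV U \<inter> {x. \<forall>i\<ge>r. x i = 0}" for x
  proof (rule d(2))
    show "x \<in> topspace (Euclidean_space r)" using that by (simp add: topspace_Euclidean_space)
    show "\<forall>i<r. \<bar>x i - p i\<bar> < d"
    proof (intro allI impI)
      fix i assume "i < r"
      then have "x i \<in> ball (p i) d" using that by (auto simp: PiE_iff U_def dest: spec[of _ i] split: if_splits)
      then show "\<bar>x i - p i\<bar> < d" by (simp add: dist_real_def)
    qed
  qed
  ultimately show "eventually P (near r p)"
    unfolding eventually_nhdsin by blast
qed

text \<open>Closed, so that the corner with all offsets equal to \<open>\<rho>\<close> belongs to
  it; absolute convergence at that corner controls the series on the whole cube.\<close>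

definition cube :: "nat \<Rightarrow> (nat \<Rightarrow> real) \<Rightarrow> real \<Rightarrow> (nat \<Rightarrow> real) set" where
  "cube r p \<rho> = {x \<in> topspace (Euclidean_space r). \<forall>i<r. \<bar>x i - p i\<bar> \<le> \<rho>}"

lemma eventually_near_cube:
  assumes p: "p \<in> topspace (Euclidean_space r)"
  shows "eventually P (near r p) \<longleftrightarrow> (\<exists>\<rho>>0. \<forall>x\<in>cube r p \<rho>. P x)"
proof
  assume "eventually P (near r p)"
  then obtain d where d: "d > 0" "\<And>x. x \<in> topspace (Euclidean_space r) \<Longrightarrow> (\<forall>i<r. \<bar>x i - p i\<bar> < d) \<Longrightarrow> P x"
    unfolding eventually_near_iff[OF p] by blast
  have "P x" if "x \<in> cube r p (d / 2)" for x
    by (rule d(2)) (use that d(1) in \<open>force simp: cube_def\<close>)+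
  then show "\<exists>\<rho>>0. \<forall>x\<in>cube r p \<rho>. P x" using d(1) by (intro exI[of _ "d / 2"]) auto
next
  assume "\<exists>\<rho>>0. \<forall>x\<in>cube r p \<rho>. P x"
  then obtain \<rho> where \<rho>: "\<rho> > 0" "\<And>x. x \<in> cube r p \<rho> \<Longrightarrow> P x" by blast
  show "eventually P (near r p)"
    unfolding eventually_near_iff[OF p]
    by (intro exI[of _ \<rho>] conjI \<rho>(1) ballI impI \<rho>(2)) (auto simp: cube_def less_imp_le)
qed

definition monomial :: "nat \<Rightarrow> (nat \<Rightarrow> real) \<Rightarrow> (nat \<Rightarrow> nat) \<Rightarrow> real" where
  "monomial r v \<alpha> = (\<Prod>i<r. v i ^ \<alpha> i)"

definition total_degree :: "nat \<Rightarrow> (nat \<Rightarrow> nat) \<Rightarrow> nat" where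
  "total_degree r \<alpha> = (\<Sum>i<r. \<alpha> i)"

lemma monomial_add: "monomial r v (\<lambda>i. \<alpha> i + \<beta> i) = monomial r v \<alpha> * monomial r v \<beta>"
  by (simp add: monomial_def power_add prod.distrib)

lemma total_degree_add: "total_degree r (\<lambda>i. \<alpha> i + \<beta> i) = total_degree r \<alpha> + total_degree r \<beta>"
  by (simp add: total_degree_def sum.distrib)

lemma monomial_const: "monomial r (\<lambda>_. \<rho>) \<alpha> = \<rho> ^ total_degree r \<alpha>"
  by (simp add: monomial_def total_degree_def power_sum)

lemma abs_monomial_le:
  assumes "\<And>i. i < r \<Longrightarrow> \<bar>v i\<bar> \<le> \<rho>"
  shows "\<bar>monomial r v \<alpha>\<bar> \<le> \<rho> ^ total_degree r \<alpha>"
proof -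
  have "\<bar>monomial r v \<alpha>\<bar> = (\<Prod>i<r. \<bar>v i\<bar> ^ \<alpha> i)"
    by (simp add: monomial_def abs_prod power_abs)
  also have "\<dots> \<le> (\<Prod>i<r. \<rho> ^ \<alpha> i)"
    by (intro prod_mono conjI power_mono) (use assms in auto)
  also have "\<dots> = \<rho> ^ total_degree r \<alpha>"
    using monomial_const[of r \<rho> \<alpha>] by (simp add: monomial_def)
  finally show ?thesis .
qed

lemma zero_multi_index: "(\<lambda>_. 0) \<in> multi_indices r"
  by (simp add: multi_indices_def)

definition series_norm :: "nat \<Rightarrow> real \<Rightarrow> ((nat \<Rightarrow> nat) \<Rightarrow> complex) \<Rightarrow> real" where
  "series_norm r \<rho> c = (\<Sum>\<^sub>\<infinity>\<alpha>\<in>multi_indices r. norm (c \<alpha>) * \<rho> ^ total_degree r \<alpha>)"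

text \<open>Membership in the ball of radius \<open>B\<close> of the weighted \<open>l1\<close>
  algebra of power series around \<open>p\<close>. With the bound inside the predicate, the closure
  rules for sums, products and conjugates assemble the norm estimates automatically.\<close>

definition has_series :: "nat \<Rightarrow> (nat \<Rightarrow> real) \<Rightarrow> real \<Rightarrow> real \<Rightarrow> ((nat \<Rightarrow> real) \<Rightarrow> complex) \<Rightarrow> bool" where
  "has_series r p \<rho> B f \<longleftrightarrow> (\<exists>c.
     (\<lambda>\<alpha>. norm (c \<alpha>) * \<rho> ^ total_degree r \<alpha>) summable_on multi_indices r \<and> series_norm r \<rho> c \<le> B \<and>
     (\<forall>x\<in>cube r p \<rho>. ((\<lambda>\<alpha>. monomial r (\<lambda>i. x i - p i) \<alpha> *\<^sub>R c \<alpha>) has_sum f x) (multi_indices r)))"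

lemma has_series_mono: "has_series r p \<rho> B f \<Longrightarrow> B \<le> B' \<Longrightarrow> has_series r p \<rho> B' f"
  unfolding has_series_def by force

text \<open>Products, infinite sums and changes of coefficients all present a function as a sum of monomials over
  some other index set; grouping the terms by their exponent turns this into a power series.\<close>

lemma has_series_regroup:
  fixes w :: "'j \<Rightarrow> complex" and e :: "'j \<Rightarrow> nat \<Rightarrow> nat"
  assumes \<rho>: "\<rho> > 0" and e: "\<And>j. j \<in> J \<Longrightarrow> e j \<in> multi_indices r"
    and sm: "(\<lambda>j. norm (w j) * \<rho> ^ total_degree r (e j)) summable_on J"
    and le: "(\<Sum>\<^sub>\<infinity>j\<in>J. norm (w j) * \<rho> ^ total_degree r (e j)) \<le> B"
    and f: "\<And>x. x \<in> cube r p \<rho> \<Longrightarrow> f x = (\<Sum>\<^sub>\<infinity>j\<in>J. monomial r (\<lambda>i. x i - p i) (e j) *\<^sub>R w j)"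
  shows "has_series r p \<rho> B f"
proof -
  define F where "F \<alpha> = {j \<in> J. e j = \<alpha>}" for \<alpha>
  define g where "g j = norm (w j) * \<rho> ^ total_degree r (e j)" for j
  define c where "c \<alpha> = (\<Sum>\<^sub>\<infinity>j\<in>F \<alpha>. w j)" for \<alpha>
  \<comment> \<open>\<open>J\<close> is partitioned into the fibres of \<open>e\<close>, and summing
    first over a fibre and then over the exponents is legitimate by absolute convergence.\<close>
  have bij: "bij_betw snd (Sigma (multi_indices r) F) J"
    by (rule bij_betwI[where g = "\<lambda>j. (e j, j)"]) (use e in \<open>auto simp: F_def\<close>)
  have gS: "(\<lambda>z. g (snd z)) summable_on Sigma (multi_indices r) F"
    using sm unfolding g_def[symmetric] by (subst summable_on_reindex_bij_betw[OF bij])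
  have gS_sum: "((\<lambda>z. g (snd z)) has_sum infsum g J) (Sigma (multi_indices r) F)"
    using sm unfolding g_def[symmetric] by (subst has_sum_reindex_bij_betw[OF bij]) (rule has_sum_infsum)
  have gF: "g summable_on F \<alpha>" for \<alpha>
    using sm unfolding g_def[symmetric] by (rule summable_on_subset_banach) (auto simp: F_def)
  have G: "((\<lambda>\<alpha>. \<Sum>\<^sub>\<infinity>j\<in>F \<alpha>. g j) has_sum infsum g J) (multi_indices r)"
    by (rule has_sum_SigmaD[OF gS_sum]) (use gF in \<open>auto intro: has_sum_infsum\<close>)
  have nw: "(\<lambda>j. norm (w j)) summable_on F \<alpha>" for \<alpha>
  proof -
    have "(\<lambda>j. g j * inverse (\<rho> ^ total_degree r \<alpha>)) summable_on F \<alpha>"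
      by (rule summable_on_cmult_left) (rule gF)
    then show ?thesis
      by (rule summable_on_cong[THEN iffD1, rotated]) (use \<rho> in \<open>auto simp: g_def F_def\<close>)
  qed
  have wF: "w summable_on F \<alpha>" for \<alpha>
    using nw by (rule abs_summable_summable)
  have c_le: "norm (c \<alpha>) * \<rho> ^ total_degree r \<alpha> \<le> (\<Sum>\<^sub>\<infinity>j\<in>F \<alpha>. g j)" for \<alpha>
  proof -
    have "norm (c \<alpha>) * \<rho> ^ total_degree r \<alpha> \<le> (\<Sum>\<^sub>\<infinity>j\<in>F \<alpha>. norm (w j)) * \<rho> ^ total_degree r \<alpha>"
      unfolding c_def by (intro mult_right_mono norm_infsum_bound nw) (use \<rho> in auto)
    also have "\<dots> = (\<Sum>\<^sub>\<infinity>j\<in>F \<alpha>. norm (w j) * \<rho> ^ total_degree r \<alpha>)"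
      by (rule infsum_cmult_left[symmetric]) (rule nw)
    also have "\<dots> = (\<Sum>\<^sub>\<infinity>j\<in>F \<alpha>. g j)"
      by (rule infsum_cong) (auto simp: g_def F_def)
    finally show ?thesis .
  qed
  have sc: "(\<lambda>\<alpha>. norm (c \<alpha>) * \<rho> ^ total_degree r \<alpha>) summable_on multi_indices r"
    by (rule summable_on_comparison_test[OF has_sum_imp_summable[OF G] c_le]) (use \<rho> in auto)
  have "series_norm r \<rho> c \<le> infsum g J"
    unfolding series_norm_def infsumI[OF G, symmetric]
    by (rule infsum_mono[OF sc has_sum_imp_summable[OF G] c_le])
  then have "series_norm r \<rho> c \<le> B" using le unfolding g_def by simp
  moreover have "((\<lambda>\<alpha>. monomial r (\<lambda>i. x i - p i) \<alpha> *\<^sub>R c \<alpha>) has_sum f x) (multi_indices r)" if x: "x \<in> cube r p \<rho>" for x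
  proof -
    let ?h = "\<lambda>j. monomial r (\<lambda>i. x i - p i) (e j) *\<^sub>R w j"
    have le: "norm (?h j) \<le> g j" for j
      using abs_monomial_le[of r "\<lambda>i. x i - p i" \<rho> "e j"] x
      by (auto simp: g_def cube_def mult.commute[of "norm (w j)"] intro: mult_right_mono)
    have "g summable_on J"
      using sm unfolding g_def .
    then have "(\<lambda>j. norm (?h j)) summable_on J"
      by (rule summable_on_comparison_test) (use le in auto)
    then have "(?h has_sum f x) J"
      unfolding f[OF x] by (rule has_sum_infsum[OF abs_summable_summable])
    then have "((\<lambda>z. ?h (snd z)) has_sum f x) (Sigma (multi_indices r) F)"
      by (subst has_sum_reindex_bij_betw[OF bij])
    then show ?thesis
    proof (rule has_sum_SigmaD)
      fix \<alpha>
      have "((\<lambda>j. monomial r (\<lambda>i. x i - p i) \<alpha> *\<^sub>R w j) has_sum monomial r (\<lambda>i. x i - p i) \<alpha> *\<^sub>R c \<alpha>) (F \<alpha>)"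
        unfolding c_def by (intro has_sum_bounded_linear[OF bounded_linear_scaleR_right] has_sum_infsum wF)
      then show "((\<lambda>j. ?h (snd (\<alpha>, j))) has_sum monomial r (\<lambda>i. x i - p i) \<alpha> *\<^sub>R c \<alpha>) (F \<alpha>)"
        by (rule has_sum_cong[THEN iffD1, rotated]) (auto simp: F_def)
    qed
  qed
  ultimately show ?thesis unfolding has_series_def using sc by blast
qed

lemma has_series_const:
  assumes "\<rho> > 0"
  shows "has_series r p \<rho> (norm z) (\<lambda>_. z)"
  by (rule has_series_regroup[where J = "{()}" and w = "\<lambda>_. z" and e = "\<lambda>_ _. 0"])
    (use assms zero_multi_index in \<open>auto simp: total_degree_def monomial_def\<close>)

lemma has_series_coordinate:
  assumes "\<rho> > 0" "i < r"
  shows "has_series r p \<rho> (\<bar>p i\<bar> + \<rho>) (\<lambda>x. complex_of_real (x i))"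
proof (rule has_series_regroup[where J = "UNIV" and w = "\<lambda>b. if b then 1 else complex_of_real (p i)"
      and e = "\<lambda>b j. if b \<and> j = i then 1 else 0"])
  have deg: "total_degree r (\<lambda>j. if j = i then 1 else 0) = 1"
    using assms by (simp add: total_degree_def)
  have mon: "monomial r v (\<lambda>j. if j = i then 1 else 0) = v i" for v
  proof -
    have "monomial r v (\<lambda>j. if j = i then 1 else 0) = (\<Prod>j<r. if j = i then v j else 1)"
      unfolding monomial_def by (intro prod.cong) auto
    then show ?thesis using assms by simp
  qed
  have z: "total_degree r (\<lambda>_. 0) = 0" "monomial r v (\<lambda>_. 0) = 1" for v
    by (simp_all add: total_degree_def monomial_def)
  show "(\<Sum>\<^sub>\<infinity>b\<in>UNIV. norm (if b then 1 else complex_of_real (p i)) * \<rho> ^ total_degree r (\<lambda>j. if b \<and> j = i then 1 else 0)) \<le> \<bar>p i\<bar> + \<rho>"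
    by (simp add: UNIV_bool deg z)
  show "complex_of_real (x i) = (\<Sum>\<^sub>\<infinity>b\<in>UNIV. monomial r (\<lambda>i. x i - p i) (\<lambda>j. if b \<and> j = i then 1 else 0) *\<^sub>R (if b then 1 else complex_of_real (p i)))" for x
    by (simp add: UNIV_bool mon z scaleR_conv_of_real)
qed (use assms in \<open>auto simp: multi_indices_def\<close>)

lemma has_series_add:
  assumes "has_series r p \<rho> B f" "has_series r p \<rho> B' g" "\<rho> > 0"
  shows "has_series r p \<rho> (B + B') (\<lambda>x. f x + g x)"
proof -
  let ?N = "\<lambda>c \<alpha>. norm (c \<alpha> :: complex) * \<rho> ^ total_degree r \<alpha>"
  from assms(1) obtain c where c: "?N c summable_on multi_indices r" "series_norm r \<rho> c \<le> B"
    "\<And>x. x \<in> cube r p \<rho> \<Longrightarrow> ((\<lambda>\<alpha>. monomial r (\<lambda>i. x i - p i) \<alpha> *\<^sub>R c \<alpha>) has_sum f x) (multi_indices r)"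
    unfolding has_series_def by blast
  from assms(2) obtain d where d: "?N d summable_on multi_indices r" "series_norm r \<rho> d \<le> B'"
    "\<And>x. x \<in> cube r p \<rho> \<Longrightarrow> ((\<lambda>\<alpha>. monomial r (\<lambda>i. x i - p i) \<alpha> *\<^sub>R d \<alpha>) has_sum g x) (multi_indices r)"
    unfolding has_series_def by blast
  have le: "?N (\<lambda>\<alpha>. c \<alpha> + d \<alpha>) \<alpha> \<le> ?N c \<alpha> + ?N d \<alpha>" for \<alpha>
    using assms(3) by (simp add: distrib_right[symmetric] norm_triangle_ineq mult_right_mono)
  have s: "(\<lambda>\<alpha>. ?N c \<alpha> + ?N d \<alpha>) summable_on multi_indices r"
    by (rule summable_on_add[OF c(1) d(1)])
  have s': "?N (\<lambda>\<alpha>. c \<alpha> + d \<alpha>) summable_on multi_indices r"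
    by (rule summable_on_comparison_test[OF s le]) (use assms(3) in auto)
  have "series_norm r \<rho> (\<lambda>\<alpha>. c \<alpha> + d \<alpha>) \<le> series_norm r \<rho> c + series_norm r \<rho> d"
    unfolding series_norm_def infsum_add[OF c(1) d(1), symmetric] by (rule infsum_mono[OF s' s le])
  moreover have "((\<lambda>\<alpha>. monomial r (\<lambda>i. x i - p i) \<alpha> *\<^sub>R (c \<alpha> + d \<alpha>)) has_sum (f x + g x)) (multi_indices r)"
    if "x \<in> cube r p \<rho>" for x
    using has_sum_add[OF c(3)[OF that] d(3)[OF that]] by (simp add: scaleR_add_right)
  ultimately show ?thesis
    unfolding has_series_def using s' c(2) d(2) by (intro exI[of _ "\<lambda>\<alpha>. c \<alpha> + d \<alpha>"]) auto
qed

lemma has_series_cnj: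
  assumes "has_series r p \<rho> B f"
  shows "has_series r p \<rho> B (\<lambda>x. cnj (f x))"
proof -
  from assms obtain c where c: "(\<lambda>\<alpha>. norm (c \<alpha>) * \<rho> ^ total_degree r \<alpha>) summable_on multi_indices r" "series_norm r \<rho> c \<le> B"
    "\<And>x. x \<in> cube r p \<rho> \<Longrightarrow> ((\<lambda>\<alpha>. monomial r (\<lambda>i. x i - p i) \<alpha> *\<^sub>R c \<alpha>) has_sum f x) (multi_indices r)"
    unfolding has_series_def by blast
  have "((\<lambda>\<alpha>. monomial r (\<lambda>i. x i - p i) \<alpha> *\<^sub>R cnj (c \<alpha>)) has_sum cnj (f x)) (multi_indices r)" if "x \<in> cube r p \<rho>" for x
    using has_sum_bounded_linear[OF bounded_linear_cnj c(3)[OF that]] by simp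
  with c show ?thesis
    unfolding has_series_def series_norm_def by (intro exI[of _ "\<lambda>\<alpha>. cnj (c \<alpha>)"]) auto
qed

text \<open>The Cauchy product: terms are indexed by pairs of exponents, exponents add, and the
  double sum of norms factors, which makes the weighted norm submultiplicative.\<close>

lemma has_series_mult:
  assumes "has_series r p \<rho> B f" "has_series r p \<rho> B' g" "\<rho> > 0"
  shows "has_series r p \<rho> (B * B') (\<lambda>x. f x * g x)"
proof -
  let ?N = "\<lambda>c \<alpha>. norm (c \<alpha> :: complex) * \<rho> ^ total_degree r \<alpha>"
  let ?I = "multi_indices r"
  from assms(1) obtain c where c: "?N c summable_on ?I" "series_norm r \<rho> c \<le> B"
    "\<And>x. x \<in> cube r p \<rho> \<Longrightarrow> ((\<lambda>\<alpha>. monomial r (\<lambda>i. x i - p i) \<alpha> *\<^sub>R c \<alpha>) has_sum f x) ?I"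
    unfolding has_series_def by blast
  from assms(2) obtain d where d: "?N d summable_on ?I" "series_norm r \<rho> d \<le> B'"
    "\<And>x. x \<in> cube r p \<rho> \<Longrightarrow> ((\<lambda>\<alpha>. monomial r (\<lambda>i. x i - p i) \<alpha> *\<^sub>R d \<alpha>) has_sum g x) ?I"
    unfolding has_series_def by blast
  have nn: "0 \<le> ?N c \<alpha>" "0 \<le> ?N d \<alpha>" for \<alpha> using assms(3) by simp_all
  have nonneg: "0 \<le> series_norm r \<rho> c" "0 \<le> series_norm r \<rho> d"
    unfolding series_norm_def using nn by (auto intro: infsum_nonneg)
  have inner: "((\<lambda>\<beta>. ?N c \<alpha> * ?N d \<beta>) has_sum ?N c \<alpha> * series_norm r \<rho> d) ?I" for \<alpha>
    unfolding series_norm_def by (intro has_sum_cmult_right has_sum_infsum d(1))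
  have outer: "((\<lambda>\<alpha>. ?N c \<alpha> * series_norm r \<rho> d) has_sum series_norm r \<rho> c * series_norm r \<rho> d) ?I"
    by (intro has_sum_cmult_left) (unfold series_norm_def, rule has_sum_infsum[OF c(1)])
  have prod_sm: "(\<lambda>(\<alpha>, \<beta>). ?N c \<alpha> * ?N d \<beta>) summable_on ?I \<times> ?I"
    by (rule summable_on_SigmaI[where g = "\<lambda>\<alpha>. ?N c \<alpha> * series_norm r \<rho> d"])
      (use inner outer nn in \<open>auto intro: has_sum_imp_summable\<close>)
  have prod_sum: "((\<lambda>(\<alpha>, \<beta>). ?N c \<alpha> * ?N d \<beta>) has_sum series_norm r \<rho> c * series_norm r \<rho> d) (?I \<times> ?I)"
    by (rule has_sum_SigmaI[OF _ outer prod_sm]) (use inner in auto)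
  have norm_eq: "(\<lambda>z. norm (c (fst z) * d (snd z)) * \<rho> ^ total_degree r (\<lambda>i. fst z i + snd z i)) = (\<lambda>(\<alpha>, \<beta>). ?N c \<alpha> * ?N d \<beta>)"
    by (auto simp: fun_eq_iff total_degree_add power_add norm_mult)
  show ?thesis
  proof (rule has_series_regroup[where J = "?I \<times> ?I" and w = "\<lambda>z. c (fst z) * d (snd z)" and e = "\<lambda>z i. fst z i + snd z i"])
    show "(\<lambda>i. fst z i + snd z i) \<in> ?I" if "z \<in> ?I \<times> ?I" for z
      using that by (auto simp: multi_indices_def)
    show "(\<lambda>z. norm (c (fst z) * d (snd z)) * \<rho> ^ total_degree r (\<lambda>i. fst z i + snd z i)) summable_on ?I \<times> ?I"
      unfolding norm_eq by (rule prod_sm)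
    show "(\<Sum>\<^sub>\<infinity>z\<in>?I \<times> ?I. norm (c (fst z) * d (snd z)) * \<rho> ^ total_degree r (\<lambda>i. fst z i + snd z i)) \<le> B * B'"
      unfolding norm_eq infsumI[OF prod_sum] using nonneg c(2) d(2) by (intro mult_mono) auto
    show "f x * g x = (\<Sum>\<^sub>\<infinity>z\<in>?I \<times> ?I. monomial r (\<lambda>i. x i - p i) (\<lambda>i. fst z i + snd z i) *\<^sub>R (c (fst z) * d (snd z)))"
      if x: "x \<in> cube r p \<rho>" for x
    proof (rule sym, rule infsumI)
      let ?m = "monomial r (\<lambda>i. x i - p i)"
      have eq: "(\<lambda>z. ?m (\<lambda>i. fst z i + snd z i) *\<^sub>R (c (fst z) * d (snd z))) = (\<lambda>(\<alpha>, \<beta>). (?m \<alpha> *\<^sub>R c \<alpha>) * (?m \<beta> *\<^sub>R d \<beta>))"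
        by (auto simp: fun_eq_iff monomial_add)
      have m: "\<bar>?m \<alpha>\<bar> \<le> \<rho> ^ total_degree r \<alpha>" for \<alpha>
        by (rule abs_monomial_le) (use x in \<open>auto simp: cube_def\<close>)
      have le: "norm ((?m \<alpha> *\<^sub>R c \<alpha>) * (?m \<beta> *\<^sub>R d \<beta>)) \<le> ?N c \<alpha> * ?N d \<beta>" for \<alpha> \<beta>
      proof -
        have "norm (?m \<alpha> *\<^sub>R c \<alpha>) \<le> ?N c \<alpha>" "norm (?m \<beta> *\<^sub>R d \<beta>) \<le> ?N d \<beta>"
          using m by (simp_all add: mult.commute[of "norm _"] mult_right_mono)
        then show ?thesis unfolding norm_mult by (intro mult_mono) (use nn in auto)
      qed
      have "(\<lambda>z. norm (case z of (\<alpha>, \<beta>) \<Rightarrow> (?m \<alpha> *\<^sub>R c \<alpha>) * (?m \<beta> *\<^sub>R d \<beta>))) summable_on ?I \<times> ?I"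
        by (rule summable_on_comparison_test[OF prod_sm]) (use le in auto)
      then have sm: "(\<lambda>(\<alpha>, \<beta>). (?m \<alpha> *\<^sub>R c \<alpha>) * (?m \<beta> *\<^sub>R d \<beta>)) summable_on ?I \<times> ?I"
        by (rule abs_summable_summable)
      show "((\<lambda>z. ?m (\<lambda>i. fst z i + snd z i) *\<^sub>R (c (fst z) * d (snd z))) has_sum f x * g x) (?I \<times> ?I)"
        unfolding eq
      proof (rule has_sum_SigmaI[where g = "\<lambda>\<alpha>. (?m \<alpha> *\<^sub>R c \<alpha>) * g x"])
        show "((\<lambda>\<beta>. case (\<alpha>, \<beta>) of (\<alpha>, \<beta>) \<Rightarrow> (?m \<alpha> *\<^sub>R c \<alpha>) * (?m \<beta> *\<^sub>R d \<beta>)) has_sum (?m \<alpha> *\<^sub>R c \<alpha>) * g x) ?I" for \<alpha>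
          unfolding prod.case by (intro has_sum_cmult_right d(3) x)
        show "((\<lambda>\<alpha>. (?m \<alpha> *\<^sub>R c \<alpha>) * g x) has_sum f x * g x) ?I"
          by (intro has_sum_cmult_left c(3) x)
      qed (rule sm)
    qed
  qed (rule assms(3))
qed

text \<open>Completeness of the algebra in the form that the Picard iteration uses: the increments
  have summable norms.\<close>

lemma has_series_suminf:
  fixes f :: "nat \<Rightarrow> (nat \<Rightarrow> real) \<Rightarrow> complex"
  assumes f: "\<And>k. has_series r p \<rho> (B k) (f k)" and B: "summable B" and \<rho>: "\<rho> > 0"
  shows "has_series r p \<rho> (suminf B) (\<lambda>x. \<Sum>k. f k x)"
proof -
  let ?N = "\<lambda>c \<alpha>. norm (c \<alpha> :: complex) * \<rho> ^ total_degree r \<alpha>"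
  let ?I = "multi_indices r"
  from f obtain c where c: "\<And>k. ?N (c k) summable_on ?I" "\<And>k. series_norm r \<rho> (c k) \<le> B k"
    "\<And>k x. x \<in> cube r p \<rho> \<Longrightarrow> ((\<lambda>\<alpha>. monomial r (\<lambda>i. x i - p i) \<alpha> *\<^sub>R c k \<alpha>) has_sum f k x) ?I"
    unfolding has_series_def by metis
  have nn: "0 \<le> ?N (c k) \<alpha>" for k \<alpha> using \<rho> by simp
  have sn: "0 \<le> series_norm r \<rho> (c k)" for k
    unfolding series_norm_def using nn by (auto intro: infsum_nonneg)
  have inner: "((\<lambda>\<alpha>. ?N (c k) \<alpha>) has_sum series_norm r \<rho> (c k)) ?I" for k
    unfolding series_norm_def by (rule has_sum_infsum[OF c(1)])
  have sB: "summable (\<lambda>k. series_norm r \<rho> (c k))"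
    by (rule summable_comparison_test'[OF B, of 0]) (use c(2) sn in auto)
  have outer: "((\<lambda>k. series_norm r \<rho> (c k)) has_sum (\<Sum>k. series_norm r \<rho> (c k))) UNIV"
    by (rule norm_summable_imp_has_sum) (use sB sn in \<open>auto intro: summable_sums\<close>)
  have sm: "(\<lambda>(k, \<alpha>). ?N (c k) \<alpha>) summable_on UNIV \<times> ?I"
    by (rule summable_on_SigmaI[where g = "\<lambda>k. series_norm r \<rho> (c k)"])
      (use inner outer nn in \<open>auto intro: has_sum_imp_summable\<close>)
  have tot: "((\<lambda>(k, \<alpha>). ?N (c k) \<alpha>) has_sum (\<Sum>k. series_norm r \<rho> (c k))) (UNIV \<times> ?I)"
    by (rule has_sum_SigmaI[OF _ outer sm]) (use inner in auto)
  have norm_eq: "(\<lambda>z. norm (c (fst z) (snd z)) * \<rho> ^ total_degree r (snd z)) = (\<lambda>(k, \<alpha>). ?N (c k) \<alpha>)"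
    by (auto simp: fun_eq_iff)
  show ?thesis
  proof (rule has_series_regroup[where J = "UNIV \<times> ?I" and w = "\<lambda>z. c (fst z) (snd z)" and e = snd])
    show "(\<lambda>z. norm (c (fst z) (snd z)) * \<rho> ^ total_degree r (snd z)) summable_on UNIV \<times> ?I"
      unfolding norm_eq by (rule sm)
    show "(\<Sum>\<^sub>\<infinity>z\<in>UNIV \<times> ?I. norm (c (fst z) (snd z)) * \<rho> ^ total_degree r (snd z)) \<le> suminf B"
      unfolding norm_eq infsumI[OF tot] by (rule suminf_le[OF c(2) sB B])
    show "(\<Sum>k. f k x) = (\<Sum>\<^sub>\<infinity>z\<in>UNIV \<times> ?I. monomial r (\<lambda>i. x i - p i) (snd z) *\<^sub>R c (fst z) (snd z))"
      if x: "x \<in> cube r p \<rho>" for x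
    proof (rule sym, rule infsumI)
      let ?m = "monomial r (\<lambda>i. x i - p i)"
      have m: "\<bar>?m \<alpha>\<bar> \<le> \<rho> ^ total_degree r \<alpha>" for \<alpha>
        by (rule abs_monomial_le) (use x in \<open>auto simp: cube_def\<close>)
      have le: "norm (?m \<alpha> *\<^sub>R c k \<alpha>) \<le> ?N (c k) \<alpha>" for k \<alpha>
        using m by (simp add: mult.commute[of "norm _"] mult_right_mono)
      have eq: "(\<lambda>z. ?m (snd z) *\<^sub>R c (fst z) (snd z)) = (\<lambda>(k, \<alpha>). ?m \<alpha> *\<^sub>R c k \<alpha>)"
        by (auto simp: fun_eq_iff)
      have "(\<lambda>z. norm (case z of (k, \<alpha>) \<Rightarrow> ?m \<alpha> *\<^sub>R c k \<alpha>)) summable_on UNIV \<times> ?I"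
        by (rule summable_on_comparison_test[OF sm]) (use le in auto)
      then have sm': "(\<lambda>(k, \<alpha>). ?m \<alpha> *\<^sub>R c k \<alpha>) summable_on UNIV \<times> ?I"
        by (rule abs_summable_summable)
      have "norm (f k x) \<le> series_norm r \<rho> (c k)" for k
        by (rule norm_infsum_le[OF c(3)[OF x] inner le])
      then have s: "summable (\<lambda>k. norm (f k x))"
        by (intro summable_comparison_test'[OF sB, of 0]) auto
      have "((\<lambda>k. f k x) has_sum (\<Sum>k. f k x)) UNIV"
        by (rule norm_summable_imp_has_sum[OF s summable_sums[OF summable_norm_cancel[OF s]]])
      then show "((\<lambda>z. ?m (snd z) *\<^sub>R c (fst z) (snd z)) has_sum (\<Sum>k. f k x)) (UNIV \<times> ?I)"
        unfolding eq by (rule has_sum_SigmaI[rotated, OF _ sm']) (use c(3) x in auto)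
    qed
  qed (use \<rho> in auto)
qed

section \<open>From analytic germs to series with norm bounds and back\<close>

lemma real_analytic_at_monomial:
  "real_analytic_at r f p \<longleftrightarrow> (\<exists>c. \<forall>\<^sub>F x in near r p.
     ((\<lambda>\<alpha>. monomial r (\<lambda>i. x i - p i) \<alpha> *\<^sub>R c \<alpha>) has_sum f x) (multi_indices r))"
  by (simp add: real_analytic_at_def monomial_def)

lemma has_series_imp_analytic:
  assumes "has_series r p \<rho> B f" "\<rho> > 0"
  shows "real_analytic_at r f p"
proof (cases "p \<in> topspace (Euclidean_space r)")
  case True
  then show ?thesis
    using assms unfolding real_analytic_at_monomial has_series_def eventually_near_cube[OF True] by blast
qed (simp add: real_analytic_at_def nhdsin_degenerate)

lemma real_analytic_at_linear:
  assumes "bounded_linear L" "real_analytic_at r f p"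
  shows "real_analytic_at r (\<lambda>x. L (f x)) p"
proof -
  interpret L: bounded_linear L by fact
  obtain c where c: "\<forall>\<^sub>F x in near r p. ((\<lambda>\<alpha>. monomial r (\<lambda>i. x i - p i) \<alpha> *\<^sub>R c \<alpha>) has_sum f x) (multi_indices r)"
    using assms(2) unfolding real_analytic_at_monomial by blast
  then have "\<forall>\<^sub>F x in near r p. ((\<lambda>\<alpha>. monomial r (\<lambda>i. x i - p i) \<alpha> *\<^sub>R L (c \<alpha>)) has_sum L (f x)) (multi_indices r)"
    by eventually_elim (use has_sum_bounded_linear[OF assms(1)] in \<open>simp flip: L.scaleR\<close>)
  then show ?thesis unfolding real_analytic_at_monomial by (rule exI[of _ "\<lambda>\<alpha>. L (c \<alpha>)"])
qed

lemma has_series_bound: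
  assumes "has_series r p \<rho> B f" "x \<in> cube r p \<rho>"
  shows "norm (f x) \<le> B"
proof -
  from assms(1) obtain c where c: "(\<lambda>\<alpha>. norm (c \<alpha>) * \<rho> ^ total_degree r \<alpha>) summable_on multi_indices r" "series_norm r \<rho> c \<le> B"
    "((\<lambda>\<alpha>. monomial r (\<lambda>i. x i - p i) \<alpha> *\<^sub>R c \<alpha>) has_sum f x) (multi_indices r)"
    using assms(2) unfolding has_series_def by blast
  have "\<bar>monomial r (\<lambda>i. x i - p i) \<alpha>\<bar> \<le> \<rho> ^ total_degree r \<alpha>" for \<alpha>
    by (rule abs_monomial_le) (use assms(2) in \<open>auto simp: cube_def\<close>)
  then have "norm (monomial r (\<lambda>i. x i - p i) \<alpha> *\<^sub>R c \<alpha>) \<le> norm (c \<alpha>) * \<rho> ^ total_degree r \<alpha>" for \<alpha>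
    by (simp add: mult.commute[of "norm _"] mult_right_mono)
  then have "norm (f x) \<le> series_norm r \<rho> c"
    unfolding series_norm_def by (intro norm_infsum_le[OF c(3) has_sum_infsum[OF c(1)]])
  then show ?thesis using c(2) by simp
qed

lemma total_degree_eq_0_iff: "\<alpha> \<in> multi_indices r \<Longrightarrow> total_degree r \<alpha> = 0 \<longleftrightarrow> \<alpha> = (\<lambda>_. 0)"
  by (auto simp: total_degree_def multi_indices_def fun_eq_iff not_less[symmetric])

text \<open>The sum is unconditional, so convergence at the corner \<open>q\<close> is already
  absolute, and this is the weighted summability for the radius \<open>R\<close>. Evaluation at
  \<open>p\<close> identifies the constant coefficient.\<close>

lemma analytic_expansion:
  fixes f :: "(nat \<Rightarrow> real) \<Rightarrow> complex"
  assumes f: "real_analytic_at r f p" and p: "p \<in> topspace (Euclidean_space r)"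
  obtains c R where "R > 0" "(\<lambda>\<alpha>. norm (c \<alpha>) * R ^ total_degree r \<alpha>) summable_on multi_indices r" "c (\<lambda>_. 0) = f p"
    "\<And>x. x \<in> cube r p R \<Longrightarrow> ((\<lambda>\<alpha>. monomial r (\<lambda>i. x i - p i) \<alpha> *\<^sub>R c \<alpha>) has_sum f x) (multi_indices r)"
proof -
  from f obtain c R where R: "R > 0" and c:
    "\<And>x. x \<in> cube r p R \<Longrightarrow> ((\<lambda>\<alpha>. monomial r (\<lambda>i. x i - p i) \<alpha> *\<^sub>R c \<alpha>) has_sum f x) (multi_indices r)"
    unfolding real_analytic_at_monomial eventually_near_cube[OF p] by blast
  define q where "q = (\<lambda>i. if i < r then p i + R else 0)"
  have "q \<in> cube r p R" using R by (auto simp: q_def cube_def topspace_Euclidean_space)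
  from has_sum_imp_summable[OF c[OF this]]
  have "(\<lambda>\<alpha>. norm (monomial r (\<lambda>i. q i - p i) \<alpha> *\<^sub>R c \<alpha>)) summable_on multi_indices r"
    by (simp add: summable_on_iff_abs_summable_on_complex)
  moreover have "monomial r (\<lambda>i. q i - p i) \<alpha> = R ^ total_degree r \<alpha>" for \<alpha>
    using monomial_const[of r R \<alpha>] by (simp add: monomial_def q_def)
  ultimately have sm: "(\<lambda>\<alpha>. norm (c \<alpha>) * R ^ total_degree r \<alpha>) summable_on multi_indices r"
    using R by (simp add: mult.commute)
  have "p \<in> cube r p R" using p R by (auto simp: cube_def)
  note c[OF this]
  moreover have "((\<lambda>\<alpha>. monomial r (\<lambda>i. p i - p i) \<alpha> *\<^sub>R c \<alpha>) has_sum c (\<lambda>_. 0)) (multi_indices r)"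
  proof (rule has_sum_finite_neutralI[where B = "{\<lambda>_. 0}"])
    fix \<alpha> assume "\<alpha> \<in> multi_indices r - {\<lambda>_. 0}"
    then have "total_degree r \<alpha> \<noteq> 0" using total_degree_eq_0_iff by blast
    moreover have "\<bar>monomial r (\<lambda>i. p i - p i) \<alpha>\<bar> \<le> 0 ^ total_degree r \<alpha>"
      by (rule abs_monomial_le) simp
    ultimately show "monomial r (\<lambda>i. p i - p i) \<alpha> *\<^sub>R c \<alpha> = 0" by (cases "total_degree r \<alpha>") auto
  qed (auto simp: zero_multi_index monomial_def)
  ultimately have "c (\<lambda>_. 0) = f p" by (rule has_sum_unique[rotated])
  then show ?thesis using that R sm c by blast
qed

text \<open>Shrinking the radius from \<open>R\<close> to \<open>\<rho>\<close> multiplies each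
  nonconstant term by at most \<open>\<rho> / R\<close>, so the norm comes as close to
  \<open>norm (f p)\<close> as desired. All smaller radii are included, so that finitely many matrix
  entries can share one.\<close>

lemma analytic_imp_has_series:
  fixes f :: "(nat \<Rightarrow> real) \<Rightarrow> complex"
  assumes f: "real_analytic_at r f p" and p: "p \<in> topspace (Euclidean_space r)" and \<eta>: "\<eta> > 0"
  shows "\<exists>\<rho>0>0. \<forall>\<rho>. 0 < \<rho> \<and> \<rho> \<le> \<rho>0 \<longrightarrow> has_series r p \<rho> (norm (f p) + \<eta>) f"
proof -
  obtain R c where R: "R > 0" and sm: "(\<lambda>\<alpha>. norm (c \<alpha>) * R ^ total_degree r \<alpha>) summable_on multi_indices r"
    and c0: "c (\<lambda>_. 0) = f p"
    and c: "\<And>x. x \<in> cube r p R \<Longrightarrow> ((\<lambda>\<alpha>. monomial r (\<lambda>i. x i - p i) \<alpha> *\<^sub>R c \<alpha>) has_sum f x) (multi_indices r)"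
    by (rule analytic_expansion[OF f p]) (rule that, assumption+)
  define K where "K = series_norm r R c"
  have K: "K \<ge> 0" unfolding K_def series_norm_def by (rule infsum_nonneg) (use R in auto)
  \<comment> \<open>Chosen so that \<open>\<rho> / R * K \<le> \<eta>\<close>; the summand 1 avoids
    division by zero for \<open>K = 0\<close>.\<close>
  define \<rho>0 where "\<rho>0 = min R (R * \<eta> / (K + 1))"
  have "\<rho>0 > 0" using R \<eta> K by (simp add: \<rho>0_def)
  moreover have "has_series r p \<rho> (norm (f p) + \<eta>) f" if \<rho>: "0 < \<rho>" "\<rho> \<le> \<rho>0" for \<rho>
  proof -
    have \<rho>R: "\<rho> \<le> R" using \<rho> by (simp add: \<rho>0_def)
    let ?g = "\<lambda>\<alpha>. (if \<alpha> = (\<lambda>_. 0) then norm (c (\<lambda>_. 0)) else 0) + \<rho> / R * (norm (c \<alpha>) * R ^ total_degree r \<alpha>)"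
    have le: "norm (c \<alpha>) * \<rho> ^ total_degree r \<alpha> \<le> ?g \<alpha>" if \<alpha>: "\<alpha> \<in> multi_indices r" for \<alpha>
    proof (cases "\<alpha> = (\<lambda>_. 0)")
      case True
      then show ?thesis using \<rho> R by (simp add: total_degree_def)
    next
      case False
      then have "total_degree r \<alpha> \<noteq> 0" using total_degree_eq_0_iff[OF \<alpha>] by simp
      then obtain d where d: "total_degree r \<alpha> = Suc d" by (cases "total_degree r \<alpha>") auto
      have "\<rho> ^ total_degree r \<alpha> \<le> \<rho> / R * R ^ total_degree r \<alpha>"
        unfolding d using \<rho> \<rho>R R power_mono[of \<rho> R d] by simp
      from mult_left_mono[OF this, of "norm (c \<alpha>)"] False show ?thesis by (simp add: mult_ac)
    qed
    have g: "(?g has_sum (norm (c (\<lambda>_. 0)) + \<rho> / R * K)) (multi_indices r)"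
      unfolding K_def series_norm_def
      by (intro has_sum_add has_sum_cmult_right has_sum_infsum sm has_sum_finite_neutralI[where B = "{\<lambda>_. 0}"])
        (auto simp: zero_multi_index)
    have s: "(\<lambda>\<alpha>. norm (c \<alpha>) * \<rho> ^ total_degree r \<alpha>) summable_on multi_indices r"
      by (rule summable_on_comparison_test[OF has_sum_imp_summable[OF g] le]) (use \<rho> in auto)
    have "series_norm r \<rho> c \<le> norm (c (\<lambda>_. 0)) + \<rho> / R * K"
      unfolding series_norm_def infsumI[OF g, symmetric]
      by (rule infsum_mono[OF s has_sum_imp_summable[OF g] le])
    also have "\<rho> / R * K \<le> \<eta>"
    proof -
      have "\<rho> * (K + 1) \<le> R * \<eta>" using \<rho>(2) K by (simp add: \<rho>0_def pos_le_divide_eq)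
      then have "\<rho> * K \<le> R * \<eta>" using \<rho>(1) by (simp add: distrib_left)
      then show ?thesis using R by (simp add: pos_divide_le_eq mult.commute)
    qed
    finally have "series_norm r \<rho> c \<le> norm (f p) + \<eta>" by (simp add: c0)
    moreover have "cube r p \<rho> \<subseteq> cube r p R" using \<rho>R by (force simp: cube_def)
    ultimately show ?thesis unfolding has_series_def using s c by blast
  qed
  ultimately show ?thesis by blast
qed

definition unit_index :: "nat \<Rightarrow> nat \<Rightarrow> nat" where
  "unit_index i = (\<lambda>j. if j = i then 1 else 0)"

lemma total_degree_le_1E:
  assumes "\<alpha> \<in> multi_indices r" "total_degree r \<alpha> \<le> 1"
  obtains "\<alpha> = (\<lambda>_. 0)" | i where "i < r" "\<alpha> = unit_index i"
proof (cases "\<alpha> = (\<lambda>_. 0)")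
  case False
  then obtain i where i: "\<alpha> i \<noteq> 0" by auto
  then have ir: "i < r" using assms(1) by (auto simp: multi_indices_def not_less[symmetric])
  have "total_degree r \<alpha> = \<alpha> i + (\<Sum>j\<in>{..<r} - {i}. \<alpha> j)"
    unfolding total_degree_def using ir by (intro sum.remove) auto
  then have a: "\<alpha> i = 1" "(\<Sum>j\<in>{..<r} - {i}. \<alpha> j) = 0" using assms(2) i by linarith+
  have "\<alpha> j = 0" if "j < r" "j \<noteq> i" for j
    using a(2) that by (subst (asm) sum_eq_0_iff) auto
  with a(1) have "\<alpha> j = unit_index i j" for j
    using assms(1) by (cases "j < r") (auto simp: unit_index_def multi_indices_def)
  then have "\<alpha> = unit_index i" by blast
  then show ?thesis using that(2) ir by blast
qed (use that in auto)

lemma monomial_unit_index: "i < r \<Longrightarrow> monomial r v (unit_index i) = v i"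
proof -
  assume "i < r"
  have "monomial r v (unit_index i) = (\<Prod>j<r. if j = i then v j else 1)"
    unfolding monomial_def unit_index_def by (intro prod.cong) auto
  then show ?thesis using \<open>i < r\<close> by simp
qed

text \<open>A monomial of degree at least 2 is bounded on the cube of radius \<open>h\<close> by
  \<open>h\<^sup>2 / R\<^sup>2\<close> times its value at radius \<open>R\<close>, so the whole
  remainder is quadratic in \<open>h\<close> with a constant independent of direction.\<close>

lemma analytic_first_order:
  fixes f :: "(nat \<Rightarrow> real) \<Rightarrow> complex"
  assumes f: "real_analytic_at r f origin"
  obtains c K R where "R > 0" "K \<ge> 0"
    "\<And>x h. x \<in> cube r origin h \<Longrightarrow> 0 \<le> h \<Longrightarrow> h \<le> R \<Longrightarrow> norm (f x - f origin - (\<Sum>i<r. x i *\<^sub>R c i)) \<le> K * h\<^sup>2"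
proof -
  have p: "origin \<in> topspace (Euclidean_space r)" by (simp add: topspace_Euclidean_space)
  obtain R c where R: "R > 0" and sm: "(\<lambda>\<alpha>. norm (c \<alpha>) * R ^ total_degree r \<alpha>) summable_on multi_indices r"
    and c0: "c (\<lambda>_. 0) = f origin"
    and c: "\<And>x. x \<in> cube r origin R \<Longrightarrow> ((\<lambda>\<alpha>. monomial r (\<lambda>i. x i - 0) \<alpha> *\<^sub>R c \<alpha>) has_sum f x) (multi_indices r)"
    by (rule analytic_expansion[OF f p]) (rule that, assumption+)
  define S where "S = series_norm r R c"
  have S: "S \<ge> 0" unfolding S_def series_norm_def by (rule infsum_nonneg) (use R in auto)
  define K where "K = S / R\<^sup>2"
  let ?F = "insert (\<lambda>_. 0) (unit_index ` {..<r})"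
  have F: "finite ?F" "?F \<subseteq> multi_indices r" by (auto simp: multi_indices_def unit_index_def)
  have inj: "inj_on unit_index {..<r}" "(\<lambda>_. 0) \<notin> unit_index ` {..<r}"
    by (auto simp: inj_on_def unit_index_def fun_eq_iff split: if_splits)
  show ?thesis
  proof (rule that[of R K "\<lambda>i. c (unit_index i)"])
    fix x h assume x: "x \<in> cube r origin h" and h: "0 \<le> h" "h \<le> R"
    have xR: "x \<in> cube r origin R" using x h by (force simp: cube_def)
    let ?t = "\<lambda>\<alpha>. monomial r x \<alpha> *\<^sub>R c \<alpha>"
    let ?u = "\<lambda>\<alpha>. if \<alpha> \<in> ?F then ?t \<alpha> else 0"
    have t: "(?t has_sum f x) (multi_indices r)" using c[OF xR] by simp
    have "(?u has_sum (\<Sum>\<alpha>\<in>?F. ?u \<alpha>)) (multi_indices r)"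
      by (rule has_sum_finite_neutralI[OF F]) auto
    moreover have "(\<Sum>\<alpha>\<in>?F. ?u \<alpha>) = f origin + (\<Sum>i<r. x i *\<^sub>R c (unit_index i))"
    proof -
      have "(\<Sum>\<alpha>\<in>?F. ?u \<alpha>) = (\<Sum>\<alpha>\<in>?F. ?t \<alpha>)" by (intro sum.cong) auto
      also have "\<dots> = ?t (\<lambda>_. 0) + (\<Sum>i<r. ?t (unit_index i))"
        using inj by (simp add: sum.reindex)
      also have "\<dots> = f origin + (\<Sum>i<r. x i *\<^sub>R c (unit_index i))"
        by (simp add: c0 monomial_unit_index) (simp add: monomial_def)
      finally show ?thesis .
    qed
    ultimately have u: "(?u has_sum (f origin + (\<Sum>i<r. x i *\<^sub>R c (unit_index i)))) (multi_indices r)" by simp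
    have d: "((\<lambda>\<alpha>. ?t \<alpha> + (- 1) * ?u \<alpha>) has_sum (f x + (- 1) * (f origin + (\<Sum>i<r. x i *\<^sub>R c (unit_index i))))) (multi_indices r)"
      by (intro has_sum_add has_sum_cmult_right t u)
    have g: "((\<lambda>\<alpha>. h\<^sup>2 / R\<^sup>2 * (norm (c \<alpha>) * R ^ total_degree r \<alpha>)) has_sum (h\<^sup>2 / R\<^sup>2 * S)) (multi_indices r)"
      unfolding S_def series_norm_def by (intro has_sum_cmult_right has_sum_infsum sm)
    have "norm (f x + (- 1) * (f origin + (\<Sum>i<r. x i *\<^sub>R c (unit_index i)))) \<le> h\<^sup>2 / R\<^sup>2 * S"
    proof (rule norm_infsum_le[OF d g])
      fix \<alpha> assume \<alpha>: "\<alpha> \<in> multi_indices r"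
      show "norm (?t \<alpha> + (- 1) * ?u \<alpha>) \<le> h\<^sup>2 / R\<^sup>2 * (norm (c \<alpha>) * R ^ total_degree r \<alpha>)"
      proof (cases "\<alpha> \<in> ?F")
        case True
        then show ?thesis using R by simp
      next
        case False
        then have "\<not> total_degree r \<alpha> \<le> 1" using total_degree_le_1E[OF \<alpha>] by blast
        then have "total_degree r \<alpha> = 2 + (total_degree r \<alpha> - 2)" by simp
        then obtain d where d: "total_degree r \<alpha> = 2 + d" by blast
        have "\<bar>monomial r x \<alpha>\<bar> \<le> h ^ total_degree r \<alpha>"
          by (rule abs_monomial_le) (use x in \<open>auto simp: cube_def\<close>)
        also have "\<dots> \<le> h\<^sup>2 * R ^ d"
          unfolding d power_add by (intro mult_left_mono power_mono h) simp
        also have "\<dots> = h\<^sup>2 / R\<^sup>2 * R ^ total_degree r \<alpha>"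
          unfolding d power_add using R by simp
        finally have "\<bar>monomial r x \<alpha>\<bar> * norm (c \<alpha>) \<le> h\<^sup>2 / R\<^sup>2 * R ^ total_degree r \<alpha> * norm (c \<alpha>)"
          by (rule mult_right_mono) simp
        then show ?thesis using False by (simp add: mult_ac)
      qed
    qed
    then show "norm (f x - f origin - (\<Sum>i<r. x i *\<^sub>R c (unit_index i))) \<le> K * h\<^sup>2"
      unfolding K_def by (simp add: algebra_simps)
  qed (use R S in \<open>auto simp: K_def\<close>)
qed

lemma has_series_sum:
  assumes "\<And>k. k < n \<Longrightarrow> has_series r p \<rho> B (f k)" "\<rho> > 0"
  shows "has_series r p \<rho> (real n * B) (\<lambda>x. \<Sum>k<n. f k x)"
  using assms(1)
proof (induction n)
  case 0
  then show ?case using has_series_const[OF assms(2), of r p 0] by simp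
next
  case (Suc n)
  then have "has_series r p \<rho> (real n * B + B) (\<lambda>x. (\<Sum>k<n. f k x) + f n x)"
    by (intro has_series_add assms(2)) auto
  then show ?case by (simp add: algebra_simps)
qed
section \<open>Solving the congruence equation\<close>

definition congruence_error :: "nat \<Rightarrow> (nat \<Rightarrow> nat \<Rightarrow> complex) \<Rightarrow> (nat \<Rightarrow> nat \<Rightarrow> complex) \<Rightarrow> (nat \<Rightarrow> nat \<Rightarrow> complex) \<Rightarrow> nat \<Rightarrow> nat \<Rightarrow> complex" where
  "congruence_error n a E C i j = E i j + (\<Sum>k<n. cnj (C k i) * E k j) + (\<Sum>k<n. E i k * C k j) +
     (\<Sum>k<n. \<Sum>l<n. cnj (C k i) * (a k l + E k l) * C l j)"

lemma congruence_expansion: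
  assumes "i < n" "j < n"
  shows "(\<Sum>k<n. \<Sum>l<n. cnj ((if k = i then 1 else 0) + C k i) * (a k l + E k l) * ((if l = j then 1 else 0) + C l j)) =
    a i j + tangent n a C i j + congruence_error n a E C i j"
proof -
  have "(\<Sum>k<n. \<Sum>l<n. cnj ((if k = i then 1 else 0) + C k i) * (a k l + E k l) * ((if l = j then 1 else 0) + C l j)) =
     (\<Sum>k<n. \<Sum>l<n. (if l = j then (if k = i then a k l + E k l else 0) else 0) + (if k = i then (a k l + E k l) * C l j else 0) +
        (if l = j then cnj (C k i) * (a k l + E k l) else 0) + cnj (C k i) * (a k l + E k l) * C l j)"
    by (intro sum.cong refl) (auto simp: algebra_simps)
  also have "\<dots> = (a i j + E i j) + (\<Sum>l<n. (a i l + E i l) * C l j) + (\<Sum>k<n. cnj (C k i) * (a k j + E k j)) +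
      (\<Sum>k<n. \<Sum>l<n. cnj (C k i) * (a k l + E k l) * C l j)"
  proof -
    have "(\<Sum>k<n. \<Sum>l<n. if k = i then (a k l + E k l) * C l j else 0) = (\<Sum>l<n. (a i l + E i l) * C l j)"
      by (subst sum.swap) (use assms in simp)
    then show ?thesis using assms by (simp add: sum.distrib)
  qed
  finally show ?thesis
    by (simp add: tangent_def congruence_error_def algebra_simps sum.distrib)
qed

lemma real_linear_op_diff:
  "real_linear_op n \<alpha> \<beta> (\<lambda>i j. M i j - M' i j) i j = real_linear_op n \<alpha> \<beta> M i j - real_linear_op n \<alpha> \<beta> M' i j"
  unfolding real_linear_op_def sum_subtractf[symmetric] by (intro sum.cong refl) (simp add: algebra_simps)

context
  fixes n :: nat and a :: "nat \<Rightarrow> nat \<Rightarrow> complex" and \<alpha> \<beta> :: "nat \<Rightarrow> nat \<Rightarrow> nat \<Rightarrow> nat \<Rightarrow> complex"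
begin

definition picard_step :: "(nat \<Rightarrow> nat \<Rightarrow> complex) \<Rightarrow> (nat \<Rightarrow> nat \<Rightarrow> complex) \<Rightarrow> nat \<Rightarrow> nat \<Rightarrow> complex" where
  "picard_step E C i j = - real_linear_op n \<alpha> \<beta> (congruence_error n a E C) i j"

primrec picard :: "(nat \<Rightarrow> nat \<Rightarrow> complex) \<Rightarrow> nat \<Rightarrow> nat \<Rightarrow> nat \<Rightarrow> complex" where
  "picard E 0 = (\<lambda>_ _. 0)"
| "picard E (Suc m) = picard_step E (picard E m)"

text \<open>Written as the sum of the increments rather than as a limit, so that the closure of
  series under summation applies.\<close>

definition picard_limit :: "(nat \<Rightarrow> nat \<Rightarrow> complex) \<Rightarrow> nat \<Rightarrow> nat \<Rightarrow> complex" where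
  "picard_limit E i j = (\<Sum>m. picard E (Suc m) i j - picard E m i j)"

lemma picard_zero: "picard (\<lambda>_ _. 0) m = (\<lambda>_ _. 0)"
  by (induction m) (auto simp: picard_step_def congruence_error_def real_linear_op_def fun_eq_iff)

lemma picard_limit_zero: "picard_limit (\<lambda>_ _. 0) i j = 0"
  unfolding picard_limit_def picard_zero by simp

text \<open>Each term of the difference carries one factor \<open>C - C'\<close>; the other factors
  are \<open>E\<close> or involve \<open>C\<close> or \<open>C'\<close>, which are small, so the
  step is a contraction.\<close>

lemma picard_step_diff:
  "picard_step E C i j - picard_step E C' i j =
     - real_linear_op n \<alpha> \<beta> (\<lambda>i j. (\<Sum>k<n. cnj (C k i - C' k i) * E k j) + (\<Sum>k<n. E i k * (C k j - C' k j)) +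
       (\<Sum>k<n. \<Sum>l<n. cnj (C k i - C' k i) * (a k l + E k l) * C l j) +
       (\<Sum>k<n. \<Sum>l<n. cnj (C' k i) * (a k l + E k l) * (C l j - C' l j))) i j"
proof -
  have *: "congruence_error n a E C i j - congruence_error n a E C' i j =
      (\<Sum>k<n. cnj (C k i - C' k i) * E k j) + (\<Sum>k<n. E i k * (C k j - C' k j)) +
       (\<Sum>k<n. \<Sum>l<n. cnj (C k i - C' k i) * (a k l + E k l) * C l j) +
       (\<Sum>k<n. \<Sum>l<n. cnj (C' k i) * (a k l + E k l) * (C l j - C' l j))" for i j
  proof -
    have "(\<Sum>k<n. \<Sum>l<n. cnj (C k i) * (a k l + E k l) * C l j) - (\<Sum>k<n. \<Sum>l<n. cnj (C' k i) * (a k l + E k l) * C' l j) =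
       (\<Sum>k<n. \<Sum>l<n. cnj (C k i - C' k i) * (a k l + E k l) * C l j + cnj (C' k i) * (a k l + E k l) * (C l j - C' l j))"
      unfolding sum_subtractf[symmetric] by (intro sum.cong refl) (simp add: algebra_simps)
    moreover have "(\<Sum>k<n. cnj (C k i) * E k j) - (\<Sum>k<n. cnj (C' k i) * E k j) = (\<Sum>k<n. cnj (C k i - C' k i) * E k j)"
      unfolding sum_subtractf[symmetric] by (intro sum.cong refl) (simp add: algebra_simps)
    moreover have "(\<Sum>k<n. E i k * C k j) - (\<Sum>k<n. E i k * C' k j) = (\<Sum>k<n. E i k * (C k j - C' k j))"
      unfolding sum_subtractf[symmetric] by (intro sum.cong refl) (simp add: algebra_simps)
    ultimately show ?thesis
      unfolding congruence_error_def sum.distrib by (simp only: add_diff_add) (simp add: algebra_simps)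
  qed
  have "picard_step E C i j - picard_step E C' i j =
     - real_linear_op n \<alpha> \<beta> (\<lambda>i j. congruence_error n a E C i j - congruence_error n a E C' i j) i j"
    unfolding picard_step_def real_linear_op_diff by simp
  then show ?thesis unfolding * .
qed

text \<open>\<open>contract\<close> lets a step halve differences inside the ball of radius
  \<open>\<delta>\<close>, and \<open>start\<close> places the first iterate within
  \<open>\<delta> / 2\<close>. The factors \<open>n\<close> come from bounding a sum by the number
  of its terms, and \<open>K\<close> bounds the entries of \<open>A + E\<close> because
  \<open>\<epsilon> \<le> 1\<close>.\<close>

context
  fixes r :: nat and p :: "nat \<Rightarrow> real" and \<rho> \<tau> K \<delta> \<epsilon> :: real and E :: "(nat \<Rightarrow> real) \<Rightarrow> nat \<Rightarrow> nat \<Rightarrow> complex"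
  assumes \<rho>: "\<rho> > 0" and \<delta>: "\<delta> > 0" and \<epsilon>: "\<epsilon> > 0" "\<epsilon> \<le> 1"
    and \<tau>: "\<And>i j k l. i < n \<Longrightarrow> j < n \<Longrightarrow> k < n \<Longrightarrow> l < n \<Longrightarrow> norm (\<alpha> i j k l) + norm (\<beta> i j k l) \<le> \<tau>" "\<tau> \<ge> 0"
    and K: "\<And>i j. i < n \<Longrightarrow> j < n \<Longrightarrow> norm (a i j) + 1 \<le> K" "K \<ge> 0"
    and contract: "real n * (real n * (\<tau> * (2 * real n * \<epsilon> + 2 * (real n * (real n * (K * \<delta>)))))) \<le> 1 / 2"
    and start: "real n * (real n * (\<tau> * \<epsilon>)) \<le> \<delta> / 2"
    and E: "\<And>i j. i < n \<Longrightarrow> j < n \<Longrightarrow> has_series r p \<rho> \<epsilon> (\<lambda>y. E y i j)"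
begin

lemma real_linear_op_series:
  assumes M: "\<And>i j. i < n \<Longrightarrow> j < n \<Longrightarrow> has_series r p \<rho> B (\<lambda>y. M y i j)" and "B \<ge> 0" and ij: "i < n" "j < n"
  shows "has_series r p \<rho> (real n * (real n * (\<tau> * B))) (\<lambda>y. - real_linear_op n \<alpha> \<beta> (M y) i j)"
proof -
  have "has_series r p \<rho> (\<tau> * B) (\<lambda>y. - \<alpha> i j k l * M y k l + - \<beta> i j k l * cnj (M y k l))" if "k < n" "l < n" for k l
  proof (rule has_series_mono)
    show "has_series r p \<rho> (norm (- \<alpha> i j k l) * B + norm (- \<beta> i j k l) * B) (\<lambda>y. - \<alpha> i j k l * M y k l + - \<beta> i j k l * cnj (M y k l))"
      by (intro has_series_add has_series_mult has_series_const has_series_cnj M that \<rho>)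
    show "norm (- \<alpha> i j k l) * B + norm (- \<beta> i j k l) * B \<le> \<tau> * B"
      unfolding distrib_right[symmetric] norm_minus_cancel using \<tau>(1)[OF ij that] assms(2) by (rule mult_right_mono)
  qed
  then have "has_series r p \<rho> (real n * (real n * (\<tau> * B))) (\<lambda>y. \<Sum>k<n. \<Sum>l<n. - \<alpha> i j k l * M y k l + - \<beta> i j k l * cnj (M y k l))"
    by (intro has_series_sum \<rho>)
  moreover have "- real_linear_op n \<alpha> \<beta> (M y) i j = (\<Sum>k<n. \<Sum>l<n. - \<alpha> i j k l * M y k l + - \<beta> i j k l * cnj (M y k l))" for y
    unfolding real_linear_op_def sum_negf[symmetric] by (intro sum.cong refl) simp
  ultimately show ?thesis by simp
qed

lemma perturbed_series:
  assumes "k < n" "l < n"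
  shows "has_series r p \<rho> K (\<lambda>y. a k l + E y k l)"
proof (rule has_series_mono)
  show "has_series r p \<rho> (norm (a k l) + \<epsilon>) (\<lambda>y. a k l + E y k l)"
    by (intro has_series_add has_series_const E assms \<rho>)
  show "norm (a k l) + \<epsilon> \<le> K" using K(1)[OF assms] \<epsilon> by simp
qed

lemma picard_step_diff_series:
  assumes C: "\<And>i j. i < n \<Longrightarrow> j < n \<Longrightarrow> has_series r p \<rho> \<delta> (\<lambda>y. C y i j)"
    and C': "\<And>i j. i < n \<Longrightarrow> j < n \<Longrightarrow> has_series r p \<rho> \<delta> (\<lambda>y. C' y i j)"
    and D: "\<And>i j. i < n \<Longrightarrow> j < n \<Longrightarrow> has_series r p \<rho> d (\<lambda>y. C y i j - C' y i j)" and d: "d \<ge> 0"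
    and ij: "i < n" "j < n"
  shows "has_series r p \<rho> (d / 2) (\<lambda>y. picard_step (E y) (C y) i j - picard_step (E y) (C' y) i j)"
proof (rule has_series_mono)
  let ?B = "real n * (d * \<epsilon>) + real n * (\<epsilon> * d) + real n * (real n * (d * K * \<delta>)) + real n * (real n * (\<delta> * K * d))"
  show "has_series r p \<rho> (real n * (real n * (\<tau> * ?B))) (\<lambda>y. picard_step (E y) (C y) i j - picard_step (E y) (C' y) i j)"
    unfolding picard_step_diff
    by (intro real_linear_op_series has_series_add has_series_sum has_series_mult has_series_cnj D C C' E perturbed_series \<rho> ij)
      (use d \<epsilon> K \<delta> in auto)
  have "?B = d * (2 * real n * \<epsilon> + 2 * (real n * (real n * (K * \<delta>))))" by (simp add: algebra_simps)
  then have "real n * (real n * (\<tau> * ?B)) = d * (real n * (real n * (\<tau> * (2 * real n * \<epsilon> + 2 * (real n * (real n * (K * \<delta>)))))))"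
    by (simp add: mult_ac)
  also have "\<dots> \<le> d * (1 / 2)" by (intro mult_left_mono contract d)
  finally show "real n * (real n * (\<tau> * ?B)) \<le> d / 2" by simp
qed

text \<open>The two claims depend on each other: the contraction estimate requires iterates in the
  ball of radius \<open>\<delta>\<close>, and they stay there because the increments add up to
  \<open>\<delta> * (1 - (1 / 2) ^ m)\<close>.\<close>

lemma picard_series:
  "(\<forall>i<n. \<forall>j<n. has_series r p \<rho> (\<delta> * (1 - (1 / 2) ^ m)) (\<lambda>y. picard (E y) m i j)) \<and>
   (\<forall>i<n. \<forall>j<n. has_series r p \<rho> (\<delta> / 2 * (1 / 2) ^ m) (\<lambda>y. picard (E y) (Suc m) i j - picard (E y) m i j))"
proof (induction m)
  case 0
  have "has_series r p \<rho> (\<delta> / 2) (\<lambda>y. picard_step (E y) (\<lambda>_ _. 0) i j)" if "i < n" "j < n" for i j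
  proof (rule has_series_mono[OF _ start])
    have "congruence_error n a (E y) (\<lambda>_ _. 0) = E y" for y
      by (simp add: fun_eq_iff congruence_error_def)
    then have "picard_step (E y) (\<lambda>_ _. 0) i j = - real_linear_op n \<alpha> \<beta> (E y) i j" for y
      by (simp add: picard_step_def)
    then show "has_series r p \<rho> (real n * (real n * (\<tau> * \<epsilon>))) (\<lambda>y. picard_step (E y) (\<lambda>_ _. 0) i j)"
      using real_linear_op_series[of \<epsilon> E, OF E _ that] \<epsilon> by simp
  qed
  then show ?case using has_series_const[OF \<rho>, of r p 0] by simp
next
  case (Suc m)
  have small: "\<delta> * (1 - (1 / 2) ^ m) \<le> \<delta>" for m using \<delta> by (simp add: mult_le_cancel_left1)
  have 1: "has_series r p \<rho> (\<delta> * (1 - (1 / 2) ^ Suc m)) (\<lambda>y. picard (E y) (Suc m) i j)" if "i < n" "j < n" for i j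
  proof -
    have "has_series r p \<rho> (\<delta> * (1 - (1 / 2) ^ m) + \<delta> / 2 * (1 / 2) ^ m)
        (\<lambda>y. picard (E y) m i j + (picard (E y) (Suc m) i j - picard (E y) m i j))"
      by (intro has_series_add \<rho>) (use Suc that in auto)
    then show ?thesis by (simp add: algebra_simps del: picard.simps)
  qed
  have "has_series r p \<rho> (\<delta> / 2 * (1 / 2) ^ m / 2) (\<lambda>y. picard_step (E y) (picard (E y) (Suc m)) i j - picard_step (E y) (picard (E y) m) i j)"
    if "i < n" "j < n" for i j
  proof (rule picard_step_diff_series[OF _ _ _ _ that])
    show "has_series r p \<rho> \<delta> (\<lambda>y. picard (E y) (Suc m) i j)" if "i < n" "j < n" for i j
      by (rule has_series_mono[OF 1[OF that] small])
    show "has_series r p \<rho> \<delta> (\<lambda>y. picard (E y) m i j)" if "i < n" "j < n" for i j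
      by (rule has_series_mono[OF _ small[of m]]) (use Suc that in auto)
    show "has_series r p \<rho> (\<delta> / 2 * (1 / 2) ^ m) (\<lambda>y. picard (E y) (Suc m) i j - picard (E y) m i j)" if "i < n" "j < n" for i j
      using Suc that by auto
  qed (use \<delta> in auto)
  with 1 show ?case by (simp add: mult_ac)
qed

lemma picard_limit_series:
  assumes "i < n" "j < n"
  shows "has_series r p \<rho> \<delta> (\<lambda>y. picard_limit (E y) i j)"
proof -
  have g: "(\<lambda>m. \<delta> / 2 * (1 / 2) ^ m) sums (\<delta> / 2 * (1 / (1 - 1 / 2)))"
    by (intro sums_mult geometric_sums) simp
  have "has_series r p \<rho> (\<Sum>m. \<delta> / 2 * (1 / 2) ^ m) (\<lambda>y. \<Sum>m. picard (E y) (Suc m) i j - picard (E y) m i j)"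
    by (rule has_series_suminf[OF _ sums_summable[OF g] \<rho>]) (use picard_series assms in blast)
  then show ?thesis unfolding picard_limit_def using sums_unique[OF g] by simp
qed

text \<open>At a fixed \<open>y\<close> the step is a polynomial in finitely many entries and their
  conjugates, so the entrywise limit passes through it.\<close>

lemma picard_limit_fixed:
  assumes y: "y \<in> cube r p \<rho>" and ij: "i < n" "j < n"
  shows "picard_limit (E y) i j = - real_linear_op n \<alpha> \<beta> (congruence_error n a (E y) (picard_limit (E y))) i j"
proof -
  have lim: "(\<lambda>m. picard (E y) m i j) \<longlonglongrightarrow> picard_limit (E y) i j" if "i < n" "j < n" for i j
  proof -
    have le: "norm (picard (E y) (Suc m) i j - picard (E y) m i j) \<le> \<delta> / 2 * (1 / 2) ^ m" for m
      by (rule has_series_bound[OF _ y]) (use picard_series that in blast)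
    have "summable (\<lambda>m. \<delta> / 2 * (1 / 2 :: real) ^ m)"
      by (intro summable_mult summable_geometric) simp
    then have "summable (\<lambda>m. picard (E y) (Suc m) i j - picard (E y) m i j)"
      by (rule summable_comparison_test'[where N = 0]) (rule le)
    then have "(\<lambda>m. \<Sum>k<m. picard (E y) (Suc k) i j - picard (E y) k i j) \<longlonglongrightarrow> picard_limit (E y) i j"
      unfolding picard_limit_def by (rule summable_LIMSEQ)
    then show ?thesis
      unfolding sum_lessThan_telescope[of "\<lambda>m. picard (E y) m i j"] by simp
  qed
  have "(\<lambda>m. congruence_error n a (E y) (picard (E y) m) i j) \<longlonglongrightarrow> congruence_error n a (E y) (picard_limit (E y)) i j"
    if "i < n" "j < n" for i j
    unfolding congruence_error_def by (intro tendsto_intros lim that) auto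
  then have "(\<lambda>m. picard (E y) (Suc m) i j) \<longlonglongrightarrow> - real_linear_op n \<alpha> \<beta> (congruence_error n a (E y) (picard_limit (E y))) i j"
    unfolding picard.simps picard_step_def real_linear_op_def by (intro tendsto_intros) auto
  moreover have "(\<lambda>m. picard (E y) (Suc m) i j) \<longlonglongrightarrow> picard_limit (E y) i j"
    by (rule LIMSEQ_Suc[OF lim[OF ij]])
  ultimately show ?thesis by (rule LIMSEQ_unique[rotated])
qed

end

text \<open>The threshold and the operator \<open>C\<close> are fixed before \<open>r\<close>,
  \<open>p\<close>, \<open>\<rho>\<close> and \<open>E\<close>. Since \<open>C\<close> depends only
  on the value \<open>E y\<close>, the expansions around different base points describe one and the
  same function.\<close>

lemma congruence_solution:
  obtains \<epsilon> C where "\<epsilon> > 0" "\<And>i j. C (\<lambda>_ _. 0) i j = 0"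
    "\<And>r p \<rho> E i j. \<rho> > 0 \<Longrightarrow> (\<And>i j. i < n \<Longrightarrow> j < n \<Longrightarrow> has_series r p \<rho> \<epsilon> (\<lambda>y. E y i j)) \<Longrightarrow> i < n \<Longrightarrow> j < n \<Longrightarrow>
      has_series r p \<rho> 1 (\<lambda>y. C (E y) i j)"
    "\<And>r p \<rho> E y i j. \<rho> > 0 \<Longrightarrow> (\<And>i j. i < n \<Longrightarrow> j < n \<Longrightarrow> has_series r p \<rho> \<epsilon> (\<lambda>y. E y i j)) \<Longrightarrow> y \<in> cube r p \<rho> \<Longrightarrow>
      i < n \<Longrightarrow> j < n \<Longrightarrow> C (E y) i j = - real_linear_op n \<alpha> \<beta> (congruence_error n a (E y) (C (E y))) i j"
proof -
  define \<tau> where "\<tau> = (\<Sum>i<n. \<Sum>j<n. \<Sum>k<n. \<Sum>l<n. norm (\<alpha> i j k l) + norm (\<beta> i j k l))"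
  define K where "K = (\<Sum>i<n. \<Sum>j<n. norm (a i j)) + 1"
  have mem: "f i \<le> (\<Sum>i<n. f i)" if "\<And>i. 0 \<le> f i" "i < n" for f :: "nat \<Rightarrow> real" and i
    using that by (intro member_le_sum) auto
  have \<tau>: "norm (\<alpha> i j k l) + norm (\<beta> i j k l) \<le> \<tau>" if "i < n" "j < n" "k < n" "l < n" for i j k l
    unfolding \<tau>_def
    by (rule order_trans[OF _ mem[of _ i]], rule order_trans[OF _ mem[of _ j]], rule order_trans[OF _ mem[of _ k]],
        rule order_trans[OF _ mem[of _ l]]) (use that in \<open>auto intro!: sum_nonneg add_nonneg_nonneg\<close>)
  have \<tau>0: "\<tau> \<ge> 0" unfolding \<tau>_def by (intro sum_nonneg) auto
  have K: "norm (a i j) + 1 \<le> K" if "i < n" "j < n" for i j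
    unfolding K_def
    by (rule add_right_mono, rule order_trans[OF _ mem[of _ i]], rule order_trans[OF _ mem[of _ j]])
      (use that in \<open>auto intro!: sum_nonneg add_nonneg_nonneg\<close>)
  have K0: "K \<ge> 0" unfolding K_def by (intro add_nonneg_nonneg sum_nonneg) auto
  define \<kappa> where "\<kappa> = real n * (real n * \<tau>)"
  have \<kappa>0: "\<kappa> \<ge> 0" unfolding \<kappa>_def using \<tau>0 by simp
  define Q where "Q = \<kappa> * (real n * (real n * K))"
  have Q0: "Q \<ge> 0" unfolding Q_def using \<kappa>0 K0 by simp
  \<comment> \<open>This spends \<open>1 / 4\<close> of the contraction budget \<open>1 / 2\<close>
    on the terms quadratic in \<open>C\<close>.\<close>
  define \<delta> where "\<delta> = 1 / (8 * (Q + 1))"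
  have \<delta>: "0 < \<delta>" "\<delta> \<le> 1" "2 * (Q * \<delta>) \<le> 1 / 4" unfolding \<delta>_def using Q0 by (simp_all add: field_simps)
  \<comment> \<open>A single product in the denominator makes each of
    \<open>\<kappa> * n * \<epsilon>\<close>, \<open>\<kappa> * \<epsilon>\<close>,
    \<open>n * \<epsilon>\<close> and \<open>\<epsilon>\<close> at most \<open>\<delta> / 8\<close>,
    which covers the remaining requirements at once.\<close>
  define \<epsilon> where "\<epsilon> = \<delta> / (8 * ((\<kappa> + 1) * (real n + 1)))"
  have \<epsilon>0: "\<epsilon> > 0" unfolding \<epsilon>_def using \<delta> \<kappa>0 by simp
  have \<epsilon>_eq: "8 * ((\<kappa> + 1) * (real n + 1)) * \<epsilon> = \<delta>" unfolding \<epsilon>_def using \<kappa>0 by simp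
  have p: "0 \<le> \<kappa> * \<epsilon>" "0 \<le> \<kappa> * real n * \<epsilon>" "0 \<le> real n * \<epsilon>" using \<kappa>0 \<epsilon>0 by simp_all
  have \<epsilon>_exp: "8 * (\<kappa> * real n * \<epsilon>) + 8 * (\<kappa> * \<epsilon>) + 8 * (real n * \<epsilon>) + 8 * \<epsilon> = \<delta>"
    using \<epsilon>_eq by (simp add: algebra_simps)
  have \<epsilon>1: "\<epsilon> \<le> 1" using \<epsilon>_exp p \<delta> \<epsilon>0 by linarith
  have start: "real n * (real n * (\<tau> * \<epsilon>)) \<le> \<delta> / 2"
  proof -
    have "\<kappa> * \<epsilon> \<le> \<delta> / 2" using \<epsilon>_exp p \<epsilon>0 by linarith
    then show ?thesis unfolding \<kappa>_def by (simp add: mult_ac)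
  qed
  have contract: "real n * (real n * (\<tau> * (2 * real n * \<epsilon> + 2 * (real n * (real n * (K * \<delta>)))))) \<le> 1 / 2"
  proof -
    have "2 * (\<kappa> * real n * \<epsilon>) + 2 * (Q * \<delta>) \<le> 1 / 2" using \<epsilon>_exp p \<epsilon>0 \<delta> by linarith
    then show ?thesis unfolding \<kappa>_def Q_def by (simp add: algebra_simps)
  qed
  show ?thesis
  proof (rule that[of \<epsilon> picard_limit])
    fix r p \<rho> i j and E :: "(nat \<Rightarrow> real) \<Rightarrow> nat \<Rightarrow> nat \<Rightarrow> complex"
    assume "\<rho> > 0" "\<And>i j. i < n \<Longrightarrow> j < n \<Longrightarrow> has_series r p \<rho> \<epsilon> (\<lambda>y. E y i j)" "i < n" "j < n"
    then show "has_series r p \<rho> 1 (\<lambda>y. picard_limit (E y) i j)"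
      by (intro has_series_mono[OF picard_limit_series[OF _ \<delta>(1) \<epsilon>0 \<epsilon>1 \<tau> \<tau>0 K K0 contract start] \<delta>(2)]) auto
  next
    fix r p \<rho> y i j and E :: "(nat \<Rightarrow> real) \<Rightarrow> nat \<Rightarrow> nat \<Rightarrow> complex"
    assume "\<rho> > 0" "\<And>i j. i < n \<Longrightarrow> j < n \<Longrightarrow> has_series r p \<rho> \<epsilon> (\<lambda>y. E y i j)" "y \<in> cube r p \<rho>" "i < n" "j < n"
    then show "picard_limit (E y) i j = - real_linear_op n \<alpha> \<beta> (congruence_error n a (E y) (picard_limit (E y))) i j"
      by (intro picard_limit_fixed[OF _ \<delta>(1) \<epsilon>0 \<epsilon>1 \<tau> \<tau>0 K K0 contract start]) auto
  qed (use \<epsilon>0 picard_limit_zero in auto)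
qed

end
section \<open>Simplest deformations\<close>

lemma adjoint_congruence_entry:
  assumes "S \<in> carrier_mat n n" "B \<in> carrier_mat n n" "i < n" "j < n"
  shows "(mat_adjoint S * B * S) $$ (i, j) = (\<Sum>k<n. \<Sum>l<n. cnj (S $$ (k, i)) * B $$ (k, l) * S $$ (l, j))"
proof -
  have adj: "mat_adjoint S \<in> carrier_mat n n" "\<And>k. k < n \<Longrightarrow> mat_adjoint S $$ (i, k) = cnj (S $$ (k, i))"
    using assms by (auto simp: mat_adjoint_def mat_of_rows_index conjugate_complex_def)
  have mult: "(P * Q) $$ (i, j) = (\<Sum>k<n. P $$ (i, k) * Q $$ (k, j))"
    if "P \<in> carrier_mat n n" "Q \<in> carrier_mat n n" "j < n" for P Q :: "complex mat" and j
    using that assms by (simp add: scalar_prod_def lessThan_atLeast0)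
  have "(mat_adjoint S * B) $$ (i, l) = (\<Sum>k<n. cnj (S $$ (k, i)) * B $$ (k, l))" if "l < n" for l
    unfolding mult[OF adj(1) assms(2) that] by (intro sum.cong refl) (simp add: adj(2))
  then have "(mat_adjoint S * B * S) $$ (i, j) = (\<Sum>l<n. (\<Sum>k<n. cnj (S $$ (k, i)) * B $$ (k, l)) * S $$ (l, j))"
    unfolding mult[OF mult_carrier_mat[OF adj(1) assms(2)] assms(1,4)] by simp
  also have "\<dots> = (\<Sum>l<n. \<Sum>k<n. cnj (S $$ (k, i)) * B $$ (k, l) * S $$ (l, j))"
    by (simp add: sum_distrib_right)
  also have "\<dots> = (\<Sum>k<n. \<Sum>l<n. cnj (S $$ (k, i)) * B $$ (k, l) * S $$ (l, j))"
    by (rule sum.swap)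
  finally show ?thesis .
qed

lemma real_analytic_at_const: "real_analytic_at r (\<lambda>_. z :: complex) p"
  by (rule has_series_imp_analytic[OF has_series_const[of 1]]) simp_all

lemma real_analytic_at_add:
  fixes f g :: "(nat \<Rightarrow> real) \<Rightarrow> complex"
  assumes "real_analytic_at r f p" "real_analytic_at r g p"
  shows "real_analytic_at r (\<lambda>x. f x + g x) p"
proof (cases "p \<in> topspace (Euclidean_space r)")
  case p: True
  obtain \<rho>1 where \<rho>1: "\<rho>1 > 0" "\<And>\<rho>. 0 < \<rho> \<Longrightarrow> \<rho> \<le> \<rho>1 \<Longrightarrow> has_series r p \<rho> (norm (f p) + 1) f"
    using analytic_imp_has_series[OF assms(1) p, of 1] by auto
  obtain \<rho>2 where \<rho>2: "\<rho>2 > 0" "\<And>\<rho>. 0 < \<rho> \<Longrightarrow> \<rho> \<le> \<rho>2 \<Longrightarrow> has_series r p \<rho> (norm (g p) + 1) g"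
    using analytic_imp_has_series[OF assms(2) p, of 1] by auto
  show ?thesis
    by (rule has_series_imp_analytic[OF has_series_add[OF \<rho>1(2)[of "min \<rho>1 \<rho>2"] \<rho>2(2)[of "min \<rho>1 \<rho>2"]]])
      (use \<rho>1(1) \<rho>2(1) in auto)
qed (simp add: real_analytic_at_def nhdsin_degenerate)

lemma real_analytic_at_coordinate:
  assumes "i < r"
  shows "real_analytic_at r (\<lambda>x. x i) p"
proof -
  have "real_analytic_at r (\<lambda>x. complex_of_real (x i)) p"
    by (rule has_series_imp_analytic[OF has_series_coordinate[of 1]]) (use assms in simp_all)
  from real_analytic_at_linear[OF bounded_linear_Re this] show ?thesis by simp
qed

context
  fixes n :: nat and D :: "symb mat" and e :: "param \<Rightarrow> nat"
  assumes D: "D \<in> carrier_mat n n" and e: "bij_betw e (params D) {..<num_params D}"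
begin

lemma param_less: "q \<in> params D \<Longrightarrow> e q < num_params D"
  using e by (auto simp: bij_betw_def)

lemma params_mem:
  assumes "i < n" "j < n"
  shows "X i j \<in> params D \<longleftrightarrow> D $$ (i, j) = Star \<or> D $$ (i, j) = Circ"
    "Y i j \<in> params D \<longleftrightarrow> D $$ (i, j) = Star \<or> D $$ (i, j) = Bullet"
  using assms D by (auto simp: params_def)

lemma param_mat_sym_ok: "i < n \<Longrightarrow> j < n \<Longrightarrow> sym_ok (D $$ (i, j)) (param_mat D v $$ (i, j))"
  using D by (cases "D $$ (i, j)") (auto simp: param_mat_def)

lemma param_mat_surj:
  assumes "i < n" "j < n" "sym_ok (D $$ (i, j)) z"
    and "\<And>q. q \<in> params D \<Longrightarrow> q = X i j \<Longrightarrow> v q = Re z" "\<And>q. q \<in> params D \<Longrightarrow> q = Y i j \<Longrightarrow> v q = Im z"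
  shows "param_mat D v $$ (i, j) = z"
  using assms D params_mem[OF assms(1,2)]
  by (cases "D $$ (i, j)") (auto simp: param_mat_def complex_eq_iff)

lemma param_mat_inj:
  assumes "\<And>i j. i < n \<Longrightarrow> j < n \<Longrightarrow> param_mat D v $$ (i, j) = 0" "q \<in> params D"
  shows "v q = 0"
proof -
  have "\<exists>i<n. \<exists>j<n. q = X i j \<and> (D $$ (i, j) = Star \<or> D $$ (i, j) = Circ) \<or> q = Y i j \<and> (D $$ (i, j) = Star \<or> D $$ (i, j) = Bullet)"
    using assms(2) D by (auto simp: params_def)
  then obtain i j where ij: "i < n" "j < n"
    "q = X i j \<and> (D $$ (i, j) = Star \<or> D $$ (i, j) = Circ) \<or> q = Y i j \<and> (D $$ (i, j) = Star \<or> D $$ (i, j) = Bullet)"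
    by blast
  show ?thesis
    using assms(1)[OF ij(1,2)] ij D by (auto simp: param_mat_def complex_eq_iff)
qed

context
  fixes A :: "complex mat"
  assumes A: "A \<in> carrier_mat n n"
begin

lemma simplest_carrier: "simplest_deformation A D e x \<in> carrier_mat n n"
  using A D by (auto simp: simplest_deformation_def param_mat_def)

lemma simplest_entry:
  "i < n \<Longrightarrow> j < n \<Longrightarrow> simplest_deformation A D e x $$ (i, j) = A $$ (i, j) + param_mat D (\<lambda>q. x (e q)) $$ (i, j)"
  using A D by (auto simp: simplest_deformation_def param_mat_def)

lemma simplest_origin: "simplest_deformation A D e origin = A"
proof (rule eq_matI)
  fix i j assume "i < dim_row A" "j < dim_col A"
  then have ij: "i < n" "j < n" using A by auto
  show "simplest_deformation A D e origin $$ (i, j) = A $$ (i, j)"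
    unfolding simplest_entry[OF ij] using ij D by (auto simp: param_mat_def split: symb.split)
qed (use A simplest_carrier[of origin] in auto)

lemma simplest_analytic:
  assumes \<phi>: "\<And>i. i < num_params D \<Longrightarrow> real_analytic_at s (\<lambda>z. \<phi> z i) y" and ij: "i < n" "j < n"
  shows "real_analytic_at s (\<lambda>z. simplest_deformation A D e (\<phi> z) $$ (i, j)) y"
proof -
  have re: "real_analytic_at s (\<lambda>z. complex_of_real (\<phi> z (e q))) y" if "q \<in> params D" for q
    by (rule real_analytic_at_linear[OF bounded_linear_of_real \<phi>[OF param_less[OF that]]])
  have im: "real_analytic_at s (\<lambda>z. \<i> * complex_of_real (\<phi> z (e q))) y" if "q \<in> params D" for q
    by (rule real_analytic_at_linear[OF bounded_linear_mult_right re[OF that]])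
  have "real_analytic_at s (\<lambda>z. A $$ (i, j) + param_mat D (\<lambda>q. \<phi> z (e q)) $$ (i, j)) y"
    using D ij params_mem[OF ij] re[of "X i j"] im[of "Y i j"]
    by (cases "D $$ (i, j)") (auto simp: param_mat_def intro!: real_analytic_at_add real_analytic_at_const)
  then show ?thesis unfolding simplest_entry[OF ij] .
qed

lemma simplest_R_deformation: "R_deformation n (num_params D) A (simplest_deformation A D e)"
  unfolding R_deformation_def
  by (intro conjI always_eventually allI impI simplest_carrier simplest_origin simplest_analytic real_analytic_at_coordinate)

end

end

subsection \<open>Versality\<close>

lemma tangent_cong:
  assumes "\<And>i j. i < n \<Longrightarrow> j < n \<Longrightarrow> C i j = C' i j" "i < n" "j < n"
  shows "tangent n a C i j = tangent n a C' i j"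
  unfolding tangent_def using assms by (intro arg_cong2[of _ _ _ _ "(+)"] sum.cong refl) auto

lemma finite_common_radius:
  fixes n :: nat
  assumes "\<And>i j. i < n \<Longrightarrow> j < n \<Longrightarrow> \<exists>\<rho>0>0. \<forall>\<rho>. 0 < \<rho> \<and> \<rho> \<le> \<rho>0 \<longrightarrow> P i j \<rho>"
  shows "\<exists>\<rho>>(0::real). \<forall>i<n. \<forall>j<n. P i j \<rho>"
proof -
  obtain R where R: "\<And>i j. i < n \<Longrightarrow> j < n \<Longrightarrow> R i j > 0 \<and> (\<forall>\<rho>. 0 < \<rho> \<and> \<rho> \<le> R i j \<longrightarrow> P i j \<rho>)"
    using assms by metis
  let ?S = "insert 1 ((\<lambda>(i, j). R i j) ` ({..<n} \<times> {..<n}))"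
  have fin: "finite ?S" by simp
  have "Min ?S > 0" using R by (subst Min_gr_iff[OF fin]) auto
  moreover have "Min ?S \<le> R i j" if "i < n" "j < n" for i j
    using that by (intro Min_le[OF fin]) auto
  ultimately show ?thesis using R by blast
qed

lemma origin_topspace: "origin \<in> topspace (Euclidean_space r)"
  by (simp add: topspace_Euclidean_space)

lemma near_topspace: "\<forall>\<^sub>F y in near r origin. y \<in> topspace (Euclidean_space r)"
  unfolding eventually_near_cube[OF origin_topspace] by (intro exI[of _ 1]) (auto simp: cube_def)

lemma eventually_near_origin: "eventually P (near r origin) \<Longrightarrow> P origin"
  unfolding eventually_near_cube[OF origin_topspace] by (auto simp: cube_def topspace_Euclidean_space)

lemma near_small:
  fixes f :: "(nat \<Rightarrow> real) \<Rightarrow> complex"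
  assumes "real_analytic_at r f origin" "f origin = 0" "\<eta> > 0"
  shows "\<forall>\<^sub>F y in near r origin. norm (f y) \<le> \<eta>"
proof -
  obtain \<rho> where \<rho>: "\<rho> > 0" "has_series r origin \<rho> (norm (f origin) + \<eta>) f"
    using analytic_imp_has_series[OF assms(1) origin_topspace assms(3)] by auto
  then show ?thesis
    unfolding eventually_near_cube[OF origin_topspace]
    using has_series_bound[OF \<rho>(2)] assms(2) by auto
qed

lemma eventually_all_less:
  fixes n :: nat
  shows "(\<And>i. i < n \<Longrightarrow> eventually (P i) F) \<Longrightarrow> eventually (\<lambda>x. \<forall>i<n. P i x) F"
  using eventually_ball_finite[of "{..<n}" "\<lambda>x i. P i x" F] by (auto simp: Ball_def)

lemma simplest_versal:
  assumes A: "A \<in> carrier_mat n n" and D: "D \<in> carrier_mat n n"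
    and e: "bij_betw e (params D) {..<num_params D}"
    and spanning: "\<And>W i j. (\<And>i j. i < n \<Longrightarrow> j < n \<Longrightarrow> cotangent n (\<lambda>i j. A $$ (i, j)) W i j = 0) \<Longrightarrow>
      (\<And>i j. i < n \<Longrightarrow> j < n \<Longrightarrow> dual_ok (D $$ (i, j)) (W i j)) \<Longrightarrow> i < n \<Longrightarrow> j < n \<Longrightarrow> W i j = 0"
  shows "versal n (num_params D) A (simplest_deformation A D e)"
  unfolding versal_def
proof (intro conjI allI impI simplest_R_deformation[OF D e A])
  fix s \<B> assume B: "R_deformation n s A \<B>"
  define a where "a = (\<lambda>i j. A $$ (i, j))"
  obtain \<alpha> \<beta> where op: "\<And>M i j. i < n \<Longrightarrow> j < n \<Longrightarrow> sym_ok (D $$ (i, j)) (M i j - tangent n a (real_linear_op n \<alpha> \<beta> M) i j)"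
    using tangent_complement_linear[of n a D] spanning unfolding a_def by blast
  obtain \<epsilon> C where \<epsilon>: "\<epsilon> > 0" and C0: "\<And>i j. C (\<lambda>_ _. 0) i j = 0"
    and C_series: "\<And>r p \<rho> E i j. \<rho> > 0 \<Longrightarrow> (\<And>i j. i < n \<Longrightarrow> j < n \<Longrightarrow> has_series r p \<rho> \<epsilon> (\<lambda>y. E y i j)) \<Longrightarrow> i < n \<Longrightarrow> j < n \<Longrightarrow>
      has_series r p \<rho> 1 (\<lambda>y. C (E y) i j)"
    and C_fixed: "\<And>r p \<rho> E y i j. \<rho> > 0 \<Longrightarrow> (\<And>i j. i < n \<Longrightarrow> j < n \<Longrightarrow> has_series r p \<rho> \<epsilon> (\<lambda>y. E y i j)) \<Longrightarrow> y \<in> cube r p \<rho> \<Longrightarrow>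
      i < n \<Longrightarrow> j < n \<Longrightarrow> C (E y) i j = - real_linear_op n \<alpha> \<beta> (congruence_error n a (E y) (C (E y))) i j"
    using congruence_solution[where n = n and a = a and \<alpha> = \<alpha> and \<beta> = \<beta>] by blast
  define E where "E = (\<lambda>y i j. \<B> y $$ (i, j) - a i j)"
  define S where "S = (\<lambda>y. mat n n (\<lambda>(i, j). (if i = j then 1 else 0) + C (E y) i j))"
  define N where "N = (\<lambda>y i j. (\<Sum>k<n. \<Sum>l<n. cnj ((if k = i then 1 else 0) + C (E y) k i) * (a k l + E y k l) *
      ((if l = j then 1 else 0) + C (E y) l j)) - a i j)"
  define par where "par = the_inv_into (params D) e"
  \<comment> \<open>Each parameter is read off the residual \<open>N\<close> as the real or
    imaginary part of the entry that names it; the value 0 beyond the number of parameters keeps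
    \<open>\<phi> y\<close> inside the parameter space.\<close>
  define \<phi> where "\<phi> = (\<lambda>y m. if m < num_params D then case par m of X k l \<Rightarrow> Re (N y k l) | Y k l \<Rightarrow> Im (N y k l) else 0)"
  define \<C> where "\<C> = (\<lambda>y. simplest_deformation A D e (\<phi> y))"
  \<comment> \<open>The points at which the Picard solution is analytic. All points near the origin
    qualify: there the entries of \<open>E\<close> are analytic with modulus at most
    \<open>\<epsilon> / 2\<close>, and a small radius adds at most another
    \<open>\<epsilon> / 2\<close> to the norm.\<close>
  define good where "good y \<longleftrightarrow> y \<in> topspace (Euclidean_space s) \<and> \<B> y \<in> carrier_mat n n \<and>
     (\<exists>\<rho>>0. \<forall>i<n. \<forall>j<n. has_series s y \<rho> \<epsilon> (\<lambda>z. E z i j))" for y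
  have E0: "E origin = (\<lambda>_ _. 0)"
    using B by (simp add: E_def a_def R_deformation_def)
  have E_analytic: "real_analytic_at s (\<lambda>z. E z i j) y" if "real_analytic_at s (\<lambda>z. \<B> z $$ (i, j)) y" for y i j
    using real_analytic_at_add[OF that real_analytic_at_const[of s "- a i j"]] by (simp add: E_def)
  have B_ev: "\<forall>\<^sub>F y in near s origin. \<B> y \<in> carrier_mat n n \<and> (\<forall>i<n. \<forall>j<n. real_analytic_at s (\<lambda>z. \<B> z $$ (i, j)) y)"
    using B by (simp add: R_deformation_def)
  have E_small: "\<forall>\<^sub>F y in near s origin. \<forall>i<n. \<forall>j<n. norm (E y i j) \<le> \<epsilon> / 2"
    using eventually_near_origin[OF B_ev] \<epsilon> E0
    by (intro eventually_all_less near_small E_analytic) auto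
  have good_ev: "\<forall>\<^sub>F y in near s origin. good y"
    using B_ev E_small near_topspace
  proof eventually_elim
    case (elim y)
    have "\<exists>\<rho>>0. \<forall>i<n. \<forall>j<n. has_series s y \<rho> \<epsilon> (\<lambda>z. E z i j)"
    proof (rule finite_common_radius)
      fix i j assume ij: "i < n" "j < n"
      then have "real_analytic_at s (\<lambda>z. E z i j) y" using elim by (intro E_analytic) auto
      from analytic_imp_has_series[OF this elim(3), of "\<epsilon> / 2"] \<epsilon>
      obtain \<rho>0 where "\<rho>0 > 0" "\<And>\<rho>. 0 < \<rho> \<and> \<rho> \<le> \<rho>0 \<Longrightarrow> has_series s y \<rho> (norm (E y i j) + \<epsilon> / 2) (\<lambda>z. E z i j)" by auto
      moreover have "norm (E y i j) + \<epsilon> / 2 \<le> \<epsilon>" using elim(2) ij by (metis field_sum_of_halves add_right_mono)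
      ultimately show "\<exists>\<rho>0>0. \<forall>\<rho>. 0 < \<rho> \<and> \<rho> \<le> \<rho>0 \<longrightarrow> has_series s y \<rho> \<epsilon> (\<lambda>z. E z i j)"
        using has_series_mono by blast
    qed
    then show ?case using elim unfolding good_def by blast
  qed
  have S_carrier: "S y \<in> carrier_mat n n" for y by (simp add: S_def)
  have S_series: "has_series s y \<rho> 2 (\<lambda>z. (if i = j then 1 else 0) + C (E z) i j)"
    if "\<rho> > 0" "\<forall>i<n. \<forall>j<n. has_series s y \<rho> \<epsilon> (\<lambda>z. E z i j)" "i < n" "j < n" for y \<rho> i j
  proof (rule has_series_mono)
    show "has_series s y \<rho> (norm (if i = j then 1 else 0 :: complex) + 1) (\<lambda>z. (if i = j then 1 else 0) + C (E z) i j)"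
      by (rule has_series_add[OF has_series_const[OF that(1)] C_series[OF that(1) _ that(3,4)] that(1)])
        (rule that(2)[rule_format])
  qed simp
  have S_analytic: "real_analytic_at s (\<lambda>z. S z $$ (i, j)) y" if "good y" "i < n" "j < n" for y i j
  proof -
    from that(1)[unfolded good_def] obtain \<rho> where \<rho>: "\<rho> > 0" "\<forall>i<n. \<forall>j<n. has_series s y \<rho> \<epsilon> (\<lambda>z. E z i j)"
      by (elim conjE exE)
    have "real_analytic_at s (\<lambda>z. (if i = j then 1 else 0) + C (E z) i j) y"
      by (rule has_series_imp_analytic[OF S_series[OF \<rho> that(2,3)] \<rho>(1)])
    then show ?thesis using that(2,3) by (simp add: S_def)
  qed
  have N_analytic: "real_analytic_at s (\<lambda>z. N z i j) y" if "good y" "i < n" "j < n" for y i j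
  proof -
    from that(1)[unfolded good_def] obtain \<rho> where \<rho>: "\<rho> > 0" "\<forall>i<n. \<forall>j<n. has_series s y \<rho> \<epsilon> (\<lambda>z. E z i j)"
      by (elim conjE exE)
    note C1 = S_series[OF \<rho>]
    define K where "K = (\<Sum>k<n. \<Sum>l<n. norm (a k l))"
    have K: "norm (a k l) \<le> K" if "k < n" "l < n" for k l
    proof -
      have "norm (a k l) \<le> (\<Sum>l<n. norm (a k l))" using that by (intro member_le_sum) auto
      also have "\<dots> \<le> K" unfolding K_def using that by (intro member_le_sum) (auto intro: sum_nonneg)
      finally show ?thesis .
    qed
    have aE: "has_series s y \<rho> (K + \<epsilon>) (\<lambda>z. a k l + E z k l)" if "k < n" "l < n" for k l
      by (rule has_series_mono[OF has_series_add[OF has_series_const[OF \<rho>(1)] \<rho>(2)[rule_format, OF that] \<rho>(1)]])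
        (use K[OF that] in simp)
    have "has_series s y \<rho> (real n * (real n * (2 * (K + \<epsilon>) * 2)) + norm (- a i j)) (\<lambda>z. (\<Sum>k<n. \<Sum>l<n. cnj ((if k = i then 1 else 0) + C (E z) k i) * (a k l + E z k l) *
      ((if l = j then 1 else 0) + C (E z) l j)) + (- a i j))"
      by (intro has_series_add has_series_const has_series_sum has_series_mult has_series_cnj C1 aE \<rho>(1) that)
    then have "has_series s y \<rho> (real n * (real n * (2 * (K + \<epsilon>) * 2)) + norm (- a i j)) (\<lambda>z. N z i j)"
      unfolding N_def by simp
    then show ?thesis using \<rho>(1) by (rule has_series_imp_analytic)
  qed
  have N_ok: "sym_ok (D $$ (i, j)) (N y i j)" if "good y" "i < n" "j < n" for y i j
  proof -
    from that(1)[unfolded good_def] obtain \<rho> where \<rho>: "\<rho> > 0" "\<forall>i<n. \<forall>j<n. has_series s y \<rho> \<epsilon> (\<lambda>z. E z i j)"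
      and y: "y \<in> topspace (Euclidean_space s)"
      by (elim conjE exE)
    have "y \<in> cube s y \<rho>" using y \<rho>(1) by (simp add: cube_def)
    \<comment> \<open>Writing \<open>L\<close> for \<open>real_linear_op\<close>, the fixed point
      equation \<open>C = - L Q\<close> makes the residual equal to
      \<open>Q - tangent (L Q)\<close>, which lies in the pattern by the choice of
      \<open>L\<close>.\<close>
    define Q where "Q = congruence_error n a (E y) (C (E y))"
    have "C (E y) i j = - real_linear_op n \<alpha> \<beta> Q i j" if "i < n" "j < n" for i j
      unfolding Q_def by (rule C_fixed[OF \<rho>(1) _ \<open>y \<in> cube s y \<rho>\<close> that]) (rule \<rho>(2)[rule_format])
    then have "tangent n a (C (E y)) i j = tangent n a (\<lambda>i j. complex_of_real (-1) * real_linear_op n \<alpha> \<beta> Q i j) i j"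
      using that(2,3) by (intro tangent_cong) auto
    also have "\<dots> = - tangent n a (real_linear_op n \<alpha> \<beta> Q) i j"
      unfolding tangent_scale by simp
    finally have "N y i j = Q i j - tangent n a (real_linear_op n \<alpha> \<beta> Q) i j"
      unfolding N_def congruence_expansion[OF that(2,3)] Q_def by simp
    then show ?thesis using op[OF that(2,3), of Q] by simp
  qed
  have par: "par m \<in> params D \<and> e (par m) = m" if "m < num_params D" for m
    using that e unfolding par_def bij_betw_def by (metis f_the_inv_into_f lessThan_iff the_inv_into_into subset_refl)
  have par_bounds: "k < n \<and> l < n" if "X k l \<in> params D \<or> Y k l \<in> params D" for k l
    using that D by (auto simp: params_def)
  have \<phi>_par: "\<phi> y (e q) = (case q of X k l \<Rightarrow> Re (N y k l) | Y k l \<Rightarrow> Im (N y k l))" if "q \<in> params D" for y q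
    using that param_less[OF D e that] e unfolding \<phi>_def par_def bij_betw_def by (simp add: the_inv_into_f_f)
  have \<phi>_top: "\<phi> y \<in> topspace (Euclidean_space (num_params D))" for y
    by (simp add: topspace_Euclidean_space \<phi>_def)
  have \<phi>_analytic: "real_analytic_at s (\<lambda>z. \<phi> z m) y" if "good y" "m < num_params D" for y m
  proof (cases "par m")
    case (X k l)
    then have "k < n" "l < n" using par[OF that(2)] par_bounds by auto
    from real_analytic_at_linear[OF bounded_linear_Re N_analytic[OF that(1) this]]
    show ?thesis using that(2) X by (simp add: \<phi>_def)
  next
    case (Y k l)
    then have "k < n" "l < n" using par[OF that(2)] par_bounds by auto
    from real_analytic_at_linear[OF bounded_linear_Im N_analytic[OF that(1) this]]
    show ?thesis using that(2) Y by (simp add: \<phi>_def)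
  qed
  have N0: "N origin k l = 0" if "k < n" "l < n" for k l
    unfolding N_def congruence_expansion[OF that] by (simp add: E0 tangent_def congruence_error_def C0)
  have \<phi>0: "\<phi> origin = origin"
  proof
    fix m
    show "\<phi> origin m = 0"
    proof (cases "m < num_params D")
      case True
      note * = par[OF True]
      show ?thesis
      proof (cases "par m")
        case (X k l)
        then have "k < n \<and> l < n" using * par_bounds[of k l] by simp
        then show ?thesis using N0[of k l] X by (simp add: \<phi>_def)
      next
        case (Y k l)
        then have "k < n \<and> l < n" using * par_bounds[of k l] by simp
        then show ?thesis using N0[of k l] Y by (simp add: \<phi>_def)
      qed
    qed (simp add: \<phi>_def)
  qed
  have C_entry: "\<C> y $$ (i, j) = a i j + N y i j" if "good y" "i < n" "j < n" for y i j
  proof -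
    have "param_mat D (\<lambda>q. \<phi> y (e q)) $$ (i, j) = N y i j"
      by (rule param_mat_surj[OF D e that(2,3) N_ok[OF that]]) (simp_all add: \<phi>_par)
    then show ?thesis unfolding \<C>_def simplest_entry[OF D e A that(2,3)] a_def by simp
  qed
  have C_def: "R_deformation n s A \<C>"
    unfolding R_deformation_def
  proof
    show "\<forall>\<^sub>F x in near s origin. \<C> x \<in> carrier_mat n n \<and> (\<forall>i<n. \<forall>j<n. real_analytic_at s (\<lambda>y. \<C> y $$ (i, j)) x)"
      using good_ev by eventually_elim (auto simp: \<C>_def intro!: simplest_carrier[OF D e A] simplest_analytic[OF D e A] \<phi>_analytic)
    show "\<C> origin = A" unfolding \<C>_def \<phi>0 by (rule simplest_origin[OF D e A])
  qed
  have "star_congruent n s \<B> \<C>"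
    unfolding star_congruent_def
  proof (intro exI conjI)
    show "R_deformation n s (1\<^sub>m n) S"
      unfolding R_deformation_def
    proof
      show "\<forall>\<^sub>F x in near s origin. S x \<in> carrier_mat n n \<and> (\<forall>i<n. \<forall>j<n. real_analytic_at s (\<lambda>y. S y $$ (i, j)) x)"
        using good_ev by eventually_elim (auto intro: S_analytic S_carrier)
      show "S origin = 1\<^sub>m n" unfolding S_def E0 by (rule eq_matI) (auto simp: C0)
    qed
    show "\<forall>\<^sub>F y in near s origin. mat_adjoint (S y) * \<B> y * S y = \<C> y"
      using good_ev
    proof eventually_elim
      case (elim y)
      have By: "\<B> y \<in> carrier_mat n n" using elim by (simp add: good_def)
      have adj: "mat_adjoint (S y) \<in> carrier_mat n n" using S_carrier[of y] by (auto simp: mat_adjoint_def)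
      show ?case
      proof (rule eq_matI)
        fix i j assume "i < dim_row (\<C> y)" "j < dim_col (\<C> y)"
        then have ij: "i < n" "j < n" using simplest_carrier[OF D e A, of "\<phi> y"] by (auto simp: \<C>_def)
        have "(mat_adjoint (S y) * \<B> y * S y) $$ (i, j) = (\<Sum>k<n. \<Sum>l<n. cnj (S y $$ (k, i)) * \<B> y $$ (k, l) * S y $$ (l, j))"
          by (rule adjoint_congruence_entry[OF S_carrier By ij])
        also have "\<dots> = a i j + N y i j"
          unfolding N_def using ij by (simp add: S_def E_def)
        finally show "(mat_adjoint (S y) * \<B> y * S y) $$ (i, j) = \<C> y $$ (i, j)"
          using C_entry[OF elim ij] by simp
      qed (use simplest_carrier[OF D e A, of "\<phi> y"] S_carrier[of y] adj in \<open>auto simp: \<C>_def\<close>)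
    qed
  qed
  moreover have "embedded s \<C> (num_params D) (simplest_deformation A D e)"
    unfolding embedded_def
    by (intro exI[of _ \<phi>] conjI \<phi>0 eventually_mono[OF good_ev]) (auto simp: \<phi>_top \<phi>_analytic \<C>_def)
  ultimately show "\<exists>\<C>. R_deformation n s A \<C> \<and> star_congruent n s \<B> \<C> \<and> embedded s \<C> (num_params D) (simplest_deformation A D e)"
    using C_def by blast
qed
subsection \<open>Minimality\<close>

lemma underdetermined_system:
  fixes g :: "nat \<Rightarrow> 'j \<Rightarrow> real"
  assumes "finite J" "r < card J"
  shows "\<exists>v. (\<exists>j\<in>J. v j \<noteq> 0) \<and> (\<forall>i<r. (\<Sum>j\<in>J. v j * g i j) = 0)"
  using assms
proof (induction r arbitrary: J g)
  case 0
  then obtain j where "j \<in> J" by fastforce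
  then show ?case by (intro exI[of _ "\<lambda>_. 1"]) auto
next
  case (Suc r)
  show ?case
  proof (cases "\<forall>j\<in>J. g r j = 0")
    case True
    obtain v where v: "\<exists>j\<in>J. v j \<noteq> 0" "\<forall>i<r. (\<Sum>j\<in>J. v j * g i j) = 0"
      using Suc.IH[OF Suc.prems(1), of g] Suc.prems(2) by auto
    moreover have "(\<Sum>j\<in>J. v j * g r j) = 0" using True by simp
    ultimately show ?thesis by (auto simp: less_Suc_eq)
  next
    case False
    then obtain j0 where j0: "j0 \<in> J" "g r j0 \<noteq> 0" by blast
    define g' where "g' = (\<lambda>i j. g i j - g i j0 * g r j / g r j0)"
    have "finite (J - {j0})" "r < card (J - {j0})" using j0 Suc.prems by simp_all
    from Suc.IH[OF this, of g']
    obtain v where v: "\<exists>j\<in>J - {j0}. v j \<noteq> 0" "\<forall>i<r. (\<Sum>j\<in>J - {j0}. v j * g' i j) = 0"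
      by (elim exE conjE)
    define w where "w = v(j0 := - (\<Sum>j\<in>J - {j0}. v j * g r j) / g r j0)"
    have w: "(\<Sum>j\<in>J. w j * g i j) = - (\<Sum>j\<in>J - {j0}. v j * g r j) / g r j0 * g i j0 + (\<Sum>j\<in>J - {j0}. v j * g i j)" for i
    proof -
      have "(\<Sum>j\<in>J. w j * g i j) = w j0 * g i j0 + (\<Sum>j\<in>J - {j0}. w j * g i j)"
        using j0 Suc.prems by (intro sum.remove) auto
      moreover have "(\<Sum>j\<in>J - {j0}. w j * g i j) = (\<Sum>j\<in>J - {j0}. v j * g i j)"
        by (intro sum.cong) (auto simp: w_def)
      ultimately show ?thesis by (simp add: w_def)
    qed
    have "(\<Sum>j\<in>J. w j * g i j) = 0" if "i < Suc r" for i
    proof (cases "i = r")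
      case True
      then show ?thesis unfolding w using j0 by simp
    next
      case False
      then have "(\<Sum>j\<in>J - {j0}. v j * g' i j) = 0" using v(2) that by simp
      moreover have "(\<Sum>j\<in>J - {j0}. v j * g' i j) = (\<Sum>j\<in>J - {j0}. v j * g i j) - (\<Sum>j\<in>J - {j0}. v j * g r j) * (g i j0 / g r j0)"
        unfolding g'_def sum_distrib_right sum_subtractf[symmetric] by (intro sum.cong refl) (simp add: algebra_simps)
      ultimately show ?thesis unfolding w by simp
    qed
    moreover have "\<exists>j\<in>J. w j \<noteq> 0" using v(1) by (auto simp: w_def)
    ultimately show ?thesis by blast
  qed
qed

section \<open>First-order behaviour along rays\<close>

definition quadratically_small :: "(real \<Rightarrow> 'a :: real_normed_vector) \<Rightarrow> bool" where
  "quadratically_small g \<longleftrightarrow> (\<exists>K \<delta>. \<delta> > 0 \<and> (\<forall>t. \<bar>t\<bar> < \<delta> \<longrightarrow> norm (g t) \<le> K * t\<^sup>2))"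

lemma quadratically_smallI:
  "\<delta> > 0 \<Longrightarrow> (\<And>t. \<bar>t\<bar> < \<delta> \<Longrightarrow> norm (g t) \<le> K * t\<^sup>2) \<Longrightarrow> quadratically_small g"
  unfolding quadratically_small_def by blast

lemma has_vector_derivative_quadratic:
  fixes f :: "real \<Rightarrow> complex"
  assumes "quadratically_small (\<lambda>t. f t - f 0 - t *\<^sub>R L)"
  shows "(f has_vector_derivative L) (at 0)"
  unfolding has_vector_derivative_def has_derivative_at
proof
  obtain \<delta> K where \<delta>: "\<delta> > 0" and bound: "\<And>t. \<bar>t\<bar> < \<delta> \<Longrightarrow> norm (f t - f 0 - t *\<^sub>R L) \<le> K * t\<^sup>2"
    using assms unfolding quadratically_small_def by blast
  show "bounded_linear (\<lambda>t. t *\<^sub>R L)" by (rule bounded_linear_scaleR_left)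
  have ev: "\<forall>\<^sub>F h in at 0. norm (norm (f (0 + h) - f 0 - h *\<^sub>R L) / norm h) \<le> \<bar>K\<bar> * \<bar>h\<bar>"
    unfolding eventually_at
  proof (intro exI[of _ \<delta>] conjI ballI impI)
    fix h :: real assume h: "h \<noteq> 0 \<and> dist h 0 < \<delta>"
    have "norm (f h - f 0 - h *\<^sub>R L) \<le> K * h\<^sup>2" using h by (intro bound) simp
    also have "\<dots> \<le> \<bar>K\<bar> * \<bar>h\<bar> * \<bar>h\<bar>" by (simp add: power2_eq_square abs_le_iff mult.assoc mult_right_mono)
    finally show "norm (norm (f (0 + h) - f 0 - h *\<^sub>R L) / norm h) \<le> \<bar>K\<bar> * \<bar>h\<bar>"
      using h by (simp add: pos_divide_le_eq)
  qed (rule \<delta>)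
  have "((\<lambda>h::real. \<bar>K\<bar> * \<bar>h\<bar>) \<longlongrightarrow> \<bar>K\<bar> * \<bar>0\<bar>) (at 0)" by (intro tendsto_intros)
  then show "(\<lambda>h. norm (f (0 + h) - f 0 - h *\<^sub>R L) / norm h) \<midarrow>0\<rightarrow> 0"
    by (intro Lim_null_comparison[OF ev]) simp
qed

text \<open>Cut off at \<open>d\<close>, so that the ray lies in the parameter space for every
  function \<open>v\<close>.\<close>

definition ray :: "nat \<Rightarrow> (nat \<Rightarrow> real) \<Rightarrow> real \<Rightarrow> nat \<Rightarrow> real" where
  "ray d v t = (\<lambda>j. if j < d then t * v j else 0)"

definition ray_radius :: "nat \<Rightarrow> (nat \<Rightarrow> real) \<Rightarrow> real" where
  "ray_radius d v = 1 + (\<Sum>j<d. \<bar>v j\<bar>)"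

lemma ray_radius_pos: "ray_radius d v > 0"
  unfolding ray_radius_def by (intro add_pos_nonneg sum_nonneg) auto

lemma ray_in_cube: "ray d v t \<in> cube d origin (\<bar>t\<bar> * ray_radius d v)"
proof -
  have "\<bar>v i\<bar> \<le> ray_radius d v" if "i < d" for i
    using member_le_sum[of i "{..<d}" "\<lambda>j. \<bar>v j\<bar>"] that by (simp add: ray_radius_def)
  then show ?thesis by (auto simp: cube_def ray_def topspace_Euclidean_space abs_mult mult_left_mono)
qed

lemma ray_eventually:
  assumes "eventually P (near d origin)"
  obtains \<delta> where "\<delta> > 0" "\<And>t. \<bar>t\<bar> < \<delta> \<Longrightarrow> P (ray d v t)"
proof -
  obtain \<rho> where \<rho>: "\<rho> > 0" "\<And>x. x \<in> cube d origin \<rho> \<Longrightarrow> P x"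
    using assms unfolding eventually_near_cube[OF origin_topspace] by blast
  show ?thesis
  proof (rule that[of "\<rho> / ray_radius d v"])
    show "\<rho> / ray_radius d v > 0" using \<rho>(1) ray_radius_pos by simp
    fix t assume "\<bar>t\<bar> < \<rho> / ray_radius d v"
    then have "\<bar>t\<bar> * ray_radius d v \<le> \<rho>" using ray_radius_pos[of d v] by (simp add: pos_less_divide_eq)
    then show "P (ray d v t)" using ray_in_cube[of d v t] by (intro \<rho>(2)) (force simp: cube_def)
  qed
qed

text \<open>The coefficients are fixed before the direction, so that a direction in the common
  kernel of several coordinates can be chosen afterwards.\<close>

lemma analytic_along_ray:
  fixes f :: "(nat \<Rightarrow> real) \<Rightarrow> complex"
  assumes "real_analytic_at d f origin"
  obtains c where "\<And>v. quadratically_small (\<lambda>t. f (ray d v t) - f origin - t *\<^sub>R (\<Sum>i<d. v i *\<^sub>R c i))"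
proof -
  obtain c K R where R: "R > 0" "K \<ge> 0" and K:
    "\<And>x h. x \<in> cube d origin h \<Longrightarrow> 0 \<le> h \<Longrightarrow> h \<le> R \<Longrightarrow> norm (f x - f origin - (\<Sum>i<d. x i *\<^sub>R c i)) \<le> K * h\<^sup>2"
    by (rule analytic_first_order[OF assms]) (rule that, assumption+)
  show ?thesis
  proof (rule that)
    fix v
    let ?\<delta> = "R / ray_radius d v"
    have "norm (f (ray d v t) - f origin - t *\<^sub>R (\<Sum>i<d. v i *\<^sub>R c i)) \<le> K * (ray_radius d v)\<^sup>2 * t\<^sup>2" if "\<bar>t\<bar> < ?\<delta>" for t
    proof -
      have "\<bar>t\<bar> * ray_radius d v \<le> R" using that ray_radius_pos[of d v] by (simp add: pos_less_divide_eq)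
      from K[OF ray_in_cube _ this]
      have "norm (f (ray d v t) - f origin - (\<Sum>i<d. ray d v t i *\<^sub>R c i)) \<le> K * (\<bar>t\<bar> * ray_radius d v)\<^sup>2"
        using ray_radius_pos[of d v] by simp
      moreover have "(\<Sum>i<d. ray d v t i *\<^sub>R c i) = t *\<^sub>R (\<Sum>i<d. v i *\<^sub>R c i)"
        by (simp add: ray_def scaleR_sum_right)
      ultimately show ?thesis by (simp add: power_mult_distrib mult_ac)
    qed
    then show "quadratically_small (\<lambda>t. f (ray d v t) - f origin - t *\<^sub>R (\<Sum>i<d. v i *\<^sub>R c i))"
      by (rule quadratically_smallI[OF divide_pos_pos[OF R(1) ray_radius_pos]])
  qed
qed

lemma ray_0: "ray d v 0 = origin"
  by (simp add: ray_def fun_eq_iff)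

lemma analytic_ray_derivative:
  fixes f :: "(nat \<Rightarrow> real) \<Rightarrow> complex"
  assumes "real_analytic_at d f origin"
  shows "\<exists>L. ((\<lambda>t. f (ray d v t)) has_vector_derivative L) (at 0)"
proof -
  obtain c where c: "\<And>v. quadratically_small (\<lambda>t. f (ray d v t) - f origin - t *\<^sub>R (\<Sum>i<d. v i *\<^sub>R c i))"
    by (rule analytic_along_ray[OF assms]) (rule that)
  have "quadratically_small (\<lambda>t. f (ray d v t) - f (ray d v 0) - t *\<^sub>R (\<Sum>i<d. v i *\<^sub>R c i))"
    unfolding ray_0 by (rule c)
  then show ?thesis by (intro exI) (rule has_vector_derivative_quadratic)
qed

text \<open>The inner map is of second order in \<open>t\<close>, and \<open>f\<close> differs from
  its value at the origin by a linear term and a quadratic remainder; the composite therefore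
  deviates only to second order.\<close>

lemma composite_ray_derivative_zero:
  fixes f :: "(nat \<Rightarrow> real) \<Rightarrow> complex"
  assumes f: "real_analytic_at r f origin" and \<phi>0: "\<phi> origin = origin" and "\<delta> > 0"
    and top: "\<And>t. \<bar>t\<bar> < \<delta> \<Longrightarrow> \<phi> (ray d v t) \<in> topspace (Euclidean_space r)"
    and small: "\<And>i. i < r \<Longrightarrow> quadratically_small (\<lambda>t. \<phi> (ray d v t) i)"
  shows "((\<lambda>t. f (\<phi> (ray d v t))) has_vector_derivative 0) (at 0)"
proof -
  obtain c K R where R: "R > 0" "K \<ge> 0" and K:
    "\<And>x h. x \<in> cube r origin h \<Longrightarrow> 0 \<le> h \<Longrightarrow> h \<le> R \<Longrightarrow> norm (f x - f origin - (\<Sum>i<r. x i *\<^sub>R c i)) \<le> K * h\<^sup>2"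
    by (rule analytic_first_order[OF f]) (rule that, assumption+)
  obtain k e where ke: "\<And>i. i < r \<Longrightarrow> e i > 0 \<and> (\<forall>t. \<bar>t\<bar> < e i \<longrightarrow> \<bar>\<phi> (ray d v t) i\<bar> \<le> k i * t\<^sup>2)"
  proof -
    have "\<forall>i. \<exists>K \<delta>. i < r \<longrightarrow> \<delta> > 0 \<and> (\<forall>t. \<bar>t\<bar> < \<delta> \<longrightarrow> \<bar>\<phi> (ray d v t) i\<bar> \<le> K * t\<^sup>2)"
      using small unfolding quadratically_small_def real_norm_def by blast
    then show ?thesis using that by metis
  qed
  define Q where "Q = (\<Sum>i<r. \<bar>k i\<bar>) + 1"
  have Q: "Q > 0" unfolding Q_def by (intro add_nonneg_pos sum_nonneg) auto
  \<comment> \<open>A radius common to all coordinates. The bound 1 gives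
    \<open>t\<^sup>2 \<le> \<bar>t\<bar>\<close>, and \<open>R / Q\<close> then keeps the argument
    of \<open>f\<close> within the cube of radius \<open>R\<close>.\<close>
  define e0 where "e0 = Min (insert (min \<delta> (min 1 (R / Q))) (e ` {..<r}))"
  have e0: "e0 > 0" "e0 \<le> \<delta>" "e0 \<le> 1" "e0 \<le> R / Q" "\<And>i. i < r \<Longrightarrow> e0 \<le> e i"
  proof -
    have fin: "finite (insert (min \<delta> (min 1 (R / Q))) (e ` {..<r}))" by simp
    show "e0 > 0" unfolding e0_def using ke R Q \<open>\<delta> > 0\<close> by (subst Min_gr_iff[OF fin]) auto
    have "e0 \<le> min \<delta> (min 1 (R / Q))" unfolding e0_def by (intro Min_le[OF fin]) auto
    then show "e0 \<le> \<delta>" "e0 \<le> 1" "e0 \<le> R / Q" by auto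
    show "e0 \<le> e i" if "i < r" for i unfolding e0_def using that by (intro Min_le[OF fin]) auto
  qed
  have "norm (f (\<phi> (ray d v t)) - f (\<phi> (ray d v 0)) - t *\<^sub>R 0) \<le> ((\<Sum>i<r. norm (c i)) * Q + K * Q * R) * t\<^sup>2" if t: "\<bar>t\<bar> < e0" for t
  proof -
    let ?w = "\<phi> (ray d v t)"
    have "\<bar>t\<bar> * \<bar>t\<bar> \<le> \<bar>t\<bar> * 1" using t e0(3) by (intro mult_left_mono) auto
    then have tt: "t\<^sup>2 \<le> \<bar>t\<bar>" by (simp add: power2_eq_square)
    have w: "\<bar>?w i\<bar> \<le> Q * t\<^sup>2" if "i < r" for i
    proof -
      have "\<bar>?w i\<bar> \<le> k i * t\<^sup>2" using ke[OF that] t e0(5)[OF that] by auto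
      also have "k i \<le> Q" using member_le_sum[of i "{..<r}" "\<lambda>i. \<bar>k i\<bar>"] that by (simp add: Q_def)
      then have "k i * t\<^sup>2 \<le> Q * t\<^sup>2" by (rule mult_right_mono) simp
      finally show ?thesis .
    qed
    have "?w \<in> cube r origin (Q * t\<^sup>2)" using top[of t] t e0(2) w by (auto simp: cube_def)
    moreover have h0: "0 \<le> Q * t\<^sup>2" using Q by simp
    moreover have hR: "Q * t\<^sup>2 \<le> R"
    proof -
      have "t\<^sup>2 \<le> R / Q" using tt t e0(4) by linarith
      then show ?thesis using Q by (simp add: pos_le_divide_eq mult.commute)
    qed
    ultimately have "norm (f ?w - f origin - (\<Sum>i<r. ?w i *\<^sub>R c i)) \<le> K * (Q * t\<^sup>2)\<^sup>2" by (rule K)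
    also have "\<dots> \<le> K * Q * R * t\<^sup>2"
      using mult_left_mono[OF hR, of "K * Q * t\<^sup>2"] R Q by (simp add: power2_eq_square mult_ac)
    finally have 1: "norm (f ?w - f origin - (\<Sum>i<r. ?w i *\<^sub>R c i)) \<le> K * Q * R * t\<^sup>2" .
    have 2: "norm (\<Sum>i<r. ?w i *\<^sub>R c i) \<le> (\<Sum>i<r. norm (c i)) * Q * t\<^sup>2"
      unfolding sum_distrib_right
    proof (rule sum_norm_le)
      fix i assume "i \<in> {..<r}"
      then show "norm (?w i *\<^sub>R c i) \<le> norm (c i) * Q * t\<^sup>2"
        using mult_right_mono[OF w[of i], of "norm (c i)"] by (simp add: mult_ac)
    qed
    have "norm (f ?w - f origin) \<le> norm (f ?w - f origin - (\<Sum>i<r. ?w i *\<^sub>R c i)) + norm (\<Sum>i<r. ?w i *\<^sub>R c i)"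
      by (metis diff_add_cancel norm_triangle_ineq)
    then show ?thesis using 1 2 unfolding ray_0 \<phi>0 by (simp add: algebra_simps)
  qed
  with e0(1) have "quadratically_small (\<lambda>t. f (\<phi> (ray d v t)) - f (\<phi> (ray d v 0)) - t *\<^sub>R 0)"
    by (rule quadratically_smallI)
  then show ?thesis by (rule has_vector_derivative_quadratic)
qed

lemma congruence_derivative:
  fixes S B :: "real \<Rightarrow> nat \<Rightarrow> nat \<Rightarrow> complex"
  assumes S: "\<And>i j. i < n \<Longrightarrow> j < n \<Longrightarrow> ((\<lambda>t. S t i j) has_vector_derivative S' i j) (at 0)"
    and S0: "\<And>i j. i < n \<Longrightarrow> j < n \<Longrightarrow> S 0 i j = (if i = j then 1 else 0)"
    and B: "\<And>i j. i < n \<Longrightarrow> j < n \<Longrightarrow> ((\<lambda>t. B t i j) has_vector_derivative B' i j) (at 0)"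
    and B0: "\<And>i j. i < n \<Longrightarrow> j < n \<Longrightarrow> B 0 i j = a i j"
    and ij: "i < n" "j < n"
  shows "((\<lambda>t. \<Sum>k<n. \<Sum>l<n. cnj (S t k i) * B t k l * S t l j) has_vector_derivative (tangent n a S' i j + B' i j)) (at 0)"
proof -
  have "((\<lambda>t. \<Sum>k<n. \<Sum>l<n. cnj (S t k i) * B t k l * S t l j) has_vector_derivative
      (\<Sum>k<n. \<Sum>l<n. cnj (S 0 k i) * B 0 k l * S' l j + (cnj (S 0 k i) * B' k l + cnj (S' k i) * B 0 k l) * S 0 l j)) (at 0)"
    by (intro has_vector_derivative_sum has_vector_derivative_mult bounded_linear.has_vector_derivative[OF bounded_linear_cnj] S B ij) auto
  also have "(\<Sum>k<n. \<Sum>l<n. cnj (S 0 k i) * B 0 k l * S' l j + (cnj (S 0 k i) * B' k l + cnj (S' k i) * B 0 k l) * S 0 l j) =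
      (\<Sum>k<n. \<Sum>l<n. (if k = i then a k l * S' l j else 0) + (if l = j then (if k = i then B' k l else 0) else 0) + (if l = j then cnj (S' k i) * a k l else 0))"
    by (intro sum.cong refl) (use ij in \<open>auto simp: S0 B0\<close>)
  also have "\<dots> = tangent n a S' i j + B' i j"
  proof -
    have "(\<Sum>k<n. \<Sum>l<n. if k = i then a k l * S' l j else 0) = (\<Sum>l<n. a i l * S' l j)"
      by (subst sum.swap) (use ij in simp)
    then show ?thesis using ij by (simp add: sum.distrib tangent_def)
  qed
  finally show ?thesis .
qed

lemma no_smaller_versal:
  assumes A: "A \<in> carrier_mat n n" and D: "D \<in> carrier_mat n n"
    and e: "bij_betw e (params D) {..<num_params D}"
    and transversal: "\<And>C i j. (\<And>i j. i < n \<Longrightarrow> j < n \<Longrightarrow> sym_ok (D $$ (i, j)) (tangent n (\<lambda>i j. A $$ (i, j)) C i j)) \<Longrightarrow>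
      i < n \<Longrightarrow> j < n \<Longrightarrow> tangent n (\<lambda>i j. A $$ (i, j)) C i j = 0"
    and r: "r < num_params D"
  shows "\<not> versal n r A \<A>"
proof
  assume v: "versal n r A \<A>"
  define d where "d = num_params D"
  define a where "a = (\<lambda>i j. A $$ (i, j))"
  let ?B = "simplest_deformation A D e"
  obtain \<C> where "star_congruent n d ?B \<C>" "embedded d \<C> r \<A>"
    using v simplest_R_deformation[OF D e A] unfolding versal_def d_def by blast
  then obtain S \<phi> where S: "R_deformation n d (1\<^sub>m n) S"
    and cong: "\<forall>\<^sub>F x in near d origin. mat_adjoint (S x) * ?B x * S x = \<C> x"
    and \<phi>: "\<forall>\<^sub>F y in near d origin. \<phi> y \<in> topspace (Euclidean_space r) \<and> (\<forall>i<r. real_analytic_at d (\<lambda>z. \<phi> z i) y)"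
    and \<phi>0: "\<phi> origin = origin" and emb: "\<forall>\<^sub>F y in near d origin. \<C> y = \<A> (\<phi> y)"
    unfolding star_congruent_def embedded_def by blast
  have S_ev: "\<forall>\<^sub>F x in near d origin. S x \<in> carrier_mat n n \<and> (\<forall>i<n. \<forall>j<n. real_analytic_at d (\<lambda>y. S y $$ (i, j)) x)"
    and S0: "S origin = 1\<^sub>m n"
    using S unfolding R_deformation_def by auto
  have A_analytic: "real_analytic_at r (\<lambda>y. \<A> y $$ (i, j)) origin" if "i < n" "j < n" for i j
    using v eventually_near_origin that unfolding versal_def R_deformation_def by blast
  \<comment> \<open>The expansion along rays is stated for complex values, so the real coordinates
    are embedded; of the coefficients obtained only the real parts matter.\<close>
  have \<phi>_analytic: "real_analytic_at d (\<lambda>z. complex_of_real (\<phi> z i)) origin" if "i < r" for i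
    using eventually_near_origin[OF \<phi>] that by (intro real_analytic_at_linear[OF bounded_linear_of_real]) blast
  have "\<forall>i. \<exists>c. i < r \<longrightarrow> (\<forall>v. quadratically_small (\<lambda>t. complex_of_real (\<phi> (ray d v t) i) -
      complex_of_real (\<phi> origin i) - t *\<^sub>R (\<Sum>j<d. v j *\<^sub>R c j)))"
  proof
    fix i
    show "\<exists>c. i < r \<longrightarrow> (\<forall>v. quadratically_small (\<lambda>t. complex_of_real (\<phi> (ray d v t) i) -
      complex_of_real (\<phi> origin i) - t *\<^sub>R (\<Sum>j<d. v j *\<^sub>R c j)))"
    proof (cases "i < r")
      case True
      obtain c where "\<And>v. quadratically_small (\<lambda>t. complex_of_real (\<phi> (ray d v t) i) -
          complex_of_real (\<phi> origin i) - t *\<^sub>R (\<Sum>j<d. v j *\<^sub>R c j))"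
        by (rule analytic_along_ray[OF \<phi>_analytic[OF True]]) (rule that)
      then show ?thesis by (intro exI[of _ c] impI allI)
    qed simp
  qed
  from choice[OF this] obtain c where c': "\<forall>i. i < r \<longrightarrow> (\<forall>v. quadratically_small (\<lambda>t. complex_of_real (\<phi> (ray d v t) i) -
      complex_of_real (\<phi> origin i) - t *\<^sub>R (\<Sum>j<d. v j *\<^sub>R c i j)))"
    by (rule exE)
  note c = c'[rule_format]
  \<comment> \<open>There are \<open>r\<close> real linear conditions on \<open>d > r\<close>
    unknowns. Along the resulting direction every coordinate of \<open>\<phi>\<close> vanishes to
    second order.\<close>
  obtain v where v0: "\<exists>j<d. v j \<noteq> 0" and v: "\<And>i. i < r \<Longrightarrow> (\<Sum>j<d. v j * Re (c i j)) = 0"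
    using underdetermined_system[of "{..<d}" r "\<lambda>i j. Re (c i j)"] r unfolding d_def by auto
  have small: "quadratically_small (\<lambda>t. \<phi> (ray d v t) i)" if i: "i < r" for i
  proof -
    obtain K \<delta> where K: "\<delta> > 0" "\<And>t. \<bar>t\<bar> < \<delta> \<Longrightarrow>
      norm (complex_of_real (\<phi> (ray d v t) i) - complex_of_real (\<phi> origin i) - t *\<^sub>R (\<Sum>j<d. v j *\<^sub>R c i j)) \<le> K * t\<^sup>2"
      using c[OF i, of v] unfolding quadratically_small_def by blast
    have "norm (\<phi> (ray d v t) i) \<le> K * t\<^sup>2" if "\<bar>t\<bar> < \<delta>" for t
    proof -
      let ?z = "complex_of_real (\<phi> (ray d v t) i) - complex_of_real (\<phi> origin i) - t *\<^sub>R (\<Sum>j<d. v j *\<^sub>R c i j)"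
      have "Re ?z = \<phi> (ray d v t) i"
        using v[OF i] \<phi>0 by simp
      then have "norm (\<phi> (ray d v t) i) \<le> norm ?z" using abs_Re_le_cmod[of ?z] by simp
      then show ?thesis using K(2)[OF that] by (rule order_trans)
    qed
    with K(1) show ?thesis by (rule quadratically_smallI)
  qed
  obtain \<delta> where \<delta>: "\<delta> > 0" "\<And>t. \<bar>t\<bar> < \<delta> \<Longrightarrow> mat_adjoint (S (ray d v t)) * ?B (ray d v t) * S (ray d v t) = \<A> (\<phi> (ray d v t)) \<and>
      S (ray d v t) \<in> carrier_mat n n \<and> \<phi> (ray d v t) \<in> topspace (Euclidean_space r)"
  proof -
    have "\<forall>\<^sub>F x in near d origin. mat_adjoint (S x) * ?B x * S x = \<A> (\<phi> x) \<and> S x \<in> carrier_mat n n \<and> \<phi> x \<in> topspace (Euclidean_space r)"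
      using cong emb S_ev \<phi> by eventually_elim auto
    then show ?thesis using that by (rule ray_eventually)
  qed
  have S_ex: "\<exists>L. ((\<lambda>t. S (ray d v t) $$ (i, j)) has_vector_derivative L) (at 0)" if "i < n" "j < n" for i j
    by (rule analytic_ray_derivative) (use eventually_near_origin[OF S_ev] that in blast)
  define S' where "S' = (\<lambda>i j. SOME L. ((\<lambda>t. S (ray d v t) $$ (i, j)) has_vector_derivative L) (at 0))"
  have S': "((\<lambda>t. S (ray d v t) $$ (i, j)) has_vector_derivative S' i j) (at 0)" if "i < n" "j < n" for i j
    unfolding S'_def by (rule someI_ex[OF S_ex[OF that]])
  define N where "N = (\<lambda>i j. param_mat D (\<lambda>q. v (e q)) $$ (i, j))"
  have B_entry: "?B (ray d v t) $$ (i, j) = a i j + t *\<^sub>R N i j" if "i < n" "j < n" for t i j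
  proof -
    have "param_mat D (\<lambda>q. ray d v t (e q)) $$ (i, j) = t *\<^sub>R N i j"
      using that D params_mem[OF D e that] param_less[OF D e] unfolding N_def ray_def d_def
      by (cases "D $$ (i, j)") (auto simp: param_mat_def scaleR_conv_of_real algebra_simps)
    then show ?thesis unfolding simplest_entry[OF D e A that] a_def by simp
  qed
  \<comment> \<open>Both sides of the congruence are differentiated along the ray at 0: the left
    side gives \<open>tangent n a S' + N\<close>, the right side 0. Hence the pattern direction
    \<open>N\<close> is itself a tangent vector.\<close>
  have N: "N i j = tangent n a (\<lambda>i j. complex_of_real (-1) * S' i j) i j" if ij: "i < n" "j < n" for i j
  proof -
    have 1: "((\<lambda>t. \<Sum>k<n. \<Sum>l<n. cnj (S (ray d v t) $$ (k, i)) * ?B (ray d v t) $$ (k, l) * S (ray d v t) $$ (l, j))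
        has_vector_derivative (tangent n a S' i j + N i j)) (at 0)"
    proof (rule congruence_derivative[where S = "\<lambda>t i j. S (ray d v t) $$ (i, j)" and B = "\<lambda>t i j. ?B (ray d v t) $$ (i, j)"])
      show "S (ray d v 0) $$ (i, j) = (if i = j then 1 else 0)" if "i < n" "j < n" for i j
        using that by (simp add: ray_0 S0)
      show "((\<lambda>t. ?B (ray d v t) $$ (i, j)) has_vector_derivative N i j) (at 0)" if "i < n" "j < n" for i j
        unfolding B_entry[OF that] by (auto intro!: derivative_eq_intros)
      show "?B (ray d v 0) $$ (i, j) = a i j" if "i < n" "j < n" for i j
        unfolding B_entry[OF that] by simp
    qed (use S' ij in auto)
    have 2: "((\<lambda>t. \<A> (\<phi> (ray d v t)) $$ (i, j)) has_vector_derivative 0) (at 0)"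
      by (rule composite_ray_derivative_zero[where f = "\<lambda>y. \<A> y $$ (i, j)" and \<phi> = \<phi>, OF A_analytic[OF ij] \<phi>0 \<delta>(1)]) (use \<delta>(2) small in auto)
    have "((\<lambda>t. \<Sum>k<n. \<Sum>l<n. cnj (S (ray d v t) $$ (k, i)) * ?B (ray d v t) $$ (k, l) * S (ray d v t) $$ (l, j)) has_vector_derivative 0) (at 0)"
    proof (rule has_vector_derivative_transform_within_open[OF 2, where S = "ball 0 \<delta>"])
      fix t :: real assume "t \<in> ball 0 \<delta>"
      then have t: "\<bar>t\<bar> < \<delta>" by simp
      show "\<A> (\<phi> (ray d v t)) $$ (i, j) = (\<Sum>k<n. \<Sum>l<n. cnj (S (ray d v t) $$ (k, i)) * ?B (ray d v t) $$ (k, l) * S (ray d v t) $$ (l, j))"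
        using \<delta>(2)[OF t] adjoint_congruence_entry[OF _ simplest_carrier[OF D e A] ij, of "S (ray d v t)" "ray d v t"] by simp
    qed (use \<delta>(1) in auto)
    from vector_derivative_unique_at[OF 1 this] have "N i j = - tangent n a S' i j"
      by (simp add: eq_neg_iff_add_eq_0 add.commute)
    then show ?thesis unfolding tangent_scale by simp
  qed
  have "tangent n a (\<lambda>i j. complex_of_real (-1) * S' i j) i j = 0" if "i < n" "j < n" for i j
    unfolding a_def
  proof (rule transversal[OF _ that])
    fix i j assume ij: "i < n" "j < n"
    show "sym_ok (D $$ (i, j)) (tangent n (\<lambda>i j. A $$ (i, j)) (\<lambda>i j. complex_of_real (-1) * S' i j) i j)"
      using param_mat_sym_ok[OF D e ij, of "\<lambda>q. v (e q)"] N[OF ij] unfolding N_def a_def by simp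
  qed
  then have "param_mat D (\<lambda>q. v (e q)) $$ (i, j) = 0" if "i < n" "j < n" for i j
    using N[OF that] that unfolding N_def by simp
  \<comment> \<open>The pattern matrix with parameters \<open>v\<close> is zero, so every parameter
    is zero, against the choice of \<open>v\<close>.\<close>
  then have ve: "v (e q) = 0" if "q \<in> params D" for q
    by (rule param_mat_inj[OF D e _ that])
  obtain j where j: "j < d" "v j \<noteq> 0" using v0 by blast
  then have "j \<in> e ` params D" using e by (simp add: bij_betw_def d_def)
  then obtain q where q: "j = e q" "q \<in> params D" by (rule imageE)
  show False using ve[OF q(2)] j(2) q(1) by simp
qed

theorem theorem3p1:
  fixes n :: nat
    and Hs Deltas :: "(nat \<times> complex) list"
    and Js :: "nat list"
    and As :: "summand list"
    and A :: "complex mat"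
    and D :: "symb mat"
    and e :: "param \<Rightarrow> nat"
  assumes H: "\<forall>(p, \<nu>) \<in> set Hs. 0 < p \<and> 1 < cmod \<nu>"
    and Delta: "\<forall>(q, \<mu>) \<in> set Deltas. 0 < q \<and> cmod \<mu> = 1"
    and J: "\<forall>r \<in> set Js. 0 < r" "sorted_wrt (\<ge>) Js"
    and As: "As = map (\<lambda>(p, \<nu>). HBlock p \<nu>) Hs @ map (\<lambda>(q, \<mu>). DeltaBlock q \<mu>) Deltas @ map JBlock Js"
    and A: "A = canonical_mat As" "A \<in> carrier_mat n n"
    and D: "D \<in> D_matrices As"
    and e: "bij_betw e (params D) {..<num_params D}"
  shows "miniversal n (num_params D) A (simplest_deformation A D e)"
proof -
  have canonical: "\<forall>s\<in>set As. canonical_summand s"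
    unfolding As using H Delta J(1) by auto
  have n: "n = block_offset As (length As)"
    using A canonical_mat_carrier[of As] by auto
  have Dc: "D \<in> carrier_mat n n"
    using D unfolding D_matrices_def n by simp
  have "versal n (num_params D) A (simplest_deformation A D e)"
  proof (rule simplest_versal[OF A(2) Dc e])
    fix W i j
    assume "\<And>i j. i < n \<Longrightarrow> j < n \<Longrightarrow> cotangent n (\<lambda>i j. A $$ (i, j)) W i j = 0"
      and "\<And>i j. i < n \<Longrightarrow> j < n \<Longrightarrow> dual_ok (D $$ (i, j)) (W i j)" "i < n" "j < n"
    then show "W i j = 0"
      unfolding A(1) n by (rule cotangent_spanning[OF canonical D])
  qed
  moreover have "\<not> versal n r A \<A>" if "r < num_params D" for r \<A>
  proof (rule no_smaller_versal[OF A(2) Dc e _ that])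
    fix C i j
    assume "\<And>i j. i < n \<Longrightarrow> j < n \<Longrightarrow> sym_ok (D $$ (i, j)) (tangent n (\<lambda>i j. A $$ (i, j)) C i j)" "i < n" "j < n"
    then show "tangent n (\<lambda>i j. A $$ (i, j)) C i j = 0"
      unfolding A(1) n by (rule tangent_transversal[OF canonical D])
  qed
  ultimately show ?thesis unfolding miniversal_def by blast
qed

end
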